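(* Let $p\in\mathbb{C}[z_1,z_2]$ be semi-stable of bidegree $(n,m)$, let $q(z)=z_2^mp(z_1,1/z_2)$ and $\tilde q(z)=z_2^m\tilde p(z_1,1/z_2)$. Then for each $\lambda\in Z_q\cap Z_{\tilde q}\cap\mathbb{D}^2$, \[ N_\lambda(q,\tilde q)=\dim\mathcal{G}_\lambda, \] and consequently $\dim\mathcal{G}=\sum_{\lambda\in Z_q\cap Z_{\tilde q}\cap\mathbb{D}^2}N_\lambda(q,\tilde q)$.
   Context: $\mathbb{D}$ is the open unit disk, $\mathbb{T}$ the unit circle, $\sigma$ normalized Lebesgue measure on $\mathbb{T}^2$. For $p$ of bidegree $(n,m)$, $\tilde p(z)=z_1^nz_2^m\overline{p(1/\bar z_1,1/\bar z_2)}$; $p$ is semi-stable if it has no zeros in $\mathbb{D}^2$ and $p,\tilde p$ have no common factor. $Z_Q=\{z\in\mathbb{C}^2:Q(z)=0\}$. In the Hilbert space $L^2(\frac1{|p|^2}d\sigma)$ let $\mathcal{G}$ be the (finite-dimensional) subspace of polynomials of bidegree at most $(n-1,m-1)$, $P$ the orthogonal projection onto $\mathcal{G}$, and $T_j:\mathcal{G}\to\mathcal{G}$, $T_jf=P(z_jf)$ for $j=1,2$; $T_2^*$ is the adjoint of $T_2$ on $\mathcal{G}$. For $\lambda\in\mathbb{C}^2$, $\mathcal{G}_\lambda=\{f\in\mathcal{G}:\exists N,M,\ (T_1-\lambda_1)^Nf=(T_2^*-\lambda_2)^Mf=0\}$. The intersection multiplicity $N_\lambda(f,g)=\dim_{\mathbb{C}}\mathcal{O}_\lambda/\langle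 f,g\rangle\mathcal{O}_\lambda$, with $\mathcal{O}_\lambda$ the ring of rational functions whose denominators do not vanish at $\lambda$. *)

theory Defs
  imports "HOL-Analysis.Analysis" "HOL-Computational_Algebra.Polynomial"
    "HOL-Computational_Algebra.Polynomial_Factorial" "HOL-Computational_Algebra.Fraction_Field"
begin

(* Bivariate polynomials in z1, z2 are represented as complex poly poly:
   the outer variable is z2, the coefficients are polynomials in z1. *)

definition eval2 :: "complex poly poly \<Rightarrow> complex \<Rightarrow> complex \<Rightarrow> complex" where
  "eval2 f z1 z2 = poly (map_poly (\<lambda>a. poly a z1) f) z2"

definition cf :: "complex poly poly \<Rightarrow> nat \<Rightarrow> nat \<Rightarrow> complex" where
  "cf f i j = coeff (coeff f j) i"

definition mk2 :: "(nat \<Rightarrow> nat \<Rightarrow> complex) \<Rightarrow> nat \<Rightarrow> nat \<Rightarrow> complex poly poly" where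
  "mk2 c a b = (\<Sum>j\<le>b. monom (\<Sum>i\<le>a. monom (c i j) i) j)"

definition has_bidegree :: "complex poly poly \<Rightarrow> nat \<Rightarrow> nat \<Rightarrow> bool" where
  "has_bidegree p n m \<longleftrightarrow> (\<forall>i j. cf p i j \<noteq> 0 \<longrightarrow> i \<le> n \<and> j \<le> m)
      \<and> (\<exists>j. cf p n j \<noteq> 0) \<and> (\<exists>i. cf p i m \<noteq> 0)"

(* p tilde (z) = z1^n z2^m conj(p(1/conj z1, 1/conj z2)) *)
definition refl2 :: "complex poly poly \<Rightarrow> nat \<Rightarrow> nat \<Rightarrow> complex poly poly" where
  "refl2 p n m = mk2 (\<lambda>i j. cnj (cf p (n - i) (m - j))) n m"

(* z2^m f(z1, 1/z2) for f of bidegree at most (n,m) *)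
definition flip2 :: "complex poly poly \<Rightarrow> nat \<Rightarrow> nat \<Rightarrow> complex poly poly" where
  "flip2 f n m = mk2 (\<lambda>i j. cf f i (m - j)) n m"

definition semi_stable :: "complex poly poly \<Rightarrow> nat \<Rightarrow> nat \<Rightarrow> bool" where
  "semi_stable p n m \<longleftrightarrow>
     (\<forall>z1 z2. cmod z1 < 1 \<longrightarrow> cmod z2 < 1 \<longrightarrow> eval2 p z1 z2 \<noteq> 0)
     \<and> coprime p (refl2 p n m)"

definition common_zeros_bidisk :: "complex poly poly \<Rightarrow> complex poly poly \<Rightarrow> (complex \<times> complex) set" where
  "common_zeros_bidisk f g = {l. eval2 f (fst l) (snd l) = 0 \<and> eval2 g (fst l) (snd l) = 0
                                 \<and> cmod (fst l) < 1 \<and> cmod (snd l) < 1}"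

(* T^2 is parametrised by (s,t) \<in> [0,2pi]^2, z = (cis s, cis t); \<sigma> = Lebesgue/(4 pi^2) *)

definition Tmeas :: "(real \<times> real) measure" where
  "Tmeas = lebesgue_on ({0..2*pi} \<times> {0..2*pi})"

definition tor :: "complex poly poly \<Rightarrow> real \<times> real \<Rightarrow> complex" where
  "tor f x = eval2 f (cis (fst x)) (cis (snd x))"

definition wt :: "complex poly poly \<Rightarrow> real \<times> real \<Rightarrow> real" where
  "wt p x = 1 / ((cmod (tor p x))\<^sup>2 * (4 * pi\<^sup>2))"

definition inL2 :: "complex poly poly \<Rightarrow> (real \<times> real \<Rightarrow> complex) \<Rightarrow> bool" where
  "inL2 p F \<longleftrightarrow> F \<in> borel_measurable Tmeas \<and> integrable Tmeas (\<lambda>x. (cmod (F x))\<^sup>2 * wt p x)"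

definition ipw :: "complex poly poly \<Rightarrow> (real \<times> real \<Rightarrow> complex) \<Rightarrow> (real \<times> real \<Rightarrow> complex) \<Rightarrow> complex" where
  "ipw p F G = (LINT x|Tmeas. F x * cnj (G x) * complex_of_real (wt p x))"

definition Gsp :: "complex poly poly \<Rightarrow> nat \<Rightarrow> nat \<Rightarrow> complex poly poly set" where
  "Gsp p n m = {f. (\<forall>i j. cf f i j \<noteq> 0 \<longrightarrow> i < n \<and> j < m) \<and> inL2 p (tor f)}"

definition Top1 :: "complex poly poly \<Rightarrow> nat \<Rightarrow> nat \<Rightarrow> complex poly poly \<Rightarrow> complex poly poly" where
  "Top1 p n m f = (THE g. g \<in> Gsp p n m \<and>
     (\<forall>h\<in>Gsp p n m. ipw p (\<lambda>x. cis (fst x) * tor f x - tor g x) (tor h) = 0))"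

definition Top2 :: "complex poly poly \<Rightarrow> nat \<Rightarrow> nat \<Rightarrow> complex poly poly \<Rightarrow> complex poly poly" where
  "Top2 p n m f = (THE g. g \<in> Gsp p n m \<and>
     (\<forall>h\<in>Gsp p n m. ipw p (\<lambda>x. cis (snd x) * tor f x - tor g x) (tor h) = 0))"

definition Top2adj :: "complex poly poly \<Rightarrow> nat \<Rightarrow> nat \<Rightarrow> complex poly poly \<Rightarrow> complex poly poly" where
  "Top2adj p n m f = (THE g. g \<in> Gsp p n m \<and>
     (\<forall>h\<in>Gsp p n m. ipw p (tor g) (tor h) = ipw p (tor f) (tor (Top2 p n m h))))"

definition Gloc :: "complex poly poly \<Rightarrow> nat \<Rightarrow> nat \<Rightarrow> complex \<times> complex \<Rightarrow> complex poly poly set" where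
  "Gloc p n m l = {f \<in> Gsp p n m. \<exists>N M.
      ((\<lambda>g. Top1 p n m g - smult [:fst l:] g) ^^ N) f = 0 \<and>
      ((\<lambda>g. Top2adj p n m g - smult [:snd l:] g) ^^ M) f = 0}"

definition cscale :: "complex \<Rightarrow> complex poly poly \<Rightarrow> complex poly poly" where
  "cscale c f = smult [:c:] f"

definition cdim :: "complex poly poly set \<Rightarrow> nat" where
  "cdim S = vector_space.dim cscale S"

definition Oloc :: "complex \<times> complex \<Rightarrow> complex poly poly fract set" where
  "Oloc l = {x. \<exists>a b. eval2 b (fst l) (snd l) \<noteq> 0 \<and> x = Fract a b}"

definition Iloc :: "complex \<times> complex \<Rightarrow> complex poly poly \<Rightarrow> complex poly poly \<Rightarrow> complex poly poly fract set" where
  "Iloc l f g = {x. \<exists>u\<in>Oloc l. \<exists>v\<in>Oloc l. x = u * Fract f 1 + v * Fract g 1}"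

definition fsc :: "complex \<Rightarrow> complex poly poly fract" where
  "fsc c = Fract [:[:c:]:] 1"

definition quot_has_dim :: "complex \<times> complex \<Rightarrow> complex poly poly \<Rightarrow> complex poly poly \<Rightarrow> nat \<Rightarrow> bool" where
  "quot_has_dim l f g d \<longleftrightarrow> (\<exists>e :: nat \<Rightarrow> complex poly poly fract.
      (\<forall>i<d. e i \<in> Oloc l) \<and>
      (\<forall>c. (\<Sum>i<d. fsc (c i) * e i) \<in> Iloc l f g \<longrightarrow> (\<forall>i<d. c i = 0)) \<and>
      (\<forall>x\<in>Oloc l. \<exists>c. x - (\<Sum>i<d. fsc (c i) * e i) \<in> Iloc l f g))"

definition int_mult :: "complex \<times> complex \<Rightarrow> complex poly poly \<Rightarrow> complex poly poly \<Rightarrow> nat" where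
  "int_mult l f g = (THE d. quot_has_dim l f g d)"

end

theory Submission
  imports Defs "HOL-Complex_Analysis.Complex_Analysis" "HOL-Computational_Algebra.Field_as_Ring"
    "HOL-Computational_Algebra.Fundamental_Theorem_Algebra"
begin

text \<open>
  Pass to the variables \<open>(z1, 1/z2)\<close>, so that \<open>T1\<close> and the adjoint of \<open>T2\<close> become compressions of
  multiplication by \<open>z1\<close> and \<open>z2\<close> in \<open>L\<^sup>2(1/|q|\<^sup>2)\<close>. Let \<open>I\<close> be the ideal of \<open>q\<close> and its companion \<open>qt\<close>.
  Elimination puts products \<open>u1(z1) v1(z1)\<close> and \<open>u2(z2) v2(z2)\<close> into \<open>I\<close>, where the roots of the \<open>u\<close>'s lie in
  the open disk and those of the \<open>v\<close>'s do not. Let \<open>N\<close> be the ideal of all \<open>f\<close> with \<open>v1 v2 f\<close> in \<open>I\<close>; it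
  is the part of \<open>I\<close> that is visible in the bidisk.

  If \<open>f\<close> is a square integrable polynomial, then \<open>f/q\<close> has its Fourier support in \<open>i \<ge> 0\<close> and \<open>f/qt\<close> in
  \<open>j \<ge> 0\<close>. If \<open>f\<close> is moreover a limit of polynomials and orthogonal to \<open>I\<close>, then the supports shrink to
  \<open>i \<ge> 0 > j\<close> and \<open>j \<ge> 0 > i\<close>, so the support of \<open>f\<close> is in the box and \<open>f\<close> belongs to the space \<open>G\<close>. Since
  \<open>N\<close> is closed and orthogonal to \<open>G\<close> (factors with roots off the open disk are cyclic), the polynomial
  ring is the direct sum of \<open>G\<close> and \<open>N\<close>. Hence the compressions are multiplication by \<open>z1\<close> and \<open>z2\<close> modulo
  \<open>N\<close>, and the generalized eigenspaces are the local rings modulo \<open>I\<close> at the points of the bidisk.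
\<close>

section \<open>Polynomials in two variables on the torus\<close>

text \<open>The obstacle is that \<open>p\<close> may vanish on the torus: the weight is then
  unbounded, and a polynomial need not be square integrable, so it cannot be projected directly. The
  identity \<open>u1 v1 = a q + b qt\<close> repairs this: \<open>u1\<close> is bounded away from 0
  on the torus and the right side is at most a multiple of |p|, so \<open>v1\<close> is square
  integrable. Since \<open>u\<close> and \<open>v\<close> are comaximal in each variable, some
  multiple \<open>e\<close> of \<open>v1\<close> has \<open>1 - e\<close> in \<open>N\<close>, and
  every \<open>f\<close> may be replaced by \<open>f e\<close>. Polynomials are not complete in the
  weighted norm, so a minimizing sequence stands in for the projection: its coefficients converge,
  the support argument makes the limit a polynomial in the box, and Fatou's lemma recovers weighted
  estimates. That \<open>N\<close> is closed is then a finite-dimensional fact: division by linear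
  factors with roots inside the disk is bounded in terms of coefficients, so the coordinates modulo
  \<open>N\<close> of a null sequence tend to 0. Cyclicity of the other factors comes from averaging
  a geometric sequence.\<close>

lemma eval2_altdef: "eval2 f z1 z2 = poly (poly f [:z2:]) z1"
  unfolding eval2_def
  by (induction f) (simp_all add: map_poly_pCons)

lemma eval2_simps [simp]:
  "eval2 0 z1 z2 = 0" "eval2 1 z1 z2 = 1"
  "eval2 (f + g) z1 z2 = eval2 f z1 z2 + eval2 g z1 z2"
  "eval2 (f - g) z1 z2 = eval2 f z1 z2 - eval2 g z1 z2"
  "eval2 (- f) z1 z2 = - eval2 f z1 z2"
  "eval2 (f * g) z1 z2 = eval2 f z1 z2 * eval2 g z1 z2"
  "eval2 (f ^ k) z1 z2 = eval2 f z1 z2 ^ k"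
  "eval2 [:a:] z1 z2 = poly a z1"
  "eval2 (pCons a f) z1 z2 = poly a z1 + z2 * eval2 f z1 z2"
  "eval2 (smult a f) z1 z2 = poly a z1 * eval2 f z1 z2"
  "eval2 (monom a k) z1 z2 = poly a z1 * z2 ^ k"
  by (simp_all add: eval2_altdef poly_monom)

lemma eval2_sum [simp]: "eval2 (\<Sum>x\<in>A. f x) z1 z2 = (\<Sum>x\<in>A. eval2 (f x) z1 z2)"
  by (simp add: eval2_altdef poly_sum)

lemma continuous_on_eval2 [continuous_intros]:
  assumes "continuous_on S a" "continuous_on S b"
  shows "continuous_on S (\<lambda>x. eval2 f (a x) (b x))"
  by (induction f) (auto intro!: continuous_intros assms)

lemma cf_simps [simp]:
  "cf 0 i j = 0" "cf (f + g) i j = cf f i j + cf g i j" "cf (f - g) i j = cf f i j - cf g i j"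
  "cf (smult [:c:] f) i j = c * cf f i j"
  by (simp_all add: cf_def)

lemma cf_sum [simp]: "cf (\<Sum>x\<in>A. f x) i j = (\<Sum>x\<in>A. cf (f x) i j)"
  by (simp add: cf_def coeff_sum)

lemma cf_eqI: "(\<And>i j. cf f i j = cf g i j) \<Longrightarrow> f = g"
  by (simp add: cf_def poly_eq_iff)

lemma cf_monom [simp]: "cf (monom (monom c a) b) i j = (if i = a \<and> j = b then c else 0)"
  by (simp add: cf_def)

text \<open>Strict bounds make \<open>pbox n m\<close> the support condition of \<open>Gsp\<close>,
  correct also for \<open>n = 0\<close> or \<open>m = 0\<close>, where only 0 is left.\<close>

definition pbox :: "nat \<Rightarrow> nat \<Rightarrow> complex poly poly set" where
  "pbox n m = {f. \<forall>i j. cf f i j \<noteq> 0 \<longrightarrow> i < n \<and> j < m}"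

definition mkb :: "(nat \<Rightarrow> nat \<Rightarrow> complex) \<Rightarrow> nat \<Rightarrow> nat \<Rightarrow> complex poly poly" where
  "mkb c n m = (\<Sum>i<n. \<Sum>j<m. monom (monom (c i j) i) j)"

lemma cf_mkb [simp]: "cf (mkb c n m) i j = (if i < n \<and> j < m then c i j else 0)"
proof -
  have "cf (mkb c n m) i j = (\<Sum>a<n. \<Sum>b<m. if i = a then (if j = b then c a b else 0) else 0)"
    by (simp add: mkb_def if_conn)
  also have "\<dots> = (\<Sum>a<n. if i = a then (\<Sum>b<m. if j = b then c a b else 0) else 0)"
    by (rule sum.cong) (simp_all only: sum.neutral_const split: if_split, simp)
  finally show ?thesis by simp
qed

lemma monom_sum: "monom (\<Sum>i\<in>A. g i) k = (\<Sum>i\<in>A. monom (g i) k)"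
  by (rule poly_eqI) (simp add: coeff_sum)

lemma mk2_eq_mkb: "mk2 c n m = mkb c (Suc n) (Suc m)"
  unfolding mk2_def mkb_def monom_sum lessThan_Suc_atMost by (rule sum.swap)

lemma cf_mk2 [simp]: "cf (mk2 c n m) i j = (if i \<le> n \<and> j \<le> m then c i j else 0)"
  unfolding mk2_eq_mkb cf_mkb by (simp add: less_Suc_eq_le)

lemma pbox_eq_mkb: "f \<in> pbox n m \<Longrightarrow> f = mkb (cf f) n m"
  by (rule cf_eqI) (auto simp: pbox_def)

lemma ex_pbox: "\<exists>N M. f \<in> pbox N M"
proof (intro exI)
  let ?N = "\<Sum>j\<le>degree f. degree (coeff f j)"
  have "i < Suc ?N \<and> j < Suc (degree f)" if ij: "coeff (coeff f j) i \<noteq> 0" for i j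
  proof -
    from ij have "coeff f j \<noteq> 0" by (metis coeff_0)
    hence j: "j \<le> degree f" by (rule le_degree)
    have "i \<le> degree (coeff f j)" using ij by (rule le_degree)
    also have "\<dots> \<le> ?N"
      using j by (intro member_le_sum[of j "{..degree f}" "\<lambda>j. degree (coeff f j)"]) simp_all
    finally show ?thesis using j by (simp only: less_Suc_eq_le)
  qed
  thus "f \<in> pbox (Suc ?N) (Suc (degree f))"
    unfolding pbox_def cf_def by blast
qed

lemma pbox_mono: "f \<in> pbox n m \<Longrightarrow> n \<le> n' \<Longrightarrow> m \<le> m' \<Longrightarrow> f \<in> pbox n' m'"
  unfolding pbox_def mem_Collect_eq using order.strict_trans2 by blast

lemma eval2_mkb: "eval2 (mkb c n m) z1 z2 = (\<Sum>i<n. \<Sum>j<m. c i j * z1 ^ i * z2 ^ j)"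
  by (simp add: mkb_def poly_monom del: poly_sum)

lemma eval2_box: "f \<in> pbox n m \<Longrightarrow> eval2 f z1 z2 = (\<Sum>i<n. \<Sum>j<m. cf f i j * z1 ^ i * z2 ^ j)"
  using eval2_mkb[of "cf f" n m z1 z2] pbox_eq_mkb[of f n m] by simp

lemma pbox_Suc_mk2: "mk2 c n m \<in> pbox (Suc n) (Suc m)"
  by (simp add: pbox_def less_Suc_eq_le)

lemma has_bidegree_box: "has_bidegree p n m \<Longrightarrow> p \<in> pbox (Suc n) (Suc m)"
  by (simp add: has_bidegree_def pbox_def less_Suc_eq_le)

text \<open>The torus trace in the variables \<open>(z1, 1/z2)\<close>, in which \<open>flip2\<close> is multiplication by a monomial.\<close>
definition tf :: "complex poly poly \<Rightarrow> real \<times> real \<Rightarrow> complex" where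
  "tf f x = eval2 f (cis (fst x)) (cis (- snd x))"

lemma tf_simps [simp]:
  "tf 0 x = 0" "tf 1 x = 1"
  "tf (f + g) x = tf f x + tf g x"
  "tf (f - g) x = tf f x - tf g x"
  "tf (f * g) x = tf f x * tf g x"
  "tf (smult [:c:] g) x = c * tf g x"
  by (simp_all add: tf_def)

text \<open>The character of the torus with frequency (i, j). The indices are integers because
  conjugates and quotients bring in negative frequencies.\<close>

definition ee :: "int \<Rightarrow> int \<Rightarrow> real \<times> real \<Rightarrow> complex" where
  "ee i j x = cis (of_int i * fst x + of_int j * snd x)"

lemma ee_mult: "ee i j x * ee k l x = ee (i + k) (j + l) x"
  by (simp add: ee_def cis_mult algebra_simps)

lemma cnj_ee: "cnj (ee i j x) = ee (- i) (- j) x"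
  by (simp add: ee_def cis_cnj)

lemma norm_ee [simp]: "cmod (ee i j x) = 1"
  by (simp add: ee_def)

lemma ee_0 [simp]: "ee 0 0 x = 1"
  by (simp add: ee_def)

lemma cis_power_ee: "cis (fst x) ^ i * cis (snd x) ^ j = ee (int i) (int j) x"
  unfolding ee_def Complex.DeMoivre cis_mult by simp

lemma cis_power_ee': "cis (fst x) ^ i * cis (- snd x) ^ j = ee (int i) (- int j) x"
  unfolding ee_def Complex.DeMoivre cis_mult by simp

lemma tf_box: "f \<in> pbox N M \<Longrightarrow> tf f x = (\<Sum>i<N. \<Sum>j<M. cf f i j * ee (int i) (- int j) x)"
  unfolding tf_def cis_power_ee' [symmetric] by (subst eval2_box) (simp_all add: mult.assoc)

lemma tor_box: "f \<in> pbox N M \<Longrightarrow> tor f x = (\<Sum>i<N. \<Sum>j<M. cf f i j * ee (int i) (int j) x)"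
  unfolding tor_def cis_power_ee [symmetric] by (subst eval2_box) (simp_all add: mult.assoc)

lemma continuous_on_tf: "continuous_on S (tf f)"
  unfolding tf_def [abs_def] by (auto intro!: continuous_intros)

lemma continuous_on_tor: "continuous_on S (tor f)"
  unfolding tor_def [abs_def] by (auto intro!: continuous_intros)

lemma continuous_on_ee: "continuous_on S (ee i j)"
  unfolding ee_def [abs_def] by (auto intro!: continuous_intros)

lemma sum_flip: "(\<Sum>j<Suc m. g j) = (\<Sum>j<Suc m. g (m - j))"
  using sum.nat_diff_reindex[of g "Suc m"] by simp

lemma tf_flip2:
  assumes "f \<in> pbox (Suc n) (Suc m)"
  shows "tf (flip2 f n m) x = ee 0 (- int m) x * tor f x"
proof -
  have "tf (flip2 f n m) x = (\<Sum>i<Suc n. \<Sum>j<Suc m. cf f i (m - j) * ee (int i) (- int j) x)"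
    unfolding flip2_def by (subst tf_box[OF pbox_Suc_mk2]) (auto intro!: sum.cong)
  also have "\<dots> = (\<Sum>i<Suc n. \<Sum>j<Suc m. cf f i j * ee (int i) (- int (m - j)) x)"
    by (subst (2) sum_flip) (intro sum.cong refl, simp)
  also have "\<dots> = (\<Sum>i<Suc n. \<Sum>j<Suc m. ee 0 (- int m) x * (cf f i j * ee (int i) (int j) x))"
    by (intro sum.cong refl) (simp add: ee_mult of_nat_diff mult.left_commute[of "ee 0 (- int m) x"] del: sum.lessThan_Suc)
  finally show ?thesis
    by (subst tor_box[OF assms]) (simp add: sum_distrib_left del: sum.lessThan_Suc)
qed

lemma tor_refl2:
  assumes "f \<in> pbox (Suc n) (Suc m)"
  shows "tor (refl2 f n m) x = ee (int n) (int m) x * cnj (tor f x)"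
proof -
  have "tor (refl2 f n m) x = (\<Sum>i<Suc n. \<Sum>j<Suc m. cnj (cf f (n - i) (m - j)) * ee (int i) (int j) x)"
    unfolding refl2_def by (subst tor_box[OF pbox_Suc_mk2]) (auto intro!: sum.cong)
  also have "\<dots> = (\<Sum>i<Suc n. \<Sum>j<Suc m. cnj (cf f i j) * ee (int (n - i)) (int (m - j)) x)"
    by (subst sum_flip, subst (2) sum_flip) (intro sum.cong refl, auto)
  also have "\<dots> = (\<Sum>i<Suc n. \<Sum>j<Suc m. ee (int n) (int m) x * (cnj (cf f i j) * cnj (ee (int i) (int j) x)))"
    by (intro sum.cong refl) (simp add: ee_mult cnj_ee of_nat_diff mult.left_commute[of "ee (int n) (int m) x"] del: sum.lessThan_Suc)
  finally show ?thesis
    by (subst tor_box[OF assms]) (simp add: sum_distrib_left del: sum.lessThan_Suc)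
qed

lemma flip2_in_box: "flip2 f n m \<in> pbox (Suc n) (Suc m)"
  unfolding flip2_def by (rule pbox_Suc_mk2)

lemma refl2_in_box: "refl2 f n m \<in> pbox (Suc n) (Suc m)"
  unfolding refl2_def by (rule pbox_Suc_mk2)

text \<open>The two powers of z2 cancel. For \<open>f = p\<close>, the companion of \<open>q\<close>
  is on the torus the conjugate of \<open>p\<close> up to a power of z1, so \<open>p\<close>,
  \<open>q\<close> and the companion have the same modulus there.\<close>

lemma tf_flip2_refl2:
  assumes "f \<in> pbox (Suc n) (Suc m)"
  shows "tf (flip2 (refl2 f n m) n m) x = ee (int n) 0 x * cnj (tor f x)"
  by (simp add: tf_flip2[OF refl2_in_box] tor_refl2[OF assms] mult.assoc[symmetric] ee_mult)

section \<open>Ideals and elimination\<close>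

definition is_ideal :: "'a::comm_ring_1 set \<Rightarrow> bool" where
  "is_ideal I \<longleftrightarrow> 0 \<in> I \<and> (\<forall>x\<in>I. \<forall>y\<in>I. x + y \<in> I) \<and> (\<forall>a. \<forall>x\<in>I. a * x \<in> I)"

lemma is_idealD:
  assumes "is_ideal I"
  shows "0 \<in> I" "x \<in> I \<Longrightarrow> y \<in> I \<Longrightarrow> x + y \<in> I" "x \<in> I \<Longrightarrow> a * x \<in> I"
    "x \<in> I \<Longrightarrow> x * a \<in> I" "x \<in> I \<Longrightarrow> - x \<in> I" "x \<in> I \<Longrightarrow> y \<in> I \<Longrightarrow> x - y \<in> I"
proof -
  show "0 \<in> I" and add: "x \<in> I \<Longrightarrow> y \<in> I \<Longrightarrow> x + y \<in> I" and m: "x \<in> I \<Longrightarrow> a * x \<in> I" for a x y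
    using assms by (auto simp: is_ideal_def)
  show "x \<in> I \<Longrightarrow> x * a \<in> I" using m[of x a] by (simp add: mult.commute)
  show n: "x \<in> I \<Longrightarrow> - x \<in> I" for x using m[of x "-1"] by simp
  show "x \<in> I \<Longrightarrow> y \<in> I \<Longrightarrow> x - y \<in> I" using add[of x "- y"] n[of y] by simp
qed

lemma is_ideal_sum:
  assumes "is_ideal I" "\<And>x. x \<in> A \<Longrightarrow> f x \<in> I"
  shows "sum f A \<in> I"
  using assms(2) by (induction A rule: infinite_finite_induct) (auto intro: is_idealD[OF assms(1)])

lemma is_ideal_dvd: "is_ideal I \<Longrightarrow> x \<in> I \<Longrightarrow> x dvd y \<Longrightarrow> y \<in> I"
  by (auto elim!: dvdE intro: is_idealD)

text \<open>Serves twice: for \<open>N\<close> itself, and for the annihilator of an element modulo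
  \<open>N\<close>.\<close>

lemma is_ideal_colon: "is_ideal I \<Longrightarrow> is_ideal {f. a * f \<in> I}"
  unfolding is_ideal_def by (auto simp: distrib_left mult.left_commute[of a])

text \<open>The set is K + (d). It contains 1 exactly when \<open>d\<close> is invertible modulo
  \<open>K\<close>, and this is how it is used.\<close>

lemma is_ideal_add_principal:
  assumes "is_ideal K"
  shows "is_ideal {f. \<exists>r. f - r * d \<in> K}"
  unfolding is_ideal_def
proof (intro conjI ballI allI)
  note I = is_idealD[OF assms]
  show "0 \<in> {f. \<exists>r. f - r * d \<in> K}" using I(1) by (auto intro!: exI[of _ 0])
  show "f + g \<in> {f. \<exists>r. f - r * d \<in> K}"
    if fg: "f \<in> {f. \<exists>r. f - r * d \<in> K}" "g \<in> {f. \<exists>r. f - r * d \<in> K}" for f g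
  proof -
    obtain r r' where r: "f - r * d \<in> K" "g - r' * d \<in> K" using fg by blast
    have eq: "(f - r * d) + (g - r' * d) = (f + g) - (r + r') * d" by (simp add: algebra_simps)
    show ?thesis using I(2)[OF r] unfolding eq by blast
  qed
  show "s * f \<in> {f. \<exists>r. f - r * d \<in> K}" if f: "f \<in> {f. \<exists>r. f - r * d \<in> K}" for s f
  proof -
    obtain r where r: "f - r * d \<in> K" using f by blast
    have eq: "s * (f - r * d) = s * f - (s * r) * d" by (simp add: algebra_simps)
    show ?thesis using I(3)[OF r, of s] unfolding eq by blast
  qed
qed

definition ideal2 :: "'a::comm_ring_1 \<Rightarrow> 'a \<Rightarrow> 'a set" where
  "ideal2 f g = {x. \<exists>a b. x = a * f + b * g}"

lemma ideal2_is_ideal: "is_ideal (ideal2 f g)"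
  unfolding is_ideal_def
proof (intro conjI ballI allI)
  show "0 \<in> ideal2 f g"
    unfolding ideal2_def by (auto intro!: exI[of _ 0])
next
  fix x y assume "x \<in> ideal2 f g" "y \<in> ideal2 f g"
  then obtain a b c d where "x = a * f + b * g" "y = c * f + d * g"
    unfolding ideal2_def by blast
  hence "x + y = (a + c) * f + (b + d) * g" by (simp add: algebra_simps)
  thus "x + y \<in> ideal2 f g" unfolding ideal2_def by blast
next
  fix e x assume "x \<in> ideal2 f g"
  then obtain a b where "x = a * f + b * g"
    unfolding ideal2_def by blast
  hence "e * x = (e * a) * f + (e * b) * g" by (simp add: algebra_simps)
  thus "e * x \<in> ideal2 f g" unfolding ideal2_def by blast
qed

lemma ideal2_gens: "f \<in> ideal2 f g" "g \<in> ideal2 f g"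
proof -
  have "f = 1 * f + 0 * g" "g = 0 * f + 1 * g" by simp_all
  thus "f \<in> ideal2 f g" "g \<in> ideal2 f g" unfolding ideal2_def by blast+
qed

text \<open>Degree means degree in z2. If every prime factor had degree 0, so would their product,
  which \<open>h\<close> divides.\<close>

lemma ex_prime_factor_degree_pos:
  fixes h :: "complex poly poly"
  assumes "degree h > 0"
  shows "\<exists>c. prime c \<and> c dvd h \<and> degree c > 0"
proof (rule ccontr)
  assume neg: "\<not> ?thesis"
  have h0: "h \<noteq> 0" using assms by auto
  have 0: "degree c = 0" if "c \<in># prime_factorization h" for c
    using neg that by (auto dest: in_prime_factors_imp_prime in_prime_factors_imp_dvd)
  have "degree (prod_mset M) = 0" if "\<forall>c\<in>#M. degree c = 0" for M :: "complex poly poly multiset"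
    using that
  proof (induction M)
    case (add c M)
    hence "degree (c * prod_mset M) \<le> 0"
      using degree_mult_le[of c "prod_mset M"] by simp
    thus ?case by simp
  qed auto
  hence "degree (prod_mset (prime_factorization h)) = 0" using 0 by blast
  moreover have dvd: "h dvd prod_mset (prime_factorization h)"
    using associatedD2[OF prod_mset_prime_factorization_weak[OF h0]] .
  moreover have "prod_mset (prime_factorization h) \<noteq> 0"
    by (simp add: prod_mset_zero_iff)
  ultimately have "degree h \<le> 0" using dvd_imp_degree_le[OF dvd] by simp
  thus False using assms by simp
qed

text \<open>An element of least \<open>z2\<close>-degree pseudo-divides the whole ideal, so a factor of positive degree
  would be common to the generators.\<close>
lemma eliminate_z2:
  fixes f g :: "complex poly poly"
  assumes "coprime f g"
  shows "\<exists>r. r \<noteq> 0 \<and> [:r:] \<in> ideal2 f g"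
proof -
  let ?I = "ideal2 f g"
  note I = is_idealD[OF ideal2_is_ideal[of f g]]
  have "\<exists>h. h \<in> ?I \<and> h \<noteq> 0"
  proof (cases "f = 0")
    case True
    hence "g \<noteq> 0" using assms by auto
    thus ?thesis using ideal2_gens(2) by blast
  qed (use ideal2_gens(1) in blast)
  then obtain h where h: "h \<in> ?I" "h \<noteq> 0" and min: "\<And>x. x \<in> ?I \<Longrightarrow> x \<noteq> 0 \<Longrightarrow> degree h \<le> degree x"
    using ex_has_least_nat[of "\<lambda>h. h \<in> ?I \<and> h \<noteq> 0" _ degree] by blast
  show ?thesis
  proof (cases "degree h = 0")
    case True
    then obtain r where "h = [:r:]" by (rule degree_eq_zeroE)
    thus ?thesis using h by auto
  next
    case False
    then obtain c where c: "prime c" "c dvd h" "degree c > 0"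
      using ex_prime_factor_degree_pos by blast
    have "c dvd x" if x: "x \<in> ?I" for x
    proof -
      obtain s r where sr: "pseudo_divmod x h = (s, r)" by fastforce
      define l where "l = coeff h (degree h) ^ (Suc (degree x) - degree h)"
      have l: "l \<noteq> 0" using h by (simp add: l_def)
      have eq: "smult l x = h * s + r" and r: "r = 0 \<or> degree r < degree h"
        using pseudo_divmod[OF h(2) sr] by (simp_all add: l_def)
      have "r = [:l:] * x - h * s" using eq by (simp add: algebra_simps)
      hence "r \<in> ?I" using x h(1) by (simp only: I)
      hence "r = 0" using r min by force
      hence "h dvd [:l:] * x" using eq by simp
      hence "c dvd [:l:] * x" using c by (meson dvd_trans)
      moreover have "\<not> c dvd [:l:]"
        using c(3) l dvd_imp_degree_le[of c "[:l:]"] by auto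
      ultimately show ?thesis
        using prime_dvd_multD[OF c(1)] by blast
    qed
    hence "c dvd f" "c dvd g" using ideal2_gens by blast+
    hence "is_unit c" using assms by (metis coprime_common_divisor)
    thus ?thesis using c(1) by (metis not_prime_unit)
  qed
qed

section \<open>Products of linear factors in one variable\<close>

definition zx :: "complex \<Rightarrow> complex poly poly" where "zx a = [:[:-a, 1:]:]"
definition zy :: "complex \<Rightarrow> complex poly poly" where "zy a = [:[:-a:], 1:]"

lemma eval2_zx [simp]: "eval2 (zx a) z1 z2 = z1 - a"
  by (simp add: zx_def)

lemma eval2_zy [simp]: "eval2 (zy a) z1 z2 = z2 - a"
  by (simp add: zy_def)

lemma eval2_prod_mset [simp]: "eval2 (prod_mset M) z1 z2 = prod_mset (image_mset (\<lambda>f. eval2 f z1 z2) M)"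
  by (induction M) auto

lemma proots_in_ideal:
  assumes I: "is_ideal I" and r: "r \<noteq> 0" "[:r:] \<in> I"
  shows "(\<Prod>x\<in>#proots r. zx x) \<in> I"
proof -
  have *: "[:prod_mset (image_mset (\<lambda>x. [:-x, 1:]) M):] = (\<Prod>x\<in>#M. zx x)" for M
  proof (induction M)
    case (add x M)
    have "[:[:-x, 1:] * prod_mset (image_mset (\<lambda>x. [:-x, 1:]) M):] =
          zx x * [:prod_mset (image_mset (\<lambda>x. [:-x, 1:]) M):]"
      by (simp add: zx_def)
    thus ?case using add by simp
  qed (simp add: one_pCons)
  have "[:r:] = [:[:lead_coeff r:]:] * (\<Prod>x\<in>#proots r. zx x)"
    by (subst complex_poly_decompose_multiset[symmetric]) (simp add: *[symmetric])
  hence "[:[:inverse (lead_coeff r):]:] * [:r:] =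
       ([:[:inverse (lead_coeff r):]:] * [:[:lead_coeff r:]:]) * (\<Prod>x\<in>#proots r. zx x)"
    by (simp only: mult.assoc)
  also have "\<dots> = (\<Prod>x\<in>#proots r. zx x)"
    using r by (simp add: one_pCons[symmetric])
  finally show ?thesis
    using is_idealD(3)[OF I r(2), of "[:[:inverse (lead_coeff r):]:]"] by simp
qed

lemma zx_dvd:
  assumes "\<And>z. eval2 h a z = 0"
  shows "zx a dvd h"
proof -
  have "map_poly (\<lambda>p. poly p a) h = 0"
    using assms unfolding eval2_def poly_all_0_iff_0[symmetric] by simp
  hence "poly (coeff h j) a = 0" for j
    by (metis coeff_0 coeff_map_poly poly_0)
  thus ?thesis unfolding zx_def
    by (simp add: const_poly_dvd_iff poly_eq_0_iff_dvd)
qed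

lemma zx_not_unit: "\<not> is_unit (zx a)"
  by (simp add: zx_def is_unit_const_poly_iff is_unit_iff_degree)

text \<open>Restricted to the line z1 = a, \<open>f\<close> is a nonzero polynomial in z2 and splits
  into linear factors. The product of these factors and the normalized \<open>f\<close> agree on the
  line, so their difference is divisible by z1 - a.\<close>

lemma eliminate_z1_at:
  fixes f :: "complex poly poly"
  assumes "\<not> zx a dvd f"
  shows "\<exists>B w c. (\<Prod>y\<in>#B. zy y) = c * f + w * zx a"
proof -
  define h where "h = map_poly (\<lambda>p. poly p a) f"
  have h: "poly h z = eval2 f a z" for z by (simp add: h_def eval2_def)
  have h0: "h \<noteq> 0" using assms zx_dvd[of f a] h by force
  let ?B = "proots h" and ?c = "[:[:inverse (lead_coeff h):]:]"
  have "zx a dvd (\<Prod>y\<in>#?B. zy y) - ?c * f"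
  proof (rule zx_dvd)
    fix z
    have "poly h z = lead_coeff h * (\<Prod>y\<in>#?B. z - y)"
      by (subst (1) complex_poly_decompose_multiset[symmetric])
         (simp add: poly_prod_mset image_mset.compositionality o_def)
    thus "eval2 ((\<Prod>y\<in>#?B. zy y) - ?c * f) a z = 0"
      using h0 h[of z, symmetric] by (simp add: image_mset.compositionality o_def)
  qed
  then obtain w where "(\<Prod>y\<in>#?B. zy y) - ?c * f = zx a * w" by (elim dvdE)
  hence "(\<Prod>y\<in>#?B. zy y) = ?c * f + w * zx a" by (simp add: algebra_simps)
  thus ?thesis by blast
qed

text \<open>The representation is not symmetric in the variables, so pseudo-division is not repeated
  for z1. Instead, by coprimality one generator survives modulo z1 - a for each root
  \<open>a\<close> in \<open>A\<close>, which gives a polynomial in z2 lying in the ideal modulo z1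
  - a. Multiplying these over \<open>A\<close> leaves an error divisible by the product over
  \<open>A\<close>, and that product is already in the ideal.\<close>

lemma eliminate_z1:
  fixes f g :: "complex poly poly"
  assumes "coprime f g" "(\<Prod>x\<in>#A. zx x) \<in> ideal2 f g"
  shows "\<exists>B. (\<Prod>y\<in>#B. zy y) \<in> ideal2 f g"
proof -
  note I = is_idealD[OF ideal2_is_ideal[of f g]]
  have 1: "\<exists>B w u. u \<in> ideal2 f g \<and> (\<Prod>y\<in>#B. zy y) = u + w * zx a" for a
  proof -
    have "\<not> zx a dvd f \<or> \<not> zx a dvd g"
      using assms(1) zx_not_unit by (metis coprime_common_divisor)
    then obtain h where h: "h \<in> ideal2 f g" "\<not> zx a dvd h" using ideal2_gens(1)[of f g] ideal2_gens(2)[of g f] by metis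
    obtain B w c where "(\<Prod>y\<in>#B. zy y) = c * h + w * zx a" using eliminate_z1_at[OF h(2)] by blast
    moreover have "c * h \<in> ideal2 f g" using h(1) by (rule I)
    ultimately show ?thesis by blast
  qed
  have "\<exists>B w u. u \<in> ideal2 f g \<and> (\<Prod>y\<in>#B. zy y) = u + w * (\<Prod>x\<in>#A. zx x)"
  proof (induction A)
    case empty
    have "(\<Prod>y\<in>#{#}. zy y) = 0 + 1 * (\<Prod>x\<in>#{#}. zx x)" by simp
    thus ?case using I(1) by blast
  next
    case (add a A)
    then obtain B w u where B: "u \<in> ideal2 f g" "(\<Prod>y\<in>#B. zy y) = u + w * (\<Prod>x\<in>#A. zx x)" by blast
    obtain B' w' u' where B': "u' \<in> ideal2 f g" "(\<Prod>y\<in>#B'. zy y) = u' + w' * zx a" using 1 by blast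
    have "(\<Prod>y\<in>#B + B'. zy y) = (u * (u' + w' * zx a) + (w * (\<Prod>x\<in>#A. zx x)) * u')
        + (w * w') * (\<Prod>x\<in>#add_mset a A. zx x)"
      by (simp add: B(2) B'(2) algebra_simps)
    moreover have "u * (u' + w' * zx a) + (w * (\<Prod>x\<in>#A. zx x)) * u' \<in> ideal2 f g"
      using B(1) B'(1) by (intro I)
    ultimately show ?case by blast
  qed
  then obtain B w u where "u \<in> ideal2 f g" "(\<Prod>y\<in>#B. zy y) = u + w * (\<Prod>x\<in>#A. zx x)" by blast
  moreover have "w * (\<Prod>x\<in>#A. zx x) \<in> ideal2 f g" using assms(2) by (rule I)
  ultimately have "(\<Prod>y\<in>#B. zy y) \<in> ideal2 f g" using I(2) by simp
  thus ?thesis by blast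
qed

section \<open>Comaximal elements and partitions of unity\<close>

definition comax :: "'a::comm_ring_1 \<Rightarrow> 'a \<Rightarrow> bool" where
  "comax a b \<longleftrightarrow> (\<exists>s t. s * a + t * b = 1)"

lemma comax_sym: "comax a b \<Longrightarrow> comax b a"
  unfolding comax_def by (metis add.commute)

lemma comax_1 [simp]: "comax a 1"
  unfolding comax_def by (rule exI[of _ 0], rule exI[of _ 1]) simp

lemma comax_mult:
  assumes "comax a b" "comax a c"
  shows "comax a (b * c)"
proof -
  obtain s t s' t' where 1: "s * a + t * b = 1" and 2: "s' * a + t' * c = 1"
    using assms unfolding comax_def by blast
  have "(s * a + t * b) * (s' * a + t' * c) = 1" using 1 2 by simp
  hence "(s * (s' * a + t' * c) + t * b * s') * a + (t * t') * (b * c) = 1"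
    by (simp add: algebra_simps)
  thus ?thesis unfolding comax_def by blast
qed

lemma comax_power: "comax a b \<Longrightarrow> comax a (b ^ k)"
  by (induction k) (auto intro: comax_mult)

lemma comax_powers: "comax a b \<Longrightarrow> comax (a ^ j) (b ^ k)"
  by (intro comax_power comax_sym[OF comax_power] comax_sym[of a b])

lemma comax_prod_mset: "(\<And>b. b \<in># M \<Longrightarrow> comax a (f b)) \<Longrightarrow> comax a (\<Prod>b\<in>#M. f b)"
  by (induction M) (auto intro: comax_mult)

lemma comax_prod: "(\<And>b. b \<in> M \<Longrightarrow> comax a (f b)) \<Longrightarrow> comax a (\<Prod>b\<in>M. f b)"
  by (induction M rule: infinite_finite_induct) (auto intro: comax_mult)

lemma comax_diff_const:
  fixes a b :: "complex poly poly"
  assumes "a - b = [:[:c:]:]" "c \<noteq> 0"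
  shows "comax a b"
proof -
  have "k * a + (- k) * b = k * (a - b)" for k :: "complex poly poly"
    by (simp add: algebra_simps)
  hence "[:[:inverse c:]:] * a + (- [:[:inverse c:]:]) * b = [:[:inverse c:]:] * (a - b)" .
  also have "\<dots> = 1" using assms by (simp add: one_pCons)
  finally show ?thesis unfolding comax_def by blast
qed

lemma comax_zx: "x \<noteq> y \<Longrightarrow> comax (zx x) (zx y)"
  by (rule comax_diff_const[of _ _ "y - x"]) (auto simp: zx_def)

lemma comax_zy: "x \<noteq> y \<Longrightarrow> comax (zy x) (zy y)"
  by (rule comax_diff_const[of _ _ "y - x"]) (auto simp: zy_def)

text \<open>The \<open>w x\<close> are the idempotents of the Chinese remainder theorem modulo the
  product of the \<open>L x\<close>: they add up to 1, and \<open>L x\<close> annihilates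
  \<open>w x\<close>.\<close>

lemma partition_of_unity:
  fixes L :: "'k \<Rightarrow> 'a::comm_ring_1"
  assumes "finite X" "\<And>x y. x \<in> X \<Longrightarrow> y \<in> X \<Longrightarrow> x \<noteq> y \<Longrightarrow> comax (L x) (L y)"
  shows "\<exists>w c. (\<Sum>x\<in>X. w x) = 1 + c * (\<Prod>x\<in>X. L x) \<and> (\<forall>x\<in>X. (\<Prod>x\<in>X. L x) dvd L x * w x)"
  using assms
proof (induction X rule: finite_induct)
  case empty
  have "(\<Sum>x\<in>{}. (\<lambda>_. 0 :: 'a) x) = 1 + (-1) * (\<Prod>x\<in>{}. L x)" by simp
  thus ?case by blast
next
  case (insert y X)
  let ?M = "\<Prod>x\<in>X. L x"
  obtain w c where w: "(\<Sum>x\<in>X. w x) = 1 + c * ?M" "\<And>x. x \<in> X \<Longrightarrow> ?M dvd L x * w x"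
    using insert.IH insert.prems by blast
  have "comax (L y) ?M"
    using insert by (intro comax_prod) auto
  then obtain s t where st: "s * L y + t * ?M = 1" unfolding comax_def by blast
  \<comment> \<open>From s L(y) + t M = 1: the summand t M is the idempotent of \<open>y\<close>,
    and the old idempotents are multiplied by the other summand.\<close>
  define w' where "w' = (\<lambda>x. if x = y then t * ?M else s * L y * w x)"
  have "(\<Sum>x\<in>insert y X. w' x) = t * ?M + (\<Sum>x\<in>X. s * L y * w x)"
    using insert(1,2) by (simp add: w'_def) (auto intro!: sum.cong)
  also have "\<dots> = (s * L y + t * ?M) + (s * c) * (L y * ?M)"
    by (simp add: sum_distrib_left[symmetric] w(1) algebra_simps)
  finally have 1: "(\<Sum>x\<in>insert y X. w' x) = 1 + (s * c) * (\<Prod>x\<in>insert y X. L x)"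
    using insert(1,2) st by simp
  have 2: "(\<Prod>x\<in>insert y X. L x) dvd L x * w' x" if "x \<in> insert y X" for x
  proof (cases "x = y")
    case True
    thus ?thesis using insert(1,2) by (auto simp: w'_def mult_ac intro!: dvd_mult)
  next
    case False
    hence x: "x \<in> X" using that by simp
    have "L y * ?M dvd L y * (L x * w x)" using w(2)[OF x] by (rule mult_dvd_mono[OF dvd_refl])
    moreover have "L x * w' x = s * (L y * (L x * w x))" using False by (simp add: w'_def mult_ac)
    ultimately have "L y * ?M dvd L x * w' x" by (metis dvd_mult)
    thus ?thesis using insert(1,2) by simp
  qed
  show ?case
    using 1 2 by (intro exI[of _ w'] exI[of _ "s * c"] conjI) auto
qed

section \<open>Integration on the torus\<close>

abbreviation tbox :: "(real \<times> real) set" where "tbox \<equiv> {0..2*pi} \<times> {0..2*pi}"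

lemma tbox_eq: "tbox = cbox (0, 0) (2*pi, 2*pi)"
  by (simp add: cbox_Pair_eq)

lemma tbox_lebesgue [simp, measurable]: "tbox \<in> sets lebesgue"
  unfolding tbox_eq by simp

lemma integrable_Tmeas_continuous:
  fixes f :: "real \<times> real \<Rightarrow> 'b::euclidean_space"
  assumes "continuous_on tbox f"
  shows "integrable Tmeas f"
  unfolding Tmeas_def tbox_eq
  using assms by (intro absolutely_integrable_imp_integrable absolutely_integrable_continuous) (simp_all add: cbox_Pair_eq)

lemma LINT_Tmeas_continuous:
  fixes f :: "real \<times> real \<Rightarrow> complex"
  assumes "continuous_on tbox f"
  shows "(LINT x|Tmeas. f x) = integral tbox f"
  unfolding Tmeas_def
  using integrable_Tmeas_continuous[OF assms, unfolded Tmeas_def] by (rule lebesgue_integral_eq_integral) simp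

lemma measurable_Tmeas:
  fixes f :: "real \<times> real \<Rightarrow> 'b::topological_space"
  assumes "f \<in> borel_measurable borel"
  shows "f \<in> borel_measurable Tmeas"
  unfolding Tmeas_def using assms
  by (intro measurable_restrict_space1 measurable_completion) simp

lemma measurable_Tmeas_continuous:
  fixes f :: "real \<times> real \<Rightarrow> 'b::topological_space"
  assumes "continuous_on UNIV f"
  shows "f \<in> borel_measurable Tmeas"
  using assms by (intro measurable_Tmeas borel_measurable_continuous_onI)

lemma space_Tmeas [simp]: "space Tmeas = tbox"
  by (simp add: Tmeas_def)

lemma AE_Tmeas:
  assumes "AE x in lborel. P x"
  shows "AE x in Tmeas. P x"
  unfolding Tmeas_def
  using AE_completion[OF assms] by (subst AE_restrict_space_iff) auto

section \<open>Zero sets on the torus are null sets\<close>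

lemma countable_cis: "countable {t. cis t = w}"
proof (cases "\<exists>t0. cis t0 = w")
  case True
  then obtain t0 where t0: "cis t0 = w" by blast
  have "{t. cis t = w} \<subseteq> range (\<lambda>n::int. t0 + 2 * pi * of_int n)"
  proof
    fix t assume "t \<in> {t. cis t = w}"
    hence "cis t = cis t0" using t0 by simp
    hence "sin t = sin t0 \<and> cos t = cos t0" by (metis cis.sel)
    thus "t \<in> range (\<lambda>n::int. t0 + 2 * pi * of_int n)"
      unfolding sin_cos_eq_iff by auto
  qed
  thus ?thesis by (rule countable_subset) simp
qed simp

lemma AE_cis_root: "h \<noteq> (0 :: complex poly) \<Longrightarrow> AE t in lborel. poly h (cis t) \<noteq> 0"
proof -
  assume h: "h \<noteq> 0"
  have "{t. poly h (cis t) = 0} = (\<Union>w\<in>{w. poly h w = 0}. {t. cis t = w})" by auto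
  also have "countable \<dots>"
    using poly_roots_finite[OF h] by (intro countable_UN countable_cis) (auto intro: countable_finite)
  finally have "AE t in lborel. t \<notin> {t. poly h (cis t) = 0}"
    by (intro AE_not_in countable_imp_null_set_lborel)
  thus ?thesis by simp
qed

text \<open>By Fubini: some coefficient of \<open>h\<close> is a nonzero polynomial in z1 and
  vanishes only for countably many s; for all other s the slice in z2 is a nonzero
  polynomial.\<close>

lemma AE_tor_nonzero:
  assumes "h \<noteq> 0"
  shows "AE x in Tmeas. tor h x \<noteq> 0"
proof (rule AE_Tmeas)
  obtain j where j: "coeff h j \<noteq> 0" using assms by (metis leading_coeff_0_iff)
  have "AE s in lborel. AE t in lborel. tor h (s, t) \<noteq> 0"
    using AE_cis_root[OF j]
  proof eventually_elim
    case (elim s)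
    hence "coeff (map_poly (\<lambda>a. poly a (cis s)) h) j \<noteq> 0" by (simp add: coeff_map_poly)
    hence "map_poly (\<lambda>a. poly a (cis s)) h \<noteq> 0" by (metis coeff_0)
    thus ?case unfolding tor_def eval2_def fst_conv snd_conv by (rule AE_cis_root)
  qed
  moreover have "{x \<in> space (lborel \<Otimes>\<^sub>M lborel). tor h x \<noteq> 0} \<in> sets (lborel \<Otimes>\<^sub>M lborel :: (real \<times> real) measure)"
  proof -
    have "open {x. tor h x \<noteq> 0}"
      using continuous_on_tor[of UNIV h] by (intro open_Collect_neq) auto
    moreover have "sets (lborel \<Otimes>\<^sub>M lborel) = sets (borel :: (real \<times> real) measure)"
      by (simp only: lborel_prod sets_lborel)
    ultimately show ?thesis by (simp add: space_pair_measure)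
  qed
  ultimately have "AE x in lborel \<Otimes>\<^sub>M lborel. tor h x \<noteq> 0"
    by (intro lborel_pair.AE_pair_measure) auto
  thus "AE x in lborel. tor h x \<noteq> 0" unfolding lborel_prod .
qed

section \<open>Dilation and integrals of quotients by a polynomial without zeros in the
  bidisk\<close>

lemma poly_le_radial:
  fixes h :: "complex poly"
  assumes h: "\<And>z. cmod z < 1 \<Longrightarrow> poly h z \<noteq> 0" and deg: "degree h \<le> N"
    and z: "cmod z \<le> 1" and r: "0 \<le> r" "r < 1"
  shows "cmod (poly h z) \<le> 2 ^ N * cmod (poly h (of_real r * z))"
proof -
  have h0: "h \<noteq> 0" using h[of 0] by auto
  \<comment> \<open>Moving z to r z costs at most 1 - r, and r z keeps at least that distance from a
    root off the open disk. Each linear factor therefore changes by a factor of at most 2.\<close>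
  have root: "cmod (z - a) \<le> 2 * cmod (of_real r * z - a)" if "cmod a \<ge> 1" for a
  proof -
    have "cmod (z - a) \<le> cmod (of_real r * z - a) + cmod (z - of_real r * z)"
      by (metis add_diff_cancel_left' diff_add_cancel norm_triangle_ineq add_diff_eq)
    also have "z - of_real r * z = of_real (1 - r) * z" by (simp add: algebra_simps)
    also have "cmod \<dots> \<le> 1 - r" using z r by (simp add: norm_mult mult_left_le del: of_real_diff)
    also have "1 - r \<le> cmod a - r * cmod z" using that z r mult_left_le[of "cmod z" r] by linarith
    also have "\<dots> \<le> cmod (of_real r * z - a)"
      using norm_triangle_ineq2[of a "of_real r * z"] r by (simp add: norm_mult norm_minus_commute)
    finally show ?thesis by simp
  qed
  have eval: "poly h w = lead_coeff h * (\<Prod>a\<in>#proots h. w - a)" for w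
    by (subst (1) complex_poly_decompose_multiset[symmetric])
       (simp add: poly_prod_mset image_mset.compositionality o_def)
  have "cmod (\<Prod>a\<in>#M. z - a) \<le> 2 ^ size M * cmod (\<Prod>a\<in>#M. of_real r * z - a)"
    if "\<forall>a\<in>#M. cmod a \<ge> 1" for M
    using that
  proof (induction M)
    case (add a M)
    hence "cmod (z - a) * cmod (\<Prod>a\<in>#M. z - a) \<le>
       (2 * cmod (of_real r * z - a)) * (2 ^ size M * cmod (\<Prod>a\<in>#M. of_real r * z - a))"
      using root[of a] by (intro mult_mono) auto
    thus ?case by (simp add: norm_mult mult_ac)
  qed simp
  moreover have "\<forall>a\<in>#proots h. cmod a \<ge> 1"
    using h h0 by (metis not_le set_count_proots mem_Collect_eq)
  ultimately have "cmod (\<Prod>a\<in>#proots h. z - a) \<le> 2 ^ degree h * cmod (\<Prod>a\<in>#proots h. of_real r * z - a)"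
    by (metis size_proots_complex)
  hence "cmod (lead_coeff h) * cmod (\<Prod>a\<in>#proots h. z - a) \<le>
      cmod (lead_coeff h) * (2 ^ degree h * cmod (\<Prod>a\<in>#proots h. of_real r * z - a))"
    by (rule mult_left_mono) simp
  hence "cmod (poly h z) \<le> 2 ^ degree h * cmod (poly h (of_real r * z))"
    unfolding eval norm_mult by (simp only: mult.left_commute)
  also have "\<dots> \<le> 2 ^ N * cmod (poly h (of_real r * z))"
    using deg by (intro mult_right_mono power_increasing) auto
  finally show ?thesis .
qed

lemma slice1:
  assumes "p \<in> pbox (Suc N) (Suc M)"
  shows "\<exists>h. degree h \<le> N \<and> (\<forall>z. poly h z = eval2 p z z2)"
proof (intro exI conjI allI)
  let ?h = "\<Sum>i<Suc N. monom (\<Sum>j<Suc M. cf p i j * z2 ^ j) i"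
  show "degree ?h \<le> N"
    by (intro degree_sum_le) (auto intro: order_trans[OF degree_monom_le])
  show "poly ?h z = eval2 p z z2" for z
    unfolding eval2_box[OF assms] poly_sum poly_monom sum_distrib_right by (intro sum.cong refl) simp
qed

lemma slice2:
  assumes "p \<in> pbox (Suc N) (Suc M)"
  shows "\<exists>h. degree h \<le> M \<and> (\<forall>z. poly h z = eval2 p z1 z)"
proof (intro exI conjI allI)
  let ?h = "\<Sum>j<Suc M. monom (\<Sum>i<Suc N. cf p i j * z1 ^ i) j"
  show "degree ?h \<le> M"
    by (intro degree_sum_le) (auto intro: order_trans[OF degree_monom_le])
  show "poly ?h z = eval2 p z1 z" for z
    unfolding eval2_box[OF assms] poly_sum poly_monom sum_distrib_right by (subst sum.swap) simp
qed

text \<open>One variable is moved at a time. The hypothesis says nothing about the slice in z1 when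
  |z2| = 1, so the first move is made for |z2| < 1 and extended by continuity. In the second move r
  z1 already lies in the open disk.\<close>

lemma eval2_le_radial:
  assumes box: "p \<in> pbox (Suc N) (Suc M)"
    and nz: "\<And>z1 z2. cmod z1 < 1 \<Longrightarrow> cmod z2 < 1 \<Longrightarrow> eval2 p z1 z2 \<noteq> 0"
    and z: "cmod z1 \<le> 1" "cmod z2 \<le> 1" and r: "0 \<le> r" "r < 1"
  shows "cmod (eval2 p z1 z2) \<le> 2 ^ (N + M) * cmod (eval2 p (of_real r * z1) (of_real r * z2))"
proof -
  have 1: "cmod (eval2 p z1 w) \<le> 2 ^ N * cmod (eval2 p (of_real r * z1) w)" if w: "cmod w < 1" for w
  proof -
    obtain h where h: "degree h \<le> N" "\<And>z. poly h z = eval2 p z w"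
      using slice1[OF box, of w] by blast
    show ?thesis using poly_le_radial[of h N z1 r] h nz w z r by simp
  qed
  have "(\<lambda>k. 1 - 1 / real (Suc k)) \<longlonglongrightarrow> 1 - 0"
    by (intro tendsto_diff tendsto_const lim_1_over_n[THEN LIMSEQ_Suc])
  hence lim: "(\<lambda>k. of_real (1 - 1 / real (Suc k)) * z2) \<longlonglongrightarrow> of_real 1 * z2"
    by (intro tendsto_mult tendsto_const tendsto_of_real) simp
  have cont: "(\<lambda>k. eval2 p w (of_real (1 - 1 / real (Suc k)) * z2)) \<longlonglongrightarrow> eval2 p w (of_real 1 * z2)" for w
    using continuous_on_tendsto_compose[OF _ lim, of UNIV "\<lambda>z. eval2 p w z"]
    by (simp add: continuous_on_eval2 continuous_on_const continuous_on_id)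
  have lt: "cmod (of_real (1 - 1 / real (Suc k)) * z2) < 1" for k
  proof -
    have "cmod (of_real (1 - 1 / real (Suc k)) * z2) = (1 - 1 / real (Suc k)) * cmod z2"
      by (simp only: norm_mult norm_of_real) simp
    also have "\<dots> \<le> 1 - 1 / real (Suc k)" using z by (intro mult_left_le) auto
    finally show ?thesis by (rule le_less_trans) simp
  qed
  have "cmod (eval2 p z1 (of_real 1 * z2)) \<le> 2 ^ N * cmod (eval2 p (of_real r * z1) (of_real 1 * z2))"
  proof (rule LIMSEQ_le)
    show "(\<lambda>k. cmod (eval2 p z1 (of_real (1 - 1 / real (Suc k)) * z2))) \<longlonglongrightarrow>
       cmod (eval2 p z1 (of_real 1 * z2))"
      by (intro tendsto_norm cont)
    show "(\<lambda>k. 2 ^ N * cmod (eval2 p (of_real r * z1) (of_real (1 - 1 / real (Suc k)) * z2))) \<longlonglongrightarrow>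
       2 ^ N * cmod (eval2 p (of_real r * z1) (of_real 1 * z2))"
      by (intro tendsto_mult tendsto_const tendsto_norm cont)
    show "\<exists>n. \<forall>k\<ge>n. cmod (eval2 p z1 (of_real (1 - 1 / real (Suc k)) * z2)) \<le>
        2 ^ N * cmod (eval2 p (of_real r * z1) (of_real (1 - 1 / real (Suc k)) * z2))"
      using 1[OF lt] by blast
  qed
  moreover have "cmod (eval2 p (of_real r * z1) z2) \<le> 2 ^ M * cmod (eval2 p (of_real r * z1) (of_real r * z2))"
  proof -
    obtain h where h: "degree h \<le> M" "\<And>z. poly h z = eval2 p (of_real r * z1) z"
      using slice2[OF box, of "of_real r * z1"] by blast
    have "cmod (of_real r * z1) \<le> r" using z r by (simp add: norm_mult mult_left_le)
    hence "cmod (of_real r * z1) < 1" using r by linarith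
    thus ?thesis using poly_le_radial[of h M z2 r] h nz z r by simp
  qed
  ultimately have "cmod (eval2 p z1 z2) \<le> 2 ^ N * (2 ^ M * cmod (eval2 p (of_real r * z1) (of_real r * z2)))"
    by (smt (verit) mult_1 mult_left_mono of_real_1 zero_le_power)
  thus ?thesis by (simp add: power_add mult.assoc)
qed

lemma integral_cis_div_poly:
  fixes h :: "complex poly" and a :: int
  assumes h: "\<And>z. cmod z < 1 \<Longrightarrow> poly h z \<noteq> 0" and r: "0 \<le> r" "r < 1" and a: "a \<ge> 1"
  shows "integral {0..2*pi} (\<lambda>s. cis (of_int a * s) / poly h (of_real r * cis s)) = 0"
proof -
  \<comment> \<open>On the unit circle ds = dz / (i z), so the frequency \<open>a\<close> becomes
    the power a - 1, which is holomorphic for a >= 1.\<close>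
  define k where "k = nat a - 1"
  have k: "of_int a = (1 :: real) + real k" using a by (simp add: k_def of_nat_diff)
  \<comment> \<open>Any radius with R > 1 and r R < 1 does: the circle is inside the ball, the zeros
    of h(r z) are outside.\<close>
  define R where "R = 2 / (1 + r)"
  have R: "R > 1" "r * R < 1" "R > 0" using r by (auto simp: R_def field_simps)
  have "(\<lambda>z::complex. z ^ k / poly h (of_real r * z)) holomorphic_on ball 0 R"
  proof (intro holomorphic_intros)
    fix z :: complex assume "z \<in> ball 0 R"
    hence "cmod z \<le> R" by simp
    hence "cmod (of_real r * z) \<le> r * R" using r by (simp add: norm_mult mult_left_mono)
    thus "poly h (of_real r * z) \<noteq> 0" using R h by simp
  qed
  hence "((\<lambda>z. z ^ k / poly h (of_real r * z)) has_contour_integral 0) (part_circlepath 0 1 0 (2*pi))"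
  proof (rule Cauchy_theorem_disc_simple)
    show "path_image (part_circlepath 0 1 0 (2*pi)) \<subseteq> ball 0 R"
      using R path_image_part_circlepath_subset'[of 1 0 0 "2*pi"] by (force simp: sphere_def)
    show "pathfinish (part_circlepath 0 1 0 (2*pi)) = pathstart (part_circlepath 0 1 0 (2*pi))"
      using exp_two_pi_i' by (simp add: mult.commute[of 2])
  qed auto
  hence "((\<lambda>t. (0 + of_real 1 * cis t) ^ k / poly h (of_real r * (0 + of_real 1 * cis t)) * of_real 1 * \<i> * cis t) has_integral 0) {0..2*pi}"
    by (subst (asm) has_contour_integral_part_circlepath_iff) auto
  hence "((\<lambda>t. (- \<i>) * ((0 + of_real 1 * cis t) ^ k / poly h (of_real r * (0 + of_real 1 * cis t)) * of_real 1 * \<i> * cis t)) has_integral (- \<i>) * 0) {0..2*pi}"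
    by (rule has_integral_mult_right)
  also have "(\<lambda>t. (- \<i>) * ((0 + of_real 1 * cis t) ^ k / poly h (of_real r * (0 + of_real 1 * cis t)) * of_real 1 * \<i> * cis t)) =
     (\<lambda>t. cis (of_int a * t) / poly h (of_real r * cis t))"
  proof
    fix t
    have "cis (of_int a * t) = cis t ^ k * cis t"
      unfolding Complex.DeMoivre cis_mult k by (simp add: algebra_simps)
    thus "(- \<i>) * ((0 + of_real 1 * cis t) ^ k / poly h (of_real r * (0 + of_real 1 * cis t)) * of_real 1 * \<i> * cis t) =
      cis (of_int a * t) / poly h (of_real r * cis t)"
      by (cases "poly h (of_real r * cis t) = 0") (simp_all add: field_simps)
  qed
  finally show ?thesis by (simp add: integral_unique)
qed

lemma cmod_lt1: "0 \<le> r \<Longrightarrow> r < 1 \<Longrightarrow> cmod (of_real r * cis t) < 1"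
  by (simp add: norm_mult)

text \<open>A single positive frequency suffices: by Cauchy's theorem the integral in its variable
  is 0 for every value of the other one. For r < 1 the integrand is continuous, so the order of
  integration can be chosen.\<close>

lemma LINT_ee_div:
  assumes box: "p \<in> pbox (Suc N) (Suc M)"
    and nz: "\<And>z1 z2. cmod z1 < 1 \<Longrightarrow> cmod z2 < 1 \<Longrightarrow> eval2 p z1 z2 \<noteq> 0"
    and r: "0 \<le> r" "r < 1" and ab: "a \<ge> 1 \<or> b \<ge> 1"
  defines "F \<equiv> \<lambda>x. ee a b x / eval2 p (of_real r * cis (fst x)) (of_real r * cis (snd x))"
  shows "continuous_on UNIV F" "(LINT x|Tmeas. F x) = 0"
proof -
  show c: "continuous_on UNIV F"
    unfolding F_def using nz cmod_lt1[OF r]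
    by (intro continuous_on_divide continuous_on_ee) (auto intro!: continuous_intros)
  have "(LINT x|Tmeas. F x) = integral (cbox (0, 0) (2*pi, 2*pi)) F"
    using LINT_Tmeas_continuous[of F] continuous_on_subset[OF c] by (simp add: cbox_Pair_eq)
  also have 1: "\<dots> = integral (cbox 0 (2*pi)) (\<lambda>s. integral (cbox 0 (2*pi)) (\<lambda>t. F (s, t)))"
    by (rule integral_prod_continuous) (rule continuous_on_subset[OF c], simp)
  also have "\<dots> = 0"
    using ab
  proof
    assume b: "b \<ge> 1"
    have "integral (cbox 0 (2*pi)) (\<lambda>t. F (s, t)) = 0" for s
    proof -
      obtain h where h: "\<And>z. poly h z = eval2 p (of_real r * cis s) z"
        using slice2[OF box, of "of_real r * cis s"] by blast
      have "(\<lambda>t. F (s, t)) = (\<lambda>t. cis (of_int a * s) * (cis (of_int b * t) / poly h (of_real r * cis t)))"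
        by (simp add: F_def ee_def h cis_mult[symmetric])
      hence "integral (cbox 0 (2*pi)) (\<lambda>t. F (s, t)) =
         cis (of_int a * s) * integral {0..2*pi} (\<lambda>t. cis (of_int b * t) / poly h (of_real r * cis t))"
        by (simp only: cbox_interval integral_mult_right)
      thus ?thesis using integral_cis_div_poly[of h r b] nz h cmod_lt1[OF r] r b by simp
    qed
    thus ?thesis by simp
  next
    assume a: "a \<ge> 1"
    have "integral (cbox 0 (2*pi)) (\<lambda>s. integral (cbox 0 (2*pi)) (\<lambda>t. F (s, t))) =
       integral (cbox 0 (2*pi)) (\<lambda>t. integral (cbox 0 (2*pi)) (\<lambda>s. F (s, t)))"
      using integral_swap_continuous[of 0 0 "2*pi" "2*pi" "\<lambda>s t. F (s, t)"] continuous_on_subset[OF c]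
      by (simp add: case_prod_unfold)
    moreover have "integral (cbox 0 (2*pi)) (\<lambda>s. F (s, t)) = 0" for t
    proof -
      obtain h where h: "\<And>z. poly h z = eval2 p z (of_real r * cis t)"
        using slice1[OF box, of "of_real r * cis t"] by blast
      have "(\<lambda>s. F (s, t)) = (\<lambda>s. cis (of_int b * t) * (cis (of_int a * s) / poly h (of_real r * cis s)))"
        by (simp add: F_def ee_def h cis_mult[symmetric] mult.commute)
      hence "integral (cbox 0 (2*pi)) (\<lambda>s. F (s, t)) =
         cis (of_int b * t) * integral {0..2*pi} (\<lambda>s. cis (of_int a * s) / poly h (of_real r * cis s))"
        by (simp only: cbox_interval integral_mult_right)
      thus ?thesis using integral_cis_div_poly[of h r a] nz h cmod_lt1[OF r] r a by simp
    qed
    ultimately show ?thesis by simp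
  qed
  finally show "(LINT x|Tmeas. F x) = 0" .
qed

text \<open>Dilating the denominator to \<open>p(r z)\<close> costs a bounded factor, which makes dominated convergence
  available although \<open>p\<close> may vanish on the torus.\<close>
lemma LINT_trig_div_tor:
  assumes box: "p \<in> pbox (Suc N) (Suc M)"
    and nz: "\<And>z1 z2. cmod z1 < 1 \<Longrightarrow> cmod z2 < 1 \<Longrightarrow> eval2 p z1 z2 \<noteq> 0"
    and K: "finite K" "\<And>k. k \<in> K \<Longrightarrow> a k \<ge> 1 \<or> b k \<ge> 1"
    and F: "\<And>x. F x = (\<Sum>k\<in>K. c k * ee (a k) (b k) x)"
    and int: "integrable Tmeas (\<lambda>x. F x / tor p x)"
  shows "(LINT x|Tmeas. F x / tor p x) = 0"
proof -
  define r where "r = (\<lambda>k. 1 - 1 / real (Suc k))"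
  have r: "0 \<le> r k" "r k < 1" for k by (auto simp: r_def)
  have rlim: "r \<longlonglongrightarrow> 1"
    using tendsto_diff[OF tendsto_const lim_1_over_n[THEN LIMSEQ_Suc], of "1::real"] by (simp add: r_def)
  define pr where "pr = (\<lambda>k x. eval2 p (of_real (r k) * cis (fst x)) (of_real (r k) * cis (snd x)))"
  have p0: "p \<noteq> 0" using nz[of 0 0] by auto
  have lim: "(\<lambda>k. pr k x) \<longlonglongrightarrow> tor p x" for x
  proof -
    have "(\<lambda>k. (of_real (r k) * cis (fst x), of_real (r k) * cis (snd x))) \<longlonglongrightarrow>
        (of_real 1 * cis (fst x), of_real 1 * cis (snd x))"
      by (intro tendsto_Pair tendsto_mult tendsto_of_real tendsto_const rlim)
    from continuous_on_tendsto_compose[OF _ this, of UNIV "\<lambda>z. eval2 p (fst z) (snd z)"]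
    show ?thesis by (simp add: continuous_on_eval2 continuous_on_fst continuous_on_snd continuous_on_id pr_def tor_def)
  qed
  have z: "(LINT x|Tmeas. F x / pr k x) = 0" for k
  proof -
    have "(LINT x|Tmeas. F x / pr k x) = (LINT x|Tmeas. (\<Sum>j\<in>K. c j * (ee (a j) (b j) x / pr k x)))"
      by (simp add: F sum_divide_distrib)
    also have "\<dots> = (\<Sum>j\<in>K. LINT x|Tmeas. c j * (ee (a j) (b j) x / pr k x))"
      using LINT_ee_div(1)[OF box nz r K(2)] unfolding pr_def
      by (intro Bochner_Integration.integral_sum integrable_mult_right integrable_Tmeas_continuous)
         (auto intro: continuous_on_subset)
    also have "\<dots> = 0"
      using LINT_ee_div(2)[OF box nz r K(2)] unfolding pr_def
      by (intro sum.neutral ballI) (simp only: integral_mult_right_zero mult_zero_right)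
    finally show ?thesis .
  qed
  have mp: "tor p \<in> borel_measurable Tmeas"
    by (intro measurable_Tmeas_continuous continuous_on_tor)
  have mF: "F \<in> borel_measurable Tmeas"
    unfolding F[abs_def] by (intro measurable_Tmeas_continuous continuous_intros continuous_on_ee)
  have "(\<lambda>k. LINT x|Tmeas. F x / pr k x) \<longlonglongrightarrow> (LINT x|Tmeas. F x / tor p x)"
  proof (rule integral_dominated_convergence)
    show "(\<lambda>x. F x / tor p x) \<in> borel_measurable Tmeas" using mp mF by measurable
    show "(\<lambda>x. F x / pr k x) \<in> borel_measurable Tmeas" for k
      unfolding pr_def
      by (rule borel_measurable_divide[OF mF]) (auto intro!: measurable_Tmeas_continuous continuous_intros)
    show "integrable Tmeas (\<lambda>x. 2 ^ (N + M) * cmod (F x / tor p x))"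
      using int by (intro integrable_mult_right integrable_norm)
    show "AE x in Tmeas. (\<lambda>k. F x / pr k x) \<longlonglongrightarrow> F x / tor p x"
      using AE_tor_nonzero[OF p0] by eventually_elim (intro tendsto_divide tendsto_const lim)
    show "AE x in Tmeas. cmod (F x / pr k x) \<le> 2 ^ (N + M) * cmod (F x / tor p x)" for k
      using AE_tor_nonzero[OF p0]
    proof eventually_elim
      case (elim x)
      have le: "cmod (tor p x) \<le> 2 ^ (N + M) * cmod (pr k x)"
        unfolding tor_def pr_def by (rule eval2_le_radial[OF box nz _ _ r]) auto
      hence "pr k x \<noteq> 0" using elim by auto
      thus ?case using elim mult_left_mono[OF le, of "cmod (F x)"]
        by (simp add: norm_divide field_simps)
    qed
  qed
  thus ?thesis unfolding z by (simp add: LIMSEQ_const_iff)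
qed

section \<open>The weighted inner product\<close>

lemma cnj_mult_mult: "cnj c * (k * c) = k * of_real ((cmod c)\<^sup>2)"
  unfolding complex_norm_square by (simp only: mult.commute mult.left_commute)

lemma sum_if: "(\<Sum>b\<in>A. if P then f b else 0) = (if P then \<Sum>b\<in>A. f b else 0)"
  by simp

lemma borel_measurable_cnj [measurable]:
  "f \<in> borel_measurable M \<Longrightarrow> (\<lambda>x. cnj (f x)) \<in> borel_measurable M"
  by (rule measurable_compose[OF _ borel_measurable_continuous_onI]) (auto intro: continuous_intros)

text \<open>A positive frequency is the case of denominator 1 in \<open>LINT_ee_div\<close>; the
  remaining nonzero frequencies follow by conjugation.\<close>

lemma LINT_ee: "(LINT x|Tmeas. ee a b x) = (if a = 0 \<and> b = 0 then 4 * of_real pi ^ 2 else 0)"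
proof -
  have pos: "(LINT x|Tmeas. ee a b x) = 0" if "a \<ge> 1 \<or> b \<ge> 1" for a b
    using LINT_ee_div(2)[of 1 0 0 0 a b] that by (simp add: pbox_def cf_def)
  have cnj: "(LINT x|Tmeas. ee a b x) = cnj (LINT x|Tmeas. ee (- a) (- b) x)"
    unfolding Bochner_Integration.integral_cnj[symmetric] by (simp add: cnj_ee)
  have "(LINT x|Tmeas. (1::complex)) = 4 * of_real pi ^ 2"
  proof -
    have "(LINT x|Tmeas. (1::complex)) = integral (cbox (0, 0) (2*pi, 2*pi)) (\<lambda>_. 1)"
      by (subst LINT_Tmeas_continuous) (simp_all add: cbox_Pair_eq)
    also have "\<dots> = of_real (measure lborel (cbox (0::real, 0::real) (2*pi, 2*pi)))"
      by (simp add: scaleR_conv_of_real)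
    also have "\<dots> = 4 * of_real pi ^ 2"
      by (simp add: content_Pair power2_eq_square)
    finally show ?thesis .
  qed
  thus ?thesis using pos[of a b] pos[of "-a" "-b"] cnj
    by (cases "a = 0 \<and> b = 0"; cases "a \<ge> 1 \<or> b \<ge> 1") auto
qed

lemma integrable_ee: "integrable Tmeas (ee a b)"
  by (intro integrable_Tmeas_continuous continuous_on_ee)

lemma LINT_tf_ee: "(LINT x|Tmeas. tf f x * cnj (ee (int i) (- int j) x)) = 4 * of_real pi ^ 2 * cf f i j"
proof -
  obtain N0 M0 where f0: "f \<in> pbox N0 M0" using ex_pbox by blast
  define N M where "N = max N0 (Suc i)" and "M = max M0 (Suc j)"
  have f: "f \<in> pbox N M" using f0 by (rule pbox_mono) (auto simp: N_def M_def)
  have "(LINT x|Tmeas. tf f x * cnj (ee (int i) (- int j) x)) =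
      (LINT x|Tmeas. (\<Sum>a<N. \<Sum>b<M. cf f a b * ee (int a - int i) (int j - int b) x))"
    by (simp add: tf_box[OF f] sum_distrib_right cnj_ee mult.assoc ee_mult)
  also have "\<dots> = (\<Sum>a<N. \<Sum>b<M. cf f a b * (LINT x|Tmeas. ee (int a - int i) (int j - int b) x))"
    by (subst Bochner_Integration.integral_sum, auto intro!: integrable_sum integrable_mult_right integrable_ee sum.cong)
       (subst Bochner_Integration.integral_sum, auto intro!: integrable_mult_right integrable_ee)
  also have "\<dots> = (\<Sum>a<N. \<Sum>b<M. if a = i then (if b = j then 4 * of_real pi ^ 2 * cf f i j else 0) else 0)"
    by (intro sum.cong refl) (auto simp: LINT_ee)
  also have "\<dots> = (\<Sum>a<N. if a = i then (\<Sum>b<M. if b = j then 4 * of_real pi ^ 2 * cf f i j else 0) else 0)"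
    unfolding sum_if ..
  also have "\<dots> = 4 * of_real pi ^ 2 * cf f i j"
    by (simp add: N_def M_def less_max_iff_disj)
  finally show ?thesis .
qed

lemma parseval_tf:
  assumes f: "f \<in> pbox N M"
  shows "(LINT x|Tmeas. (cmod (tf f x))\<^sup>2) = 4 * pi ^ 2 * (\<Sum>i<N. \<Sum>j<M. (cmod (cf f i j))\<^sup>2)"
proof -
  have int: "integrable Tmeas (\<lambda>x. tf f x * cnj (ee a b x))" for a b
    by (intro integrable_Tmeas_continuous continuous_intros continuous_on_tf continuous_on_ee)
  have "complex_of_real (LINT x|Tmeas. (cmod (tf f x))\<^sup>2) = (LINT x|Tmeas. tf f x * cnj (tf f x))"
    by (simp add: complex_norm_square of_real_power[symmetric] flip: integral_complex_of_real del: of_real_power)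
  also have "\<dots> = (LINT x|Tmeas. (\<Sum>i<N. \<Sum>j<M. cnj (cf f i j) * (tf f x * cnj (ee (int i) (- int j) x))))"
    by (subst (2) tf_box[OF f]) (simp add: sum_distrib_left mult.left_commute)
  also have "\<dots> = (\<Sum>i<N. \<Sum>j<M. cnj (cf f i j) * (LINT x|Tmeas. (tf f x * cnj (ee (int i) (- int j) x))))"
    by (subst Bochner_Integration.integral_sum, auto intro!: integrable_sum integrable_mult_right int sum.cong)
       (subst Bochner_Integration.integral_sum, auto intro!: integrable_mult_right int)
  also have "\<dots> = (\<Sum>i<N. \<Sum>j<M. of_real (4 * pi ^ 2 * (cmod (cf f i j))\<^sup>2))"
    unfolding LINT_tf_ee by (intro sum.cong refl) (simp add: cnj_mult_mult)
  also have "\<dots> = of_real (4 * pi ^ 2 * (\<Sum>i<N. \<Sum>j<M. (cmod (cf f i j))\<^sup>2))"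
    by (simp add: sum_distrib_left)
  finally show ?thesis by (simp only: of_real_eq_iff)
qed

lemma bounded_on_tbox:
  assumes "continuous_on UNIV (H :: real \<times> real \<Rightarrow> complex)"
  shows "\<exists>C>0. \<forall>x\<in>tbox. cmod (H x) \<le> C"
proof -
  have "compact (H ` tbox)"
    unfolding tbox_eq using continuous_on_subset[OF assms] by (intro compact_continuous_image) auto
  thus ?thesis using compact_imp_bounded bounded_pos by (metis imageI)
qed

section \<open>Square integrable functions, their norm and inner product\<close>

definition nsq :: "complex poly poly \<Rightarrow> (real \<times> real \<Rightarrow> complex) \<Rightarrow> real" where
  "nsq p F = (LINT x|Tmeas. (cmod (F x))\<^sup>2 * wt p x)"

lemma wt_nonneg: "wt p x \<ge> 0"
  by (simp add: wt_def)

lemma measurable_tor [measurable]: "tor f \<in> borel_measurable Tmeas"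
  by (intro measurable_Tmeas_continuous continuous_on_tor)

lemma measurable_tf [measurable]: "tf f \<in> borel_measurable Tmeas"
  by (intro measurable_Tmeas_continuous continuous_on_tf)

lemma measurable_ee [measurable]: "ee i j \<in> borel_measurable Tmeas"
  by (intro measurable_Tmeas_continuous continuous_on_ee)

lemma measurable_wt [measurable]: "wt p \<in> borel_measurable Tmeas"
  unfolding wt_def[abs_def] by measurable

lemma measurable_of_real_wt [measurable]: "(\<lambda>x. complex_of_real (wt p x)) \<in> borel_measurable Tmeas"
  by (rule measurable_compose[OF measurable_wt borel_measurable_continuous_onI]) (auto intro: continuous_intros)

lemma inL2_measurable: "inL2 p F \<Longrightarrow> F \<in> borel_measurable Tmeas"
  by (simp add: inL2_def)

lemma inL2_integrable: "inL2 p F \<Longrightarrow> integrable Tmeas (\<lambda>x. (cmod (F x))\<^sup>2 * wt p x)"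
  by (simp add: inL2_def)

lemma integrable_ip:
  assumes "inL2 p F" "inL2 p G"
  shows "integrable Tmeas (\<lambda>x. F x * cnj (G x) * complex_of_real (wt p x))"
proof (rule Bochner_Integration.integrable_bound)
  show "integrable Tmeas (\<lambda>x. (cmod (F x))\<^sup>2 * wt p x + (cmod (G x))\<^sup>2 * wt p x)"
    using assms by (auto simp: inL2_def)
  show "(\<lambda>x. F x * cnj (G x) * complex_of_real (wt p x)) \<in> borel_measurable Tmeas"
    using assms[THEN inL2_measurable] by measurable
  show "AE x in Tmeas. cmod (F x * cnj (G x) * complex_of_real (wt p x))
          \<le> norm ((cmod (F x))\<^sup>2 * wt p x + (cmod (G x))\<^sup>2 * wt p x)"
  proof (rule AE_I2)
    fix x
    have "2 * (cmod (F x) * cmod (G x)) \<le> (cmod (F x))\<^sup>2 + (cmod (G x))\<^sup>2"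
      using sum_squares_bound[of "cmod (F x)" "cmod (G x)"] by simp
    moreover have "0 \<le> cmod (F x) * cmod (G x)" by simp
    ultimately have "cmod (F x) * cmod (G x) \<le> (cmod (F x))\<^sup>2 + (cmod (G x))\<^sup>2"
      by linarith
    hence "cmod (F x * cnj (G x) * complex_of_real (wt p x)) \<le> ((cmod (F x))\<^sup>2 + (cmod (G x))\<^sup>2) * wt p x"
      using wt_nonneg[of p x]
      by (simp only: norm_mult complex_mod_cnj norm_of_real abs_of_nonneg mult_right_mono)
    also have "\<dots> = (cmod (F x))\<^sup>2 * wt p x + (cmod (G x))\<^sup>2 * wt p x"
      by (rule distrib_right)
    also have "\<dots> \<le> norm \<dots>" unfolding real_norm_def by (rule abs_ge_self)
    finally show "cmod (F x * cnj (G x) * complex_of_real (wt p x))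
          \<le> norm ((cmod (F x))\<^sup>2 * wt p x + (cmod (G x))\<^sup>2 * wt p x)" .
  qed
qed

lemma inL2I:
  assumes "F \<in> borel_measurable Tmeas" "integrable Tmeas g"
    "\<And>x. x \<in> tbox \<Longrightarrow> (cmod (F x))\<^sup>2 * wt p x \<le> g x"
  shows "inL2 p F"
  unfolding inL2_def
proof
  show "integrable Tmeas (\<lambda>x. (cmod (F x))\<^sup>2 * wt p x)"
  proof (rule Bochner_Integration.integrable_bound[OF assms(2)])
    show "(\<lambda>x. (cmod (F x))\<^sup>2 * wt p x) \<in> borel_measurable Tmeas"
      using assms(1) by measurable
    show "AE x in Tmeas. norm ((cmod (F x))\<^sup>2 * wt p x) \<le> norm (g x)"
    proof (rule AE_I2)
      fix x assume "x \<in> space Tmeas"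
      hence "(cmod (F x))\<^sup>2 * wt p x \<le> g x" using assms(3) by simp
      moreover have "0 \<le> (cmod (F x))\<^sup>2 * wt p x" by (intro mult_nonneg_nonneg wt_nonneg) simp
      ultimately show "norm ((cmod (F x))\<^sup>2 * wt p x) \<le> norm (g x)"
        unfolding real_norm_def by linarith
    qed
  qed
qed (rule assms(1))

lemma inL2_bound:
  assumes "inL2 p F" "H \<in> borel_measurable Tmeas" "\<And>x. x \<in> tbox \<Longrightarrow> cmod (H x) \<le> C * cmod (F x)" "C \<ge> 0"
  shows "inL2 p H"
proof (rule inL2I[OF assms(2)])
  show "integrable Tmeas (\<lambda>x. C\<^sup>2 * ((cmod (F x))\<^sup>2 * wt p x))"
    using assms by (auto simp: inL2_def)
  fix x assume "x \<in> tbox"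
  hence "(cmod (H x))\<^sup>2 \<le> (C * cmod (F x))\<^sup>2" using assms by (intro power_mono) auto
  hence "(cmod (H x))\<^sup>2 * wt p x \<le> (C * cmod (F x))\<^sup>2 * wt p x"
    by (rule mult_right_mono) (rule wt_nonneg)
  thus "(cmod (H x))\<^sup>2 * wt p x \<le> C\<^sup>2 * ((cmod (F x))\<^sup>2 * wt p x)"
    by (simp only: power_mult_distrib mult.assoc)
qed

lemma inL2_mult_continuous:
  assumes "inL2 p F" "continuous_on UNIV H"
  shows "inL2 p (\<lambda>x. H x * F x)"
proof -
  obtain C where C: "C > 0" "\<forall>x\<in>tbox. cmod (H x) \<le> C" using bounded_on_tbox[OF assms(2)] by blast
  have [measurable]: "H \<in> borel_measurable Tmeas" "F \<in> borel_measurable Tmeas"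
    using assms by (auto intro: measurable_Tmeas_continuous inL2_measurable)
  show ?thesis using C
    by (intro inL2_bound[OF assms(1), of _ C]) (auto simp: norm_mult intro!: mult_right_mono)
qed

lemma inL2_mult_tor:
  assumes "continuous_on UNIV H"
  shows "inL2 p (\<lambda>x. H x * tor p x)"
proof -
  have [measurable]: "H \<in> borel_measurable Tmeas"
    using assms by (auto intro: measurable_Tmeas_continuous)
  have "inL2 p (tor p)"
  proof (rule inL2I[OF measurable_tor])
    \<comment> \<open>Off the zeros of \<open>p\<close>, |p|^2 times the weight equals this
      constant; at a zero the weight is 1/0 = 0.\<close>
    show "integrable Tmeas (\<lambda>x. 1 / (4 * pi\<^sup>2) :: real)" by (intro integrable_Tmeas_continuous continuous_intros)
  qed (simp add: wt_def)
  thus ?thesis using assms by (rule inL2_mult_continuous)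
qed

lemma inL2_add:
  assumes "inL2 p F" "inL2 p G"
  shows "inL2 p (\<lambda>x. F x + G x)"
proof (rule inL2I)
  show "(\<lambda>x. F x + G x) \<in> borel_measurable Tmeas"
    using assms by (intro borel_measurable_add inL2_measurable)
  show "integrable Tmeas (\<lambda>x. 2 * ((cmod (F x))\<^sup>2 * wt p x) + 2 * ((cmod (G x))\<^sup>2 * wt p x))"
    using assms by (auto simp: inL2_def)
  fix x
  have "(cmod (F x + G x))\<^sup>2 \<le> (cmod (F x) + cmod (G x))\<^sup>2"
    by (intro power_mono norm_triangle_ineq) simp
  also have "\<dots> \<le> 2 * (cmod (F x))\<^sup>2 + 2 * (cmod (G x))\<^sup>2"
    using sum_squares_bound[of "cmod (F x)" "cmod (G x)"] by (simp add: power2_sum)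
  finally have "(cmod (F x + G x))\<^sup>2 * wt p x \<le> (2 * (cmod (F x))\<^sup>2 + 2 * (cmod (G x))\<^sup>2) * wt p x"
    by (rule mult_right_mono) (rule wt_nonneg)
  thus "(cmod (F x + G x))\<^sup>2 * wt p x \<le> 2 * ((cmod (F x))\<^sup>2 * wt p x) + 2 * ((cmod (G x))\<^sup>2 * wt p x)"
    by (simp only: distrib_right mult.assoc)
qed

lemma inL2_cmult: "inL2 p F \<Longrightarrow> inL2 p (\<lambda>x. c * F x)"
  by (rule inL2_mult_continuous) (auto intro: continuous_intros)

lemma inL2_diff: assumes "inL2 p F" "inL2 p G" shows "inL2 p (\<lambda>x. F x - G x)"
  using inL2_add[OF assms(1) inL2_cmult[OF assms(2), of "-1"]] by simp

lemma inL2_zero: "inL2 p (\<lambda>x. 0)"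
  by (simp add: inL2_def)

lemma ipw_add_left: "inL2 p F \<Longrightarrow> inL2 p G \<Longrightarrow> inL2 p H \<Longrightarrow> ipw p (\<lambda>x. F x + G x) H = ipw p F H + ipw p G H"
  unfolding ipw_def distrib_right by (intro Bochner_Integration.integral_add integrable_ip)

lemma ipw_diff_left: "inL2 p F \<Longrightarrow> inL2 p G \<Longrightarrow> inL2 p H \<Longrightarrow> ipw p (\<lambda>x. F x - G x) H = ipw p F H - ipw p G H"
  unfolding ipw_def left_diff_distrib by (intro Bochner_Integration.integral_diff integrable_ip)

lemma ipw_cmult_left: "ipw p (\<lambda>x. c * F x) H = c * ipw p F H"
  unfolding ipw_def by (simp add: mult.assoc flip: integral_mult_right_zero)

lemma ipw_commute: "ipw p G F = cnj (ipw p F G)"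
  unfolding ipw_def by (simp add: Bochner_Integration.integral_cnj[symmetric] mult.commute del: Bochner_Integration.integral_cnj)

lemma ipw_diff_right: "inL2 p F \<Longrightarrow> inL2 p G \<Longrightarrow> inL2 p H \<Longrightarrow> ipw p H (\<lambda>x. F x - G x) = ipw p H F - ipw p H G"
  by (subst (1 2 3) ipw_commute) (simp add: ipw_diff_left)

lemma ipw_add_right: "inL2 p F \<Longrightarrow> inL2 p G \<Longrightarrow> inL2 p H \<Longrightarrow> ipw p H (\<lambda>x. F x + G x) = ipw p H F + ipw p H G"
  by (subst (1 2 3) ipw_commute) (simp add: ipw_add_left)

lemma ipw_cmult_right: "ipw p H (\<lambda>x. c * F x) = cnj c * ipw p H F"
  by (subst (1 2) ipw_commute) (simp add: ipw_cmult_left)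

lemma inL2_sum: "(\<And>k. k \<in> K \<Longrightarrow> inL2 p (F k)) \<Longrightarrow> inL2 p (\<lambda>x. \<Sum>k\<in>K. F k x)"
  by (induction K rule: infinite_finite_induct) (auto intro: inL2_zero inL2_add)

lemma ipw_sum_right:
  "inL2 p H \<Longrightarrow> (\<And>k. k \<in> K \<Longrightarrow> inL2 p (F k)) \<Longrightarrow> ipw p H (\<lambda>x. \<Sum>k\<in>K. F k x) = (\<Sum>k\<in>K. ipw p H (F k))"
  by (induction K rule: infinite_finite_induct) (simp_all add: ipw_add_right inL2_sum, simp_all add: ipw_def)

lemma ipw_self: "ipw p F F = of_real (nsq p F)"
proof -
  have "F x * cnj (F x) * complex_of_real (wt p x) = of_real ((cmod (F x))\<^sup>2 * wt p x)" for x
    by (simp only: of_real_mult complex_norm_square)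
  thus ?thesis unfolding ipw_def nsq_def by (simp only: integral_complex_of_real)
qed

lemma nsq_nonneg: "nsq p F \<ge> 0"
  unfolding nsq_def by (intro integral_nonneg_AE) (auto simp: wt_nonneg)

lemma nsq_cmult: "nsq p (\<lambda>x. c * F x) = (cmod c)\<^sup>2 * nsq p F"
  unfolding nsq_def by (simp add: norm_mult power_mult_distrib mult.assoc)

lemma nsq_diff_eq:
  assumes "inL2 p F" "inL2 p G"
  shows "nsq p (\<lambda>x. F x - G x) = nsq p F + nsq p G - 2 * Re (ipw p F G)"
proof -
  have "complex_of_real (nsq p (\<lambda>x. F x - G x)) = ipw p (\<lambda>x. F x - G x) (\<lambda>x. F x - G x)"
    by (rule ipw_self[symmetric])
  also have "\<dots> = ipw p F F - ipw p F G - (ipw p G F - ipw p G G)"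
    using assms by (simp add: ipw_diff_left ipw_diff_right inL2_diff)
  also have "\<dots> = of_real (nsq p F) + of_real (nsq p G) - (ipw p F G + cnj (ipw p F G))"
    by (simp add: ipw_self ipw_commute[of p G F])
  also have "\<dots> = of_real (nsq p F + nsq p G - 2 * Re (ipw p F G))"
    by (simp add: complex_add_cnj)
  finally show ?thesis by (simp only: of_real_eq_iff)
qed

lemma nsq_add_eq:
  assumes "inL2 p F" "inL2 p G"
  shows "nsq p (\<lambda>x. F x + G x) = nsq p F + nsq p G + 2 * Re (ipw p F G)"
  using nsq_diff_eq[OF assms(1) inL2_cmult[OF assms(2), of "-1"]] nsq_cmult[of p "-1" G]
    ipw_cmult_right[of p F "-1" G] by simp

text \<open>Quantitative form of the fact that a shortest vector is orthogonal: if subtracting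
  multiples of \<open>G\<close> shortens \<open>F\<close> by at most the defect, the inner product
  is of the order of its square root.\<close>

lemma ipw_bound:
  assumes F: "inL2 p F" "inL2 p G" and min: "\<And>c. nsq p F - \<delta> \<le> nsq p (\<lambda>x. F x - c * G x)"
  shows "(cmod (ipw p F G))\<^sup>2 \<le> \<delta> * (nsq p G + 1)"
proof -
  define X where "X = (cmod (ipw p F G))\<^sup>2"
  \<comment> \<open>The best multiple would have nsq p G in the denominator; adding 1 avoids a
    separate case of norm 0 and still gives t nsq p G <= 1.\<close>
  define t where "t = 1 / (nsq p G + 1)"
  define c where "c = of_real t * ipw p F G"
  have t: "t > 0" "t * nsq p G \<le> 1" using nsq_nonneg[of p G] by (auto simp: t_def)
  have X0: "X \<ge> 0" by (simp add: X_def)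
  have "nsq p (\<lambda>x. F x - c * G x) = nsq p F + (cmod c)\<^sup>2 * nsq p G - 2 * Re (cnj c * ipw p F G)"
    using nsq_diff_eq[OF F(1) inL2_cmult[OF F(2), of c]] by (simp add: nsq_cmult ipw_cmult_right)
  also have "(cmod c)\<^sup>2 = t * t * X"
    by (simp add: c_def norm_mult power_mult_distrib X_def power2_eq_square)
  also have "cnj c * ipw p F G = of_real (t * X)"
    by (simp only: c_def X_def of_real_mult complex_norm_square complex_cnj_mult complex_cnj_complex_of_real
        mult.assoc mult.commute[of "ipw p F G"])
  finally have "2 * (t * X) - (t * X) * (t * nsq p G) \<le> \<delta>"
    using min[of c] by (simp add: algebra_simps)
  moreover have "(t * X) * (t * nsq p G) \<le> (t * X) * 1"
    using t X0 by (intro mult_left_mono) auto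
  ultimately have "t * X \<le> \<delta>" by linarith
  thus ?thesis using nsq_nonneg[of p G] by (simp add: t_def X_def field_simps)
qed

text \<open>With defect \<open>nsq p F\<close> the hypothesis of \<open>ipw_bound\<close> is mere
  nonnegativity. The extra 1 does no harm, since the bound is applied to functions \<open>G\<close>
  of a fixed norm.\<close>

lemma ipw_cauchy:
  assumes "inL2 p F" "inL2 p G"
  shows "(cmod (ipw p F G))\<^sup>2 \<le> nsq p F * (nsq p G + 1)"
  using assms by (rule ipw_bound) (simp add: nsq_nonneg)

section \<open>Fourier supports of quotients\<close>

lemma tf_monom: "tf (monom (monom 1 i) j) x = ee (int i) (- int j) x"
  unfolding cis_power_ee'[symmetric] by (simp add: tf_def poly_monom)

lemma sq_wt_nonneg: "0 \<le> (cmod c)\<^sup>2 * wt p x"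
  by (intro mult_nonneg_nonneg wt_nonneg) simp

lemma bessel_tf: "4 * pi ^ 2 * (\<Sum>i<N. \<Sum>j<M. (cmod (cf f i j))\<^sup>2) \<le> (LINT x|Tmeas. (cmod (tf f x))\<^sup>2)"
proof -
  obtain N0 M0 where f0: "f \<in> pbox N0 M0" using ex_pbox by blast
  let ?N = "max N0 N" and ?M = "max M0 M"
  have f: "f \<in> pbox ?N ?M" using f0 by (rule pbox_mono) auto
  have "(\<Sum>i<N. \<Sum>j<M. (cmod (cf f i j))\<^sup>2) \<le> (\<Sum>i<N. \<Sum>j<?M. (cmod (cf f i j))\<^sup>2)"
    by (intro sum_mono sum_mono2) auto
  also have "\<dots> \<le> (\<Sum>i<?N. \<Sum>j<?M. (cmod (cf f i j))\<^sup>2)"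
    by (intro sum_mono2 sum_nonneg) auto
  finally show ?thesis unfolding parseval_tf[OF f] by (intro mult_left_mono) auto
qed

definition kap :: complex where "kap = inverse (4 * of_real pi ^ 2)"

lemma kap_cancel [simp]: "kap * (4 * of_real pi ^ 2 * c) = c"
  by (simp add: kap_def)

locale disc_nz =
  fixes p :: "complex poly poly" and n m :: nat
  assumes box: "p \<in> pbox (Suc n) (Suc m)"
    and nz: "\<And>z1 z2. cmod z1 < 1 \<Longrightarrow> cmod z2 < 1 \<Longrightarrow> eval2 p z1 z2 \<noteq> 0"
begin

definition q :: "complex poly poly" where "q = flip2 p n m"
definition qt :: "complex poly poly" where "qt = flip2 (refl2 p n m) n m"

lemma p_nonzero: "p \<noteq> 0"
  using nz[of 0 0] by auto

lemma tf_q: "tf q x = ee 0 (- int m) x * tor p x"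
  unfolding q_def by (rule tf_flip2[OF box])

lemma tf_qt: "tf qt x = ee (int n) 0 x * cnj (tor p x)"
  unfolding qt_def by (rule tf_flip2_refl2[OF box])

lemma q_box: "q \<in> pbox (Suc n) (Suc m)" and qt_box: "qt \<in> pbox (Suc n) (Suc m)"
  unfolding q_def qt_def by (rule flip2_in_box)+

lemma cmod_tf_q: "cmod (tf q x) = cmod (tor p x)" and cmod_tf_qt: "cmod (tf qt x) = cmod (tor p x)"
  by (simp_all add: tf_q tf_qt norm_mult)

text \<open>On the torus the weight is 1/|q|^2 up to normalization, so the inner product of F with
  \<open>eq i j\<close> is the Fourier coefficient of F/q at (i, j) in the variables (z1, 1/z2). In
  the same way \<open>et\<close> gives the coefficients of F/qt, and \<open>pp\<close> those of F
  itself.\<close>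

definition eq :: "int \<Rightarrow> int \<Rightarrow> real \<times> real \<Rightarrow> complex" where
  "eq i j x = ee i (- j) x * tf q x"
definition et :: "int \<Rightarrow> int \<Rightarrow> real \<times> real \<Rightarrow> complex" where
  "et i j x = ee i (- j) x * tf qt x"
definition pp :: "int \<Rightarrow> int \<Rightarrow> real \<times> real \<Rightarrow> complex" where
  "pp i j x = ee i (- j) x * (tor p x * cnj (tor p x))"

lemma inL2_tor: "inL2 p (tor p)"
  using inL2_mult_tor[of "\<lambda>_. 1" p] by (simp add: continuous_on_const)

lemma inL2_le_tor:
  assumes "continuous_on UNIV H" "\<And>x. cmod (F x) = cmod (tor p x)" "continuous_on UNIV F"
  shows "inL2 p (\<lambda>x. H x * F x)"
proof (rule inL2_mult_continuous[OF _ assms(1)])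
  show "inL2 p F"
    using assms by (intro inL2_bound[OF inL2_tor, of _ 1] measurable_Tmeas_continuous) auto
qed

lemma inL2_eq: "inL2 p (eq i j)" and inL2_et: "inL2 p (et i j)"
  unfolding eq_def[abs_def] et_def[abs_def]
  by (rule inL2_le_tor; simp add: continuous_on_ee cmod_tf_q cmod_tf_qt continuous_on_tf)+

lemma inL2_mult_q: "inL2 p (tf (h * q))" and inL2_mult_qt: "inL2 p (tf (h * qt))"
proof -
  have "tf (h * q) = (\<lambda>x. tf h x * tf q x)" "tf (h * qt) = (\<lambda>x. tf h x * tf qt x)" by auto
  thus "inL2 p (tf (h * q))" "inL2 p (tf (h * qt))"
    using inL2_le_tor[OF continuous_on_tf cmod_tf_q continuous_on_tf]
      inL2_le_tor[OF continuous_on_tf cmod_tf_qt continuous_on_tf] by simp_all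
qed

lemma inL2_pp: "inL2 p (pp i j)"
proof -
  have "pp i j = (\<lambda>x. (ee i (- j) x * cnj (tor p x)) * tor p x)" by (auto simp: pp_def)
  thus ?thesis
    using inL2_mult_tor[of "\<lambda>x. ee i (- j) x * cnj (tor p x)" p]
    by (simp add: continuous_on_mult continuous_on_cnj continuous_on_ee continuous_on_tor)
qed

text \<open>Turns inner products with multiples of \<open>p\<close> into integrals of quotients by
  \<open>p\<close>. At a zero of \<open>p\<close> both sides are 0, by the convention for division
  by 0.\<close>

lemma cnj_tor_wt: "cnj (tor p x) * of_real (wt p x) = kap / tor p x"
proof (cases "tor p x = 0")
  case False
  have "complex_of_real (wt p x) = 1 / (tor p x * cnj (tor p x) * (4 * of_real pi ^ 2))"
    unfolding wt_def of_real_divide of_real_mult complex_norm_square by simp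
  thus ?thesis using False by (simp add: kap_def field_simps)
qed (simp add: wt_def)

text \<open>The conjugate of \<open>q\<close> cancels against the weight and leaves a trigonometric
  polynomial over \<open>p\<close>; the shift by \<open>m\<close> is the power of z2 in
  \<open>tf_q\<close>. The condition says that every shifted frequency is positive in some
  coordinate, as \<open>LINT_trig_div_tor\<close> requires.\<close>

lemma ipw_eq_zero:
  assumes K: "finite K" and F: "\<And>x. F x = (\<Sum>k\<in>K. c k * ee (a k) (b k) x)" and L2: "inL2 p F"
    and ab: "\<And>k. k \<in> K \<Longrightarrow> a k - i \<ge> 1 \<or> b k + j + int m \<ge> 1"
  shows "ipw p F (eq i j) = 0"
proof -
  let ?F = "\<lambda>x. \<Sum>k\<in>K. (c k * kap) * ee (a k - i) (b k + j + int m) x"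
  have *: "F x * cnj (eq i j x) * of_real (wt p x) = ?F x / tor p x" for x
  proof -
    have "F x * cnj (eq i j x) * of_real (wt p x) =
      (F x * (ee (- i) j x * ee 0 (int m) x)) * (cnj (tor p x) * of_real (wt p x))"
      by (simp add: eq_def tf_q cnj_ee mult_ac)
    also have "\<dots> = (\<Sum>k\<in>K. c k * ee (a k - i) (b k + j + int m) x) * kap / tor p x"
      unfolding cnj_tor_wt F sum_distrib_right ee_mult by (simp add: mult.assoc ee_mult add.assoc sum_divide_distrib)
    also have "\<dots> = ?F x / tor p x"
      by (simp add: sum_distrib_right sum_divide_distrib mult.assoc mult.commute[of kap])
    finally show ?thesis .
  qed
  have "(LINT x|Tmeas. ?F x / tor p x) = 0"
  proof (rule LINT_trig_div_tor[OF box nz K ab])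
    show "integrable Tmeas (\<lambda>x. ?F x / tor p x)"
      using integrable_ip[OF L2 inL2_eq, of i j] by (simp only: *)
  qed auto
  thus ?thesis unfolding ipw_def * .
qed

text \<open>Since \<open>qt\<close> carries the conjugate of \<open>p\<close>, the arguments of the
  inner product are exchanged to bring \<open>p\<close> back into the denominator. This reverses the
  frequencies of \<open>F\<close>; the shift by \<open>n\<close> is the power of z1 in
  \<open>tf_qt\<close>.\<close>

lemma ipw_et_zero:
  assumes K: "finite K" and F: "\<And>x. F x = (\<Sum>k\<in>K. c k * ee (a k) (b k) x)" and L2: "inL2 p F"
    and ab: "\<And>k. k \<in> K \<Longrightarrow> i + int n - a k \<ge> 1 \<or> - b k - j \<ge> 1"
  shows "ipw p F (et i j) = 0"
proof -
  let ?F = "\<lambda>x. \<Sum>k\<in>K. (cnj (c k) * kap) * ee (i + int n - a k) (- b k - j) x"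
  have *: "et i j x * cnj (F x) * of_real (wt p x) = ?F x / tor p x" for x
  proof -
    have "et i j x * cnj (F x) * of_real (wt p x) =
      (cnj (F x) * (ee i (- j) x * ee (int n) 0 x)) * (cnj (tor p x) * of_real (wt p x))"
      by (simp add: et_def tf_qt mult_ac)
    also have "cnj (F x) * (ee i (- j) x * ee (int n) 0 x) = (\<Sum>k\<in>K. cnj (c k) * ee (i + int n - a k) (- b k - j) x)"
      by (simp add: F sum_distrib_right cnj_ee ee_mult mult.assoc)
    also have "\<dots> * (cnj (tor p x) * of_real (wt p x)) = ?F x / tor p x"
      unfolding cnj_tor_wt by (simp add: sum_distrib_right sum_divide_distrib mult.assoc mult.commute[of kap])
    finally show ?thesis .
  qed
  have "(LINT x|Tmeas. ?F x / tor p x) = 0"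
  proof (rule LINT_trig_div_tor[OF box nz K ab])
    show "integrable Tmeas (\<lambda>x. ?F x / tor p x)"
      using integrable_ip[OF inL2_et L2, of i j] by (simp only: *)
  qed auto
  hence "ipw p (et i j) F = 0" unfolding ipw_def * .
  thus ?thesis using ipw_commute[of p F "et i j"] by simp
qed

lemma tf_pairs: "f \<in> pbox N M \<Longrightarrow>
    tf f x = (\<Sum>k\<in>{..<N} \<times> {..<M}. cf f (fst k) (snd k) * ee (int (fst k)) (- int (snd k)) x)"
  by (simp add: tf_box sum.cartesian_product case_prod_unfold)

lemma ipw_eq_neg:
  assumes "inL2 p (tf f)" "i < 0"
  shows "ipw p (tf f) (eq i j) = 0"
proof -
  obtain N M where f: "f \<in> pbox N M" using ex_pbox by blast
  show ?thesis
    by (rule ipw_eq_zero[OF _ tf_pairs[OF f] assms(1)]) (use assms(2) in auto)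
qed

lemma ipw_et_neg:
  assumes "inL2 p (tf f)" "j < 0"
  shows "ipw p (tf f) (et i j) = 0"
proof -
  obtain N M where f: "f \<in> pbox N M" using ex_pbox by blast
  show ?thesis
    by (rule ipw_et_zero[OF _ tf_pairs[OF f] assms(1)]) (use assms(2) in auto)
qed

text \<open>This is where the size of the box matters: a z2-exponent k < m gives the positive
  frequency j + m - k. The bound by \<open>n\<close> plays the same role for
  \<open>et\<close>.\<close>

lemma ipw_eq_box: "g \<in> pbox n m \<Longrightarrow> inL2 p (tf g) \<Longrightarrow> j \<ge> 0 \<Longrightarrow> ipw p (tf g) (eq i j) = 0"
  by (rule ipw_eq_zero[OF _ tf_pairs]) auto

lemma ipw_et_box: "g \<in> pbox n m \<Longrightarrow> inL2 p (tf g) \<Longrightarrow> i \<ge> 0 \<Longrightarrow> ipw p (tf g) (et i j) = 0"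
  by (rule ipw_et_zero[OF _ tf_pairs]) auto

lemma tf_mult_q: "f \<in> pbox N M \<Longrightarrow>
    tf (f * q) x = (\<Sum>k\<in>{..<N} \<times> {..<M}. cf f (fst k) (snd k) * eq (int (fst k)) (int (snd k)) x)"
  by (simp add: tf_pairs eq_def sum_distrib_right mult.assoc)

lemma tf_mult_qt: "f \<in> pbox N M \<Longrightarrow>
    tf (f * qt) x = (\<Sum>k\<in>{..<N} \<times> {..<M}. cf f (fst k) (snd k) * et (int (fst k)) (int (snd k)) x)"
  by (simp add: tf_pairs et_def sum_distrib_right mult.assoc)

lemma ipw_ideal_zero:
  assumes g: "g \<in> pbox n m" "inL2 p (tf g)" and f: "f \<in> ideal2 q qt"
  shows "ipw p (tf g) (tf f) = 0"
proof -
  obtain a b where ab: "f = a * q + b * qt" using f unfolding ideal2_def by blast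
  obtain N M where a: "a \<in> pbox N M" using ex_pbox by blast
  obtain N' M' where b: "b \<in> pbox N' M'" using ex_pbox by blast
  have "ipw p (tf g) (tf (a * q)) = 0"
    unfolding tf_mult_q[OF a, abs_def]
    by (subst ipw_sum_right) (simp_all add: g inL2_cmult inL2_eq ipw_cmult_right ipw_eq_box)
  moreover have "ipw p (tf g) (tf (b * qt)) = 0"
    unfolding tf_mult_qt[OF b, abs_def]
    by (subst ipw_sum_right) (simp_all add: g inL2_cmult inL2_et ipw_cmult_right ipw_et_box)
  moreover have "tf f = (\<lambda>x. tf (a * q) x + tf (b * qt) x)" by (auto simp: ab)
  ultimately show ?thesis
    using ipw_add_right[OF inL2_mult_q inL2_mult_qt g(2), of a b] by simp
qed

lemma wt_tor: "tor p x \<noteq> 0 \<Longrightarrow> (cmod (tor p x))\<^sup>2 * wt p x = 1 / (4 * pi\<^sup>2)"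
  by (simp add: wt_def)

lemma ipw_pp:
  shows "ipw p (tf f) (pp (int i) (int j)) = cf f i j"
proof -
  have "ipw p (tf f) (pp (int i) (int j)) =
    (LINT x|Tmeas. kap * (tf f x * cnj (ee (int i) (- int j) x)))"
    unfolding ipw_def
  proof (rule integral_cong_AE)
    show "AE x in Tmeas. tf f x * cnj (pp (int i) (int j) x) * complex_of_real (wt p x) =
       kap * (tf f x * cnj (ee (int i) (- int j) x))"
      using AE_tor_nonzero[OF p_nonzero]
    proof eventually_elim
      case (elim x)
      have "tf f x * cnj (pp (int i) (int j) x) * complex_of_real (wt p x) =
        (tf f x * cnj (ee (int i) (- int j) x)) * tor p x * (cnj (tor p x) * complex_of_real (wt p x))"
        by (simp add: pp_def mult_ac)
      thus ?case unfolding cnj_tor_wt using elim by (simp add: mult.commute[of kap])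
    qed
  next
    have [measurable]: "pp (int i) (int j) \<in> borel_measurable Tmeas"
      by (rule inL2_measurable[OF inL2_pp])
    show "(\<lambda>x. tf f x * cnj (pp (int i) (int j) x) * complex_of_real (wt p x)) \<in> borel_measurable Tmeas"
      "(\<lambda>x. kap * (tf f x * cnj (ee (int i) (- int j) x))) \<in> borel_measurable Tmeas"
      by measurable
  qed
  also have "\<dots> = cf f i j"
    by (simp only: integral_mult_right_zero LINT_tf_ee) simp
  finally show ?thesis .
qed

text \<open>Expands the conjugate of \<open>q\<close> in |p|^2 = q conj(q). Together with
  \<open>ipw_pp\<close> this reads f = q (f/q) as a finite convolution of Fourier coefficients,
  which is \<open>cf_eq_sum\<close>.\<close>

lemma pp_eq: "pp i j x = (\<Sum>k\<in>{..<Suc n} \<times> {..<Suc m}.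
    cnj (cf q (fst k) (snd k)) * eq (i - int (fst k)) (j - int (snd k)) x)"
proof -
  have "pp i j x = ee i (- j) x * (tf q x * cnj (tf q x))"
    by (simp add: pp_def tf_q cnj_ee ee_mult mult_ac)
  also have "\<dots> = ee i (- j) x * (tf q x * (\<Sum>k\<in>{..<Suc n} \<times> {..<Suc m}.
       cnj (cf q (fst k) (snd k)) * ee (- int (fst k)) (int (snd k)) x))"
    unfolding tf_pairs[OF q_box] by (simp add: cnj_ee del: sum.lessThan_Suc)
  also have "\<dots> = (\<Sum>k\<in>{..<Suc n} \<times> {..<Suc m}. cnj (cf q (fst k) (snd k)) *
       ((ee i (- j) x * ee (- int (fst k)) (int (snd k)) x) * tf q x))"
    by (simp add: sum_distrib_left mult_ac)
  finally show ?thesis by (simp add: ee_mult eq_def)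
qed

lemma pp_et: "pp i j x = (\<Sum>k\<in>{..<Suc n} \<times> {..<Suc m}.
    cnj (cf qt (fst k) (snd k)) * et (i - int (fst k)) (j - int (snd k)) x)"
proof -
  have "pp i j x = ee i (- j) x * (tf qt x * cnj (tf qt x))"
    by (simp add: pp_def tf_qt cnj_ee ee_mult mult_ac)
  also have "\<dots> = ee i (- j) x * (tf qt x * (\<Sum>k\<in>{..<Suc n} \<times> {..<Suc m}.
       cnj (cf qt (fst k) (snd k)) * ee (- int (fst k)) (int (snd k)) x))"
    unfolding tf_pairs[OF qt_box] by (simp add: cnj_ee del: sum.lessThan_Suc)
  also have "\<dots> = (\<Sum>k\<in>{..<Suc n} \<times> {..<Suc m}. cnj (cf qt (fst k) (snd k)) *
       ((ee i (- j) x * ee (- int (fst k)) (int (snd k)) x) * tf qt x))"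
    by (simp add: sum_distrib_left mult_ac)
  finally show ?thesis by (simp add: ee_mult et_def)
qed

lemma cf_eq_sum: "inL2 p (tf f) \<Longrightarrow> cf f i j = (\<Sum>k\<in>{..<Suc n} \<times> {..<Suc m}.
    cf q (fst k) (snd k) * ipw p (tf f) (eq (int i - int (fst k)) (int j - int (snd k))))"
  unfolding ipw_pp[of f i j, symmetric] pp_eq[abs_def]
  by (subst ipw_sum_right) (simp_all add: ipw_cmult_right inL2_cmult inL2_eq del: sum.lessThan_Suc)

lemma cf_et_sum: "inL2 p (tf f) \<Longrightarrow> cf f i j = (\<Sum>k\<in>{..<Suc n} \<times> {..<Suc m}.
    cf qt (fst k) (snd k) * ipw p (tf f) (et (int i - int (fst k)) (int j - int (snd k))))"
  unfolding ipw_pp[of f i j, symmetric] pp_et[abs_def]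
  by (subst ipw_sum_right) (simp_all add: ipw_cmult_right inL2_cmult inL2_et del: sum.lessThan_Suc)

section \<open>Coefficient bounds and passage to the limit\<close>

definition Ccf :: real where "Ccf = nsq p (pp 0 0) + 1"

lemma cf_bound: "inL2 p (tf f) \<Longrightarrow> (cmod (cf f i j))\<^sup>2 \<le> nsq p (tf f) * Ccf"
proof -
  assume "inL2 p (tf f)"
  hence "(cmod (cf f i j))\<^sup>2 \<le> nsq p (tf f) * (nsq p (pp (int i) (int j)) + 1)"
    using ipw_cauchy[OF _ inL2_pp, of "tf f" "int i" "int j"] by (simp add: ipw_pp)
  \<comment> \<open>Characters have modulus 1, so one constant bounds all coefficients.\<close>
  moreover have "nsq p (pp (int i) (int j)) = nsq p (pp 0 0)"
    by (simp add: nsq_def pp_def norm_mult)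
  ultimately show ?thesis by (simp add: Ccf_def)
qed

lemma Ccf_pos: "Ccf > 0"
  using nsq_nonneg[of p "pp 0 0"] by (simp add: Ccf_def)

text \<open>\<open>p\<close> is bounded on the torus, so the weight is bounded below.\<close>

lemma LINT_le_nsq: "\<exists>C>0. \<forall>f. inL2 p (tf f) \<longrightarrow> (LINT x|Tmeas. (cmod (tf f x))\<^sup>2) \<le> C * nsq p (tf f)"
proof -
  obtain B where B: "B > 0" "\<forall>x\<in>tbox. cmod (tor p x) \<le> B"
    using bounded_on_tbox[OF continuous_on_tor] by blast
  show ?thesis
  proof (intro exI[of _ "4 * pi\<^sup>2 * B\<^sup>2"] conjI allI impI)
    show "0 < 4 * pi\<^sup>2 * B\<^sup>2" using B by simp
    fix f assume f: "inL2 p (tf f)"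
    have "(LINT x|Tmeas. (cmod (tf f x))\<^sup>2) \<le> (LINT x|Tmeas. (4 * pi\<^sup>2 * B\<^sup>2) * ((cmod (tf f x))\<^sup>2 * wt p x))"
    proof (rule integral_mono_AE)
      show "integrable Tmeas (\<lambda>x. (cmod (tf f x))\<^sup>2)"
        by (intro integrable_Tmeas_continuous continuous_intros continuous_on_tf)
      show "integrable Tmeas (\<lambda>x. (4 * pi\<^sup>2 * B\<^sup>2) * ((cmod (tf f x))\<^sup>2 * wt p x))"
        using f by (intro integrable_mult_right inL2_integrable)
      show "AE x in Tmeas. (cmod (tf f x))\<^sup>2 \<le> (4 * pi\<^sup>2 * B\<^sup>2) * ((cmod (tf f x))\<^sup>2 * wt p x)"
        using AE_tor_nonzero[OF p_nonzero] AE_space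
      proof eventually_elim
        case (elim x)
        have "(cmod (tor p x))\<^sup>2 \<le> B\<^sup>2" using B elim by (intro power_mono) auto
        hence "(cmod (tor p x))\<^sup>2 * wt p x \<le> B\<^sup>2 * wt p x" by (rule mult_right_mono) (rule wt_nonneg)
        hence "1 \<le> 4 * pi\<^sup>2 * (B\<^sup>2 * wt p x)"
          unfolding wt_tor[OF elim(1)] by (simp add: field_simps)
        hence "(cmod (tf f x))\<^sup>2 * 1 \<le> (cmod (tf f x))\<^sup>2 * (4 * pi\<^sup>2 * (B\<^sup>2 * wt p x))"
          by (rule mult_left_mono) simp
        thus ?case by (simp add: mult_ac)
      qed
    qed
    also have "\<dots> = 4 * pi\<^sup>2 * B\<^sup>2 * nsq p (tf f)" unfolding nsq_def by simp
    finally show "(LINT x|Tmeas. (cmod (tf f x))\<^sup>2) \<le> 4 * pi\<^sup>2 * B\<^sup>2 * nsq p (tf f)" .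
  qed
qed

text \<open>The weight is unbounded above, so unweighted convergence gives no weighted convergence.
  A subsequence converges almost everywhere, and Fatou's lemma carries the weighted bound to the
  limit.\<close>

lemma nsq_fatou:
  assumes h: "\<And>l. inL2 p (tf (h l))" "\<And>l. nsq p (tf (h l)) \<le> e"
    and lim: "(\<lambda>l. LINT x|Tmeas. (cmod (tf (h l - h0) x))\<^sup>2) \<longlonglongrightarrow> 0"
  shows "inL2 p (tf h0)" "nsq p (tf h0) \<le> e"
proof -
  have e: "e \<ge> 0" using h(2)[of 0] nsq_nonneg[of p "tf (h 0)"] by linarith
  obtain r :: "nat \<Rightarrow> nat" where r: "AE x in Tmeas. (\<lambda>l. (cmod (tf (h (r l) - h0) x))\<^sup>2) \<longlonglongrightarrow> 0"
  proof -
    have "\<exists>r. strict_mono r \<and> (AE x in Tmeas. (\<lambda>l. (cmod (tf (h (r l) - h0) x))\<^sup>2) \<longlonglongrightarrow> 0)"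
    proof (rule tendsto_L1_AE_subseq)
      show "integrable Tmeas (\<lambda>x. (cmod (tf (h l - h0) x))\<^sup>2)" for l
        by (intro integrable_Tmeas_continuous continuous_intros continuous_on_tf)
      show "(\<lambda>l. LINT x|Tmeas. norm ((cmod (tf (h l - h0) x))\<^sup>2)) \<longlonglongrightarrow> 0"
        using lim by (simp del: tf_simps)
    qed
    thus ?thesis using that by blast
  qed
  have "(\<integral>\<^sup>+x. ennreal ((cmod (tf h0 x))\<^sup>2 * wt p x) \<partial>Tmeas) =
      (\<integral>\<^sup>+x. liminf (\<lambda>l. ennreal ((cmod (tf (h (r l)) x))\<^sup>2 * wt p x)) \<partial>Tmeas)"
  proof (rule nn_integral_cong_AE)
    show "AE x in Tmeas. ennreal ((cmod (tf h0 x))\<^sup>2 * wt p x) =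
        liminf (\<lambda>l. ennreal ((cmod (tf (h (r l)) x))\<^sup>2 * wt p x))"
      using r
    proof eventually_elim
      case (elim x)
      have "(\<lambda>l. sqrt ((cmod (tf (h (r l) - h0) x))\<^sup>2)) \<longlonglongrightarrow> sqrt 0"
        using elim by (rule tendsto_real_sqrt)
      hence "(\<lambda>l. tf (h (r l)) x - tf h0 x) \<longlonglongrightarrow> 0"
        by (simp add: tendsto_norm_zero_iff)
      hence "(\<lambda>l. tf (h (r l)) x) \<longlonglongrightarrow> tf h0 x" by (simp only: LIM_zero_iff)
      hence "(\<lambda>l. ennreal ((cmod (tf (h (r l)) x))\<^sup>2 * wt p x)) \<longlonglongrightarrow> ennreal ((cmod (tf h0 x))\<^sup>2 * wt p x)"
        by (intro tendsto_ennrealI tendsto_mult tendsto_power tendsto_norm tendsto_const)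
      thus ?case by (simp add: lim_imp_Liminf)
    qed
  qed
  also have "\<dots> \<le> liminf (\<lambda>l. \<integral>\<^sup>+x. ennreal ((cmod (tf (h (r l)) x))\<^sup>2 * wt p x) \<partial>Tmeas)"
    by (rule nn_integral_liminf) measurable
  also have "\<dots> \<le> liminf (\<lambda>l. ennreal e)"
  proof (rule Liminf_mono, rule always_eventually, rule allI)
    fix l
    have "(\<integral>\<^sup>+x. ennreal ((cmod (tf (h (r l)) x))\<^sup>2 * wt p x) \<partial>Tmeas) = ennreal (nsq p (tf (h (r l))))"
      unfolding nsq_def
      by (rule nn_integral_eq_integral[OF inL2_integrable[OF h(1)]]) (rule AE_I2, rule sq_wt_nonneg)
    thus "(\<integral>\<^sup>+x. ennreal ((cmod (tf (h (r l)) x))\<^sup>2 * wt p x) \<partial>Tmeas) \<le> ennreal e"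
      using h(2)[of "r l"] by (simp add: ennreal_leI)
  qed
  also have "\<dots> = ennreal e" by (simp add: Liminf_const)
  finally have le: "(\<integral>\<^sup>+x. ennreal ((cmod (tf h0 x))\<^sup>2 * wt p x) \<partial>Tmeas) \<le> ennreal e" .
  have int: "integrable Tmeas (\<lambda>x. (cmod (tf h0 x))\<^sup>2 * wt p x)"
  proof (rule integrableI_nonneg)
    show "(\<integral>\<^sup>+x. ennreal ((cmod (tf h0 x))\<^sup>2 * wt p x) \<partial>Tmeas) < \<infinity>"
      using le by (rule le_less_trans) simp
  qed (auto intro!: AE_I2 simp: sq_wt_nonneg)
  thus "inL2 p (tf h0)" by (simp add: inL2_def)
  have "ennreal (nsq p (tf h0)) \<le> ennreal e"
    using le unfolding nsq_def
    by (subst (asm) nn_integral_eq_integral[OF int]) (rule AE_I2, rule sq_wt_nonneg)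
  thus "nsq p (tf h0) \<le> e" using e by (simp add: ennreal_le_iff)
qed

end

section \<open>Projection by minimization\<close>

context disc_nz
begin

lemma parallelogram:
  assumes "inL2 p F" "inL2 p G"
  shows "nsq p (\<lambda>x. F x - G x) = 2 * nsq p F + 2 * nsq p G - 4 * nsq p (\<lambda>x. (1/2) * (F x + G x))"
  using nsq_diff_eq[OF assms] nsq_add_eq[OF assms] nsq_cmult[of p "1/2" "\<lambda>x. F x + G x"]
  by (simp add: power2_eq_square)

text \<open>Stands in for the projection onto the orthogonal complement of \<open>N\<close>, whose
  value need not be a polynomial. The explicit rates come from values within 1/(k+1) of the
  infimum.\<close>

lemma minimizing_sequence:
  assumes N: "is_ideal N" and NL: "\<And>h. h \<in> N \<Longrightarrow> inL2 p (tf h)" and f: "inL2 p (tf f)"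
  shows "\<exists>F. (\<forall>k. F k - f \<in> N) \<and>
    (\<forall>k l. nsq p (tf (F k - F l)) \<le> 2 / real (Suc k) + 2 / real (Suc l)) \<and>
    (\<forall>h\<in>N. (\<lambda>k. ipw p (tf (F k)) (tf h)) \<longlonglongrightarrow> 0)"
proof -
  note I = is_idealD[OF N]
  let ?S = "(\<lambda>h. nsq p (tf (f + h))) ` N"
  define d where "d = Inf ?S"
  have bdd: "bdd_below ?S" by (rule bdd_belowI[of _ 0]) (auto simp: nsq_nonneg)
  have d: "d \<le> nsq p (tf (f + h))" if "h \<in> N" for h
    unfolding d_def using that by (intro cInf_lower bdd) auto
  have "\<exists>h\<in>N. nsq p (tf (f + h)) < d + 1 / real (Suc k)" for k
    using cInf_lessD[of ?S "d + 1 / real (Suc k)"] I(1) by (auto simp: d_def)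
  then obtain H where H: "\<And>k. H k \<in> N" "\<And>k. nsq p (tf (f + H k)) < d + 1 / real (Suc k)"
    by metis
  define F where "F = (\<lambda>k. f + H k)"
  have FL: "inL2 p (tf (F k))" for k
    using inL2_add[OF f NL[OF H(1)[of k]]] by (simp add: F_def[abs_def] tf_simps[abs_def])
  have FN: "F k - f \<in> N" for k using H(1) by (simp add: F_def)
  have cauchy: "nsq p (tf (F k - F l)) \<le> 2 / real (Suc k) + 2 / real (Suc l)" for k l
  proof -
    \<comment> \<open>The midpoint of \<open>F k\<close> and \<open>F l\<close> is again in f + N,
      so its norm is at least \<open>d\<close>, and the parallelogram law bounds the
      difference.\<close>
    have "[:[:1/2:]:] * (H k + H l) \<in> N" by (intro I H)
    moreover have "tf (f + [:[:1/2:]:] * (H k + H l)) = (\<lambda>x. (1/2) * (tf (F k) x + tf (F l) x))"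
      by (auto simp: F_def field_simps)
    ultimately have "d \<le> nsq p (\<lambda>x. (1/2) * (tf (F k) x + tf (F l) x))" by (metis d)
    moreover have "nsq p (tf (F k)) \<le> d + 1 / real (Suc k)" "nsq p (tf (F l)) \<le> d + 1 / real (Suc l)"
      using H(2)[of k] H(2)[of l] by (simp_all add: F_def less_imp_le)
    moreover have "tf (F k - F l) = (\<lambda>x. tf (F k) x - tf (F l) x)" by auto
    ultimately show ?thesis using parallelogram[OF FL[of k] FL[of l]] by simp
  qed
  have orth: "(\<lambda>k. ipw p (tf (F k)) (tf h)) \<longlonglongrightarrow> 0" if h: "h \<in> N" for h
  proof -
    have b: "(cmod (ipw p (tf (F k)) (tf h)))\<^sup>2 \<le> 1 / real (Suc k) * (nsq p (tf h) + 1)" for k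
    proof (rule ipw_bound[OF FL NL[OF h]])
      fix c
      have "H k - [:[:c:]:] * h \<in> N" by (intro I H h)
      moreover have "tf (f + (H k - [:[:c:]:] * h)) = (\<lambda>x. tf (F k) x - c * tf h x)"
        by (auto simp: F_def)
      ultimately have "d \<le> nsq p (\<lambda>x. tf (F k) x - c * tf h x)" by (metis d)
      thus "nsq p (tf (F k)) - 1 / real (Suc k) \<le> nsq p (\<lambda>x. tf (F k) x - c * tf h x)"
        using H(2)[of k] by (simp add: F_def)
    qed
    have lim: "(\<lambda>k. 1 / real (Suc k) * (nsq p (tf h) + 1)) \<longlonglongrightarrow> 0"
      using tendsto_mult[OF lim_1_over_n[THEN LIMSEQ_Suc] tendsto_const, of "nsq p (tf h) + 1"] by simp
    have "(\<lambda>k. (cmod (ipw p (tf (F k)) (tf h)))\<^sup>2) \<longlonglongrightarrow> 0"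
      by (rule real_tendsto_sandwich[OF _ _ tendsto_const lim]) (rule always_eventually, use b in simp)+
    hence "(\<lambda>k. sqrt ((cmod (ipw p (tf (F k)) (tf h)))\<^sup>2)) \<longlonglongrightarrow> sqrt 0" by (rule tendsto_real_sqrt)
    thus ?thesis by (simp add: tendsto_norm_zero_iff)
  qed
  show ?thesis using FN cauchy orth by blast
qed

text \<open>The minimal element of \<open>f + N\<close> has Fourier support in the box: its quotient by \<open>q\<close> lives on
  \<open>i \<ge> 0 > j\<close>, its quotient by \<open>qt\<close> on \<open>j \<ge> 0 > i\<close>.\<close>
lemma approximate_projection:
  assumes N: "is_ideal N" and NL: "\<And>h. h \<in> N \<Longrightarrow> inL2 p (tf h)" and f: "inL2 p (tf f)"
    and qN: "q \<in> N" "qt \<in> N"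
  shows "\<exists>g F. g \<in> pbox n m \<and> inL2 p (tf g) \<and> (\<forall>k. F k - (f - g) \<in> N) \<and>
    (\<forall>k. inL2 p (tf (F k))) \<and> (\<lambda>k. nsq p (tf (F k))) \<longlonglongrightarrow> 0"
proof -
  note I = is_idealD[OF N]
  obtain F where FN: "\<And>k. F k - f \<in> N"
    and cauchy: "\<And>k l. nsq p (tf (F k - F l)) \<le> 2 / real (Suc k) + 2 / real (Suc l)"
    and orth: "\<And>h. h \<in> N \<Longrightarrow> (\<lambda>k. ipw p (tf (F k)) (tf h)) \<longlonglongrightarrow> 0"
    using minimizing_sequence[OF N NL f] by blast
  have FL: "inL2 p (tf (F k))" for k
    using inL2_add[OF f NL[OF FN[of k]]] by (simp add: tf_simps[abs_def])
  have FFL: "inL2 p (tf (F k - F l))" for k l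
    using inL2_diff[OF FL[of k] FL[of l]] by (simp add: tf_simps[abs_def])
  have lim2: "(\<lambda>k. C / real (Suc k)) \<longlonglongrightarrow> 0" for C :: real
    using tendsto_mult[OF tendsto_const lim_1_over_n[THEN LIMSEQ_Suc], of C] by simp
  have "Cauchy (\<lambda>k. cf (F k) i j)" for i j
  proof (rule metric_CauchyI)
    fix e :: real assume e: "e > 0"
    from order_tendstoD(2)[OF lim2[of "4 * Ccf"], of "e\<^sup>2"] e
    obtain K where K: "\<And>k. k \<ge> K \<Longrightarrow> 4 * Ccf / real (Suc k) < e\<^sup>2"
      by (auto simp: eventually_sequentially)
    have "dist (cf (F k) i j) (cf (F l) i j) < e" if kl: "k \<ge> K" "l \<ge> K" for k l
    proof -
      have "(cmod (cf (F k - F l) i j))\<^sup>2 \<le> (2 / real (Suc k) + 2 / real (Suc l)) * Ccf"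
        using cf_bound[OF FFL[of k l], of i j] mult_right_mono[OF cauchy[of k l], of Ccf] Ccf_pos by linarith
      also have "\<dots> = (4 * Ccf / real (Suc k) + 4 * Ccf / real (Suc l)) / 2"
      proof -
        have "(2 / a + 2 / b) * c = (4 * c / a + 4 * c / b) / 2" for a b c :: real
          by (simp add: distrib_right add_divide_distrib)
        thus ?thesis .
      qed
      also have "\<dots> < e\<^sup>2" using K[OF kl(1)] K[OF kl(2)] by simp
      finally have "cmod (cf (F k - F l) i j) < e" using e by (simp add: power_less_imp_less_base)
      thus ?thesis by (simp add: dist_norm)
    qed
    thus "\<exists>M. \<forall>k\<ge>M. \<forall>l\<ge>M. dist (cf (F k) i j) (cf (F l) i j) < e" by blast
  qed
  hence "\<exists>c. (\<lambda>k. cf (F k) i j) \<longlonglongrightarrow> c" for i j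
    by (simp add: Cauchy_convergent_iff convergent_def)
  then obtain g0 where g0: "\<And>i j. (\<lambda>k. cf (F k) i j) \<longlonglongrightarrow> g0 i j" by metis
  \<comment> \<open>For i < 0 the inner product is 0 already because \<open>F k\<close> is a
    polynomial; for i >= 0 the function \<open>eq i j\<close> is a multiple of \<open>q\<close> in
    \<open>N\<close>, to which \<open>F k\<close> becomes orthogonal.\<close>
  have eq0: "(\<lambda>k. ipw p (tf (F k)) (eq i j)) \<longlonglongrightarrow> 0" if j: "j \<ge> 0" for i j
  proof (cases "i < 0")
    case True
    thus ?thesis using ipw_eq_neg[OF FL] by simp
  next
    case False
    have "eq i j = tf (monom (monom 1 (nat i)) (nat j) * q)"
      using False j by (auto simp: eq_def tf_monom)
    thus ?thesis using orth[OF I(3)[OF qN(1)]] by simp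
  qed
  have et0: "(\<lambda>k. ipw p (tf (F k)) (et i j)) \<longlonglongrightarrow> 0" if i: "i \<ge> 0" for i j
  proof (cases "j < 0")
    case True
    thus ?thesis using ipw_et_neg[OF FL] by simp
  next
    case False
    have "et i j = tf (monom (monom 1 (nat i)) (nat j) * qt)"
      using False i by (auto simp: et_def tf_monom)
    thus ?thesis using orth[OF I(3)[OF qN(2)]] by simp
  qed
  \<comment> \<open>The z2-exponents of \<open>q\<close> are at most \<open>m\<close>, so for j >= m
    the convolution meets only indices at which \<open>eq0\<close> applies.\<close>
  have g0j: "g0 i j = 0" if "m \<le> j" for i j
  proof -
    have "(\<lambda>k. cf (F k) i j) \<longlonglongrightarrow> (\<Sum>k\<in>{..<Suc n} \<times> {..<Suc m}. cf q (fst k) (snd k) * 0)"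
      unfolding cf_eq_sum[OF FL, of _ i j] using that
      by (intro tendsto_sum tendsto_mult tendsto_const eq0) auto
    thus ?thesis using g0[of i j] LIMSEQ_unique by fastforce
  qed
  have g0i: "g0 i j = 0" if "n \<le> i" for i j
  proof -
    have "(\<lambda>k. cf (F k) i j) \<longlonglongrightarrow> (\<Sum>k\<in>{..<Suc n} \<times> {..<Suc m}. cf qt (fst k) (snd k) * 0)"
      unfolding cf_et_sum[OF FL, of _ i j] using that
      by (intro tendsto_sum tendsto_mult tendsto_const et0) auto
    thus ?thesis using g0[of i j] LIMSEQ_unique by fastforce
  qed
  define g where "g = mkb g0 n m"
  have cfg: "cf g i j = g0 i j" for i j
    using g0i g0j by (auto simp: g_def not_less)
  have gbox: "g \<in> pbox n m" by (simp add: pbox_def g_def)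
  obtain C where C: "C > 0" "\<And>f. inL2 p (tf f) \<Longrightarrow> (LINT x|Tmeas. (cmod (tf f x))\<^sup>2) \<le> C * nsq p (tf f)"
    using LINT_le_nsq by blast
  \<comment> \<open>The norm of \<open>F k - g\<close> is carried by finitely many coefficients, so
    l may tend to infinity in a finite sum that Bessel's inequality bounds for each l.\<close>
  have A: "(LINT x|Tmeas. (cmod (tf (F k - g) x))\<^sup>2) \<le> 2 * C / real (Suc k)" for k
  proof -
    obtain N0 M0 where NM: "F k - g \<in> pbox N0 M0" using ex_pbox by blast
    let ?S = "\<lambda>c. 4 * pi ^ 2 * (\<Sum>i<N0. \<Sum>j<M0. (cmod (c i j))\<^sup>2)"
    have "?S (cf (F k - g)) \<le> 2 * C / real (Suc k) + 0"
    proof (rule LIMSEQ_le)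
      show "(\<lambda>l. ?S (cf (F k - F l))) \<longlonglongrightarrow> ?S (cf (F k - g))"
        unfolding cf_simps cfg
        by (intro tendsto_mult tendsto_const tendsto_sum tendsto_power tendsto_norm tendsto_diff g0)
      show "(\<lambda>l. 2 * C / real (Suc k) + 2 * C / real (Suc l)) \<longlonglongrightarrow> 2 * C / real (Suc k) + 0"
        by (intro tendsto_add tendsto_const lim2)
      show "\<exists>L. \<forall>l\<ge>L. ?S (cf (F k - F l)) \<le> 2 * C / real (Suc k) + 2 * C / real (Suc l)"
      proof (intro exI allI impI)
        fix l
        have "?S (cf (F k - F l)) \<le> C * nsq p (tf (F k - F l))"
          using bessel_tf C(2)[OF FFL] by (rule order_trans)
        also have "\<dots> \<le> C * (2 / real (Suc k) + 2 / real (Suc l))"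
          using cauchy C(1) by (intro mult_left_mono) auto
        also have "\<dots> = 2 * C / real (Suc k) + 2 * C / real (Suc l)" by (simp add: algebra_simps)
        finally show "?S (cf (F k - F l)) \<le> 2 * C / real (Suc k) + 2 * C / real (Suc l)" .
      qed
    qed
    thus ?thesis by (simp only: parseval_tf[OF NM] add_0_right)
  qed
  have A0: "(\<lambda>k. LINT x|Tmeas. (cmod (tf (F k - g) x))\<^sup>2) \<longlonglongrightarrow> 0"
  proof (rule real_tendsto_sandwich[OF _ _ tendsto_const lim2[of "2 * C"]])
    show "\<forall>\<^sub>F k in sequentially. 0 \<le> (LINT x|Tmeas. (cmod (tf (F k - g) x))\<^sup>2)"
      by (simp del: tf_simps)
    show "\<forall>\<^sub>F k in sequentially. (LINT x|Tmeas. (cmod (tf (F k - g) x))\<^sup>2) \<le> 2 * C / real (Suc k)"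
      using A by (rule always_eventually[OF allI])
  qed
  \<comment> \<open>Fatou's lemma along \<open>F k - F (l + k)\<close>. Starting the second index at
    k makes the bound uniform in l.\<close>
  have fat: "inL2 p (tf (F k - g)) \<and> nsq p (tf (F k - g)) \<le> 4 / real (Suc k)" for k
  proof -
    have e: "nsq p (tf (F k - F (l + k))) \<le> 4 / real (Suc k)" for l
    proof -
      have "2 / real (Suc (l + k)) \<le> 2 / real (Suc k)" by (intro divide_left_mono) auto
      thus ?thesis using cauchy[of k "l + k"] by linarith
    qed
    have "cmod (tf (F k - F (l + k) - (F k - g)) x) = cmod (tf (F (l + k) - g) x)" for l x
      by (simp add: norm_minus_commute)
    hence l: "(\<lambda>l. LINT x|Tmeas. (cmod (tf (F k - F (l + k) - (F k - g)) x))\<^sup>2) \<longlonglongrightarrow> 0"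
      using LIMSEQ_ignore_initial_segment[OF A0, of k] by (simp only:)
    show ?thesis
      using nsq_fatou[of "\<lambda>l. F k - F (l + k)", OF FFL e l] by blast
  qed
  have gL: "inL2 p (tf g)"
    using inL2_diff[OF FL[of 0] conjunct1[OF fat[of 0]]] by (simp add: tf_simps[abs_def])
  have lim0: "(\<lambda>k. nsq p (tf (F k - g))) \<longlonglongrightarrow> 0"
    by (rule real_tendsto_sandwich[OF _ _ tendsto_const lim2[of 4]])
       (use fat nsq_nonneg in \<open>auto intro!: always_eventually\<close>)
  have "F k - g - (f - g) \<in> N" for k using FN[of k] by simp
  thus ?thesis using gbox gL lim0 fat by (intro exI[of _ g] exI[of _ "\<lambda>k. F k - g"]) auto
qed

section \<open>Cancelling linear factors with roots off the open disk\<close>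

lemma AE_ee_neq:
  "AE x in Tmeas. ee 1 0 x \<noteq> c" "AE x in Tmeas. ee 0 (-1) x \<noteq> c"
proof -
  show "AE x in Tmeas. ee 1 0 x \<noteq> c"
    using AE_tor_nonzero[of "zx c"] by (auto simp: tor_def ee_def zx_def)
  have "AE x in Tmeas. tor (zy (cnj c)) x \<noteq> 0"
    by (rule AE_tor_nonzero) (simp add: zy_def)
  thus "AE x in Tmeas. ee 0 (-1) x \<noteq> c"
  proof eventually_elim
    case (elim x)
    hence "cis (snd x) \<noteq> cnj c" by (simp add: tor_def)
    hence "cnj (cis (snd x)) \<noteq> c" by (metis complex_cnj_cnj)
    thus ?case by (simp add: ee_def cis_cnj)
  qed
qed

text \<open>The moments \<open>c i\<close> of \<open>\<Phi>\<close> satisfy \<open>c (i + 1) = \<mu> c i\<close>, so \<open>c 0\<close> is the mean of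
  \<open>\<mu> powi (- i) * c i\<close>, and the means of \<open>(e / \<mu>) ^ i\<close> tend to \<open>0\<close> boundedly.\<close>
lemma LINT_eq_0_of_recurrence:
  assumes \<Phi>: "integrable Tmeas \<Phi>" and \<mu>: "cmod \<mu> \<ge> 1" and AE: "AE x in Tmeas. ee a b x \<noteq> \<mu>"
    and rec: "\<And>i. (LINT x|Tmeas. ee a b x ^ i * (ee a b x - \<mu>) * \<Phi> x) = 0"
  shows "(LINT x|Tmeas. \<Phi> x) = (0 :: complex)"
proof -
  have [measurable]: "\<Phi> \<in> borel_measurable Tmeas" using \<Phi> by simp
  have \<mu>0: "\<mu> \<noteq> 0" using \<mu> by auto
  have int: "integrable Tmeas (\<lambda>x. ee a b x ^ i * \<Phi> x)" for i
  proof (rule Bochner_Integration.integrable_bound[OF \<Phi>])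
    show "AE x in Tmeas. cmod (ee a b x ^ i * \<Phi> x) \<le> cmod (\<Phi> x)"
      by (simp add: norm_mult norm_power)
  qed measurable
  have step: "(LINT x|Tmeas. ee a b x ^ Suc i * \<Phi> x) = \<mu> * (LINT x|Tmeas. ee a b x ^ i * \<Phi> x)" for i
  proof -
    have "ee a b x ^ i * (ee a b x - \<mu>) * \<Phi> x = ee a b x ^ Suc i * \<Phi> x - \<mu> * (ee a b x ^ i * \<Phi> x)" for x
      by (simp add: algebra_simps)
    hence "0 = (LINT x|Tmeas. ee a b x ^ Suc i * \<Phi> x - \<mu> * (ee a b x ^ i * \<Phi> x))"
      using rec[of i] by simp
    also have "\<dots> = (LINT x|Tmeas. ee a b x ^ Suc i * \<Phi> x) - (LINT x|Tmeas. \<mu> * (ee a b x ^ i * \<Phi> x))"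
      by (intro Bochner_Integration.integral_diff int integrable_mult_right)
    finally show ?thesis by simp
  qed
  have pow: "(LINT x|Tmeas. ee a b x ^ i * \<Phi> x) = \<mu> ^ i * (LINT x|Tmeas. \<Phi> x)" for i
    by (induction i) (simp_all only: step, simp_all)
  define S where "S = (\<lambda>k x. inverse (of_nat (Suc k)) * (\<Sum>i<Suc k. (ee a b x / \<mu>) ^ i) * \<Phi> x)"
  have "(LINT x|Tmeas. S k x) = (LINT x|Tmeas. \<Phi> x)" for k
  proof -
    have "S k x = inverse (of_nat (Suc k)) * (\<Sum>i<Suc k. inverse (\<mu> ^ i) * (ee a b x ^ i * \<Phi> x))" for x
    proof -
      have "(ee a b x / \<mu>) ^ i * \<Phi> x = inverse (\<mu> ^ i) * (ee a b x ^ i * \<Phi> x)" for i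
        by (simp add: power_divide field_simps)
      thus ?thesis by (simp only: S_def mult.assoc sum_distrib_right)
    qed
    hence "(LINT x|Tmeas. S k x) = inverse (of_nat (Suc k)) *
        (LINT x|Tmeas. (\<Sum>i<Suc k. inverse (\<mu> ^ i) * (ee a b x ^ i * \<Phi> x)))"
      by (simp only: integral_mult_right_zero)
    also have "(LINT x|Tmeas. (\<Sum>i<Suc k. inverse (\<mu> ^ i) * (ee a b x ^ i * \<Phi> x))) =
        (\<Sum>i<Suc k. LINT x|Tmeas. inverse (\<mu> ^ i) * (ee a b x ^ i * \<Phi> x))"
      by (intro Bochner_Integration.integral_sum integrable_mult_right int)
    also have "\<dots> = (\<Sum>i<Suc k. (LINT x|Tmeas. \<Phi> x))"
      using \<mu>0 by (intro sum.cong refl) (simp only: integral_mult_right_zero pow, simp)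
    also have "inverse (of_nat (Suc k)) * \<dots> = (LINT x|Tmeas. \<Phi> x)"
      by (simp add: field_simps del: of_nat_Suc)
    finally show ?thesis .
  qed
  moreover have "(\<lambda>k. LINT x|Tmeas. S k x) \<longlonglongrightarrow> (LINT x|Tmeas. 0)"
  proof (rule integral_dominated_convergence)
    show "integrable Tmeas (\<lambda>x. cmod (\<Phi> x))" using \<Phi> by (rule integrable_norm)
    show "S k \<in> borel_measurable Tmeas" for k unfolding S_def by measurable
    have w1: "cmod (ee a b x / \<mu>) \<le> 1" for x
      using \<mu> \<mu>0 by (simp add: norm_divide divide_le_eq_1_pos)
    show "AE x in Tmeas. cmod (S k x) \<le> cmod (\<Phi> x)" for k
    proof (rule AE_I2)
      fix x
      have "cmod (\<Sum>i<Suc k. (ee a b x / \<mu>) ^ i) \<le> (\<Sum>i<Suc k. 1)"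
        using w1[of x] by (intro sum_norm_le) (simp add: norm_power power_le_one)
      hence "inverse (real (Suc k)) * cmod (\<Sum>i<Suc k. (ee a b x / \<mu>) ^ i) \<le> inverse (real (Suc k)) * real (Suc k)"
        by (intro mult_left_mono) auto
      hence "inverse (real (Suc k)) * cmod (\<Sum>i<Suc k. (ee a b x / \<mu>) ^ i) \<le> 1" by simp
      hence "inverse (real (Suc k)) * cmod (\<Sum>i<Suc k. (ee a b x / \<mu>) ^ i) * cmod (\<Phi> x) \<le> 1 * cmod (\<Phi> x)"
        by (rule mult_right_mono) simp
      thus "cmod (S k x) \<le> cmod (\<Phi> x)"
        by (simp only: S_def norm_mult norm_inverse norm_of_nat mult_1)
    qed
    show "AE x in Tmeas. (\<lambda>k. S k x) \<longlonglongrightarrow> 0"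
      using AE
    proof eventually_elim
      case (elim x)
      define w where "w = ee a b x / \<mu>"
      have w: "w \<noteq> 1" "cmod w \<le> 1" using elim \<mu>0 w1[of x] by (auto simp: w_def)
      \<comment> \<open>The numerator of the geometric sum is at most 2 in modulus, so the sums stay
        bounded in k and their means tend to 0.\<close>
      define D where "D = 2 / cmod (w - 1)"
      have b: "cmod (\<Sum>i<Suc k. w ^ i) \<le> D" for k
      proof -
        have "cmod (w ^ Suc k - 1) \<le> cmod (w ^ Suc k) + 1"
          using norm_triangle_ineq4[of "w ^ Suc k" 1] by simp
        also have "cmod (w ^ Suc k) \<le> 1" unfolding norm_power using w(2) by (intro power_le_one) auto
        finally have "cmod (w ^ Suc k - 1) / cmod (w - 1) \<le> D"
          unfolding D_def by (intro divide_right_mono) auto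
        thus ?thesis using w(1) by (simp only: geometric_sum[OF w(1)] norm_divide)
      qed
      have "(\<lambda>k. D * cmod (\<Phi> x) * (1 / real (Suc k))) \<longlonglongrightarrow> D * cmod (\<Phi> x) * 0"
        by (intro tendsto_mult tendsto_const lim_1_over_n[THEN LIMSEQ_Suc])
      moreover have "cmod (S k x) \<le> D * cmod (\<Phi> x) * (1 / real (Suc k))" for k
      proof -
        have "S k x = inverse (of_nat (Suc k)) * (\<Sum>i<Suc k. w ^ i) * \<Phi> x"
          by (simp only: S_def w_def)
        hence "cmod (S k x) = cmod (\<Sum>i<Suc k. w ^ i) * (cmod (\<Phi> x) * (1 / real (Suc k)))"
          by (simp only: norm_mult norm_inverse norm_of_nat divide_inverse mult_ac mult_1_left)
        also have "\<dots> \<le> D * (cmod (\<Phi> x) * (1 / real (Suc k)))"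
          by (intro mult_right_mono b) auto
        finally show ?thesis by (simp only: mult.assoc)
      qed
      ultimately show ?case
        by (intro Lim_null_comparison[of "\<lambda>k. S k x" "\<lambda>k. D * cmod (\<Phi> x) * (1 / real (Suc k))"])
           (auto intro!: always_eventually)
    qed
  qed simp
  ultimately show ?thesis by (simp add: LIMSEQ_const_iff)
qed

lemma tf_zx: "tf (zx c) x = ee 1 0 x - c" and tf_zy: "tf (zy c) x = ee 0 (-1) x - c"
  by (simp_all add: tf_def ee_def)

lemma inL2_mult_poly: "inL2 p (tf f) \<Longrightarrow> inL2 p (tf (h * f))"
  using inL2_mult_continuous[OF _ continuous_on_tf, of p "tf f" h] by (simp add: tf_simps[abs_def])

text \<open>The pair \<open>ab\<close> is the frequency of the variable that occurs in
  \<open>L\<close>, which treats both variables at once. Testing the hypothesis on multiples by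
  powers of that variable gives the recurrence of the moments.\<close>

lemma ipw_cancel_factor:
  fixes ab :: "int \<times> int"
  assumes f: "inL2 p (tf f)" and g: "inL2 p (tf g)" and \<mu>: "cmod \<mu> \<ge> 1"
    and L: "L = zx \<mu> \<and> ab = (1, 0) \<or> L = zy \<mu> \<and> ab = (0, -1)"
    and zero: "\<And>h. ipw p (tf (h * (L * f))) (tf g) = 0"
  shows "ipw p (tf (h * f)) (tf g) = 0"
proof -
  define L0 where "L0 = (if ab = (1, 0) then zx 0 else zy 0)"
  have L0: "tf L0 x = ee (fst ab) (snd ab) x" and LL: "tf L x = ee (fst ab) (snd ab) x - \<mu>" for x
    using L by (auto simp: L0_def tf_zx tf_zy)
  have L0k: "tf (L0 ^ k) x = ee (fst ab) (snd ab) x ^ k" for k x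
    by (induction k) (simp_all add: L0)
  show ?thesis
    unfolding ipw_def
  proof (rule LINT_eq_0_of_recurrence[OF _ \<mu>, of _ "fst ab" "snd ab"])
    show "integrable Tmeas (\<lambda>x. tf (h * f) x * cnj (tf g x) * complex_of_real (wt p x))"
      by (intro integrable_ip inL2_mult_poly f g)
    show "AE x in Tmeas. ee (fst ab) (snd ab) x \<noteq> \<mu>"
      using L AE_ee_neq by auto
    fix i
    show "(LINT x|Tmeas. ee (fst ab) (snd ab) x ^ i * (ee (fst ab) (snd ab) x - \<mu>) *
         (tf (h * f) x * cnj (tf g x) * complex_of_real (wt p x))) = 0"
      using zero[of "L0 ^ i * h"] unfolding ipw_def
      by (simp add: L0k LL mult_ac)
  qed
qed

end

section \<open>Closed ideals\<close>

text \<open>Weighted \<open>l\<^sup>1\<close> norms of the coefficients: for them, division by a linear factor with root of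
  modulus less than \<open>\<rho>\<close> is bounded.\<close>
definition w1 :: "real \<Rightarrow> complex poly \<Rightarrow> real" where
  "w1 \<rho> a = poly (map_poly cmod a) \<rho>"

definition w2 :: "real \<Rightarrow> complex poly poly \<Rightarrow> real" where
  "w2 \<rho> f = poly (map_poly (w1 \<rho>) f) \<rho>"

lemma w1_0 [simp]: "w1 \<rho> 0 = 0" by (simp add: w1_def)
lemma w2_0 [simp]: "w2 \<rho> 0 = 0" by (simp add: w2_def)

lemma w1_pCons [simp]: "w1 \<rho> (pCons c a) = cmod c + \<rho> * w1 \<rho> a"
  by (simp add: w1_def map_poly_pCons)

lemma w2_pCons [simp]: "w2 \<rho> (pCons c a) = w1 \<rho> c + \<rho> * w2 \<rho> a"
  by (simp add: w2_def map_poly_pCons)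

lemma w1_nonneg: "\<rho> \<ge> 0 \<Longrightarrow> w1 \<rho> a \<ge> 0"
  by (induction a) auto

lemma w2_nonneg: "\<rho> \<ge> 0 \<Longrightarrow> w2 \<rho> f \<ge> 0"
  by (induction f) (auto simp: w1_nonneg)

text \<open>A geometric series: for a radius below 1, a uniform bound on the coefficients suffices
  whatever the degree. This matters because the degrees in a sequence of polynomials are not
  bounded.\<close>

lemma w1_le:
  assumes "\<And>i. cmod (coeff a i) \<le> b" "0 \<le> \<rho>" "\<rho> < 1"
  shows "w1 \<rho> a \<le> b / (1 - \<rho>)"
  using assms(1)
proof (induction a)
  case 0
  have "0 \<le> b" using 0[of 0] by simp
  thus ?case using assms(3) by simp
next
  case (pCons c a)
  have c: "cmod c \<le> b" using pCons.prems[of 0] by simp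
  have "cmod (coeff a i) \<le> b" for i using pCons.prems[of "Suc i"] by simp
  hence "\<rho> * w1 \<rho> a \<le> \<rho> * (b / (1 - \<rho>))" using pCons.IH assms(2) by (intro mult_left_mono) auto
  hence "w1 \<rho> (pCons c a) \<le> b + \<rho> * (b / (1 - \<rho>))" using c by simp
  also have "\<dots> = b / (1 - \<rho>)" using assms(3) by (simp add: field_simps)
  finally show ?case .
qed

lemma w2_le:
  assumes "\<And>i j. cmod (cf f i j) \<le> b" "0 \<le> \<rho>" "\<rho> < 1"
  shows "w2 \<rho> f \<le> b / (1 - \<rho>) / (1 - \<rho>)"
  using assms(1)
proof (induction f)
  case 0
  have "0 \<le> b" using 0[of 0 0] by simp
  thus ?case using assms(3) by simp
next
  case (pCons c a)
  have c: "w1 \<rho> c \<le> b / (1 - \<rho>)"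
    using pCons.prems[of _ 0] assms by (intro w1_le) (auto simp: cf_def)
  have "cmod (cf a i j) \<le> b" for i j using pCons.prems[of i "Suc j"] by (simp add: cf_def)
  hence "\<rho> * w2 \<rho> a \<le> \<rho> * (b / (1 - \<rho>) / (1 - \<rho>))" using pCons.IH assms(2) by (intro mult_left_mono) auto
  hence "w2 \<rho> (pCons c a) \<le> b / (1 - \<rho>) + \<rho> * (b / (1 - \<rho>) / (1 - \<rho>))" using c by simp
  also have "\<dots> = b / (1 - \<rho>) / (1 - \<rho>)"
  proof -
    have "B + \<rho> * (B / (1 - \<rho>)) = B / (1 - \<rho>)" for B using assms(3) by (simp add: field_simps)
    thus ?thesis .
  qed
  finally show ?case .
qed

text \<open>Horner's scheme. Quotient and remainder share one inequality because each step of the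
  induction trades one for the other.\<close>

lemma w1_synthetic_div:
  assumes "cmod c \<le> \<rho>"
  shows "(\<rho> - cmod c) * w1 \<rho> (synthetic_div a c) + cmod (poly a c) \<le> w1 \<rho> a"
proof (induction a)
  case (pCons b a)
  have \<rho>: "\<rho> \<ge> 0" using assms norm_ge_zero[of c] by linarith
  have "cmod (poly (pCons b a) c) \<le> cmod b + cmod c * cmod (poly a c)"
    using norm_triangle_ineq[of b "c * poly a c"] by (simp add: norm_mult)
  moreover have "\<rho> * ((\<rho> - cmod c) * w1 \<rho> (synthetic_div a c) + cmod (poly a c)) \<le> \<rho> * w1 \<rho> a"
    using pCons.IH \<rho> by (rule mult_left_mono)
  ultimately show ?case by (simp add: algebra_simps)
qed simp

text \<open>The polynomials in z2 alone, which are the remainders of division by z1 - c.\<close>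

definition const1 :: "complex poly poly set" where
  "const1 = {f. \<forall>j. degree (coeff f j) = 0}"

lemma const1_pCons: "pCons a f \<in> const1 \<longleftrightarrow> degree a = 0 \<and> f \<in> const1"
  unfolding const1_def by (auto simp: coeff_pCons split: nat.splits)

lemma divide_zx:
  assumes "cmod c < \<rho>"
  shows "\<exists>K\<ge>0. \<forall>f. \<exists>f'. \<exists>r\<in>const1. f = zx c * f' + r \<and> w2 \<rho> f' \<le> K * w2 \<rho> f \<and> w2 \<rho> r \<le> w2 \<rho> f"
proof (rule exI, intro conjI allI)
  let ?K = "1 / (\<rho> - cmod c)"
  have \<rho>: "\<rho> \<ge> 0" using assms norm_ge_zero[of c] by linarith
  show "?K \<ge> 0" using assms by simp
  fix f
  show "\<exists>f'. \<exists>r\<in>const1. f = zx c * f' + r \<and> w2 \<rho> f' \<le> ?K * w2 \<rho> f \<and> w2 \<rho> r \<le> w2 \<rho> f"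
  proof (induction f)
    case 0
    show ?case by (rule exI[of _ 0], rule bexI[of _ 0]) (auto simp: const1_def)
  next
    case (pCons a f)
    then obtain f' r where IH: "r \<in> const1" "f = zx c * f' + r" "w2 \<rho> f' \<le> ?K * w2 \<rho> f" "w2 \<rho> r \<le> w2 \<rho> f"
      by blast
    let ?a' = "synthetic_div a c" and ?b = "[:poly a c:]"
    have a: "a = [:- c, 1:] * ?a' + ?b"
      using synthetic_div_correct'[of c a] by simp
    have wa: "(\<rho> - cmod c) * w1 \<rho> ?a' + cmod (poly a c) \<le> w1 \<rho> a"
      using assms by (intro w1_synthetic_div) simp
    have 1: "w1 \<rho> ?a' \<le> ?K * w1 \<rho> a"
    proof -
      have "(\<rho> - cmod c) * w1 \<rho> ?a' \<le> w1 \<rho> a" using wa norm_ge_zero[of "poly a c"] by linarith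
      thus ?thesis using assms by (simp add: field_simps)
    qed
    have 2: "cmod (poly a c) \<le> w1 \<rho> a"
    proof -
      have "0 \<le> (\<rho> - cmod c) * w1 \<rho> ?a'" using assms w1_nonneg[OF \<rho>] by (intro mult_nonneg_nonneg) auto
      thus ?thesis using wa by linarith
    qed
    show ?case
    proof (intro exI[of _ "pCons ?a' f'"] bexI[of _ "pCons ?b r"] conjI)
      show "pCons ?b r \<in> const1" using IH by (simp add: const1_pCons)
      have "pCons a f = pCons ([:- c, 1:] * ?a' + ?b) (zx c * f' + r)" using a IH(2) by simp
      also have "\<dots> = zx c * pCons ?a' f' + pCons ?b r" by (simp add: zx_def)
      finally show "pCons a f = zx c * pCons ?a' f' + pCons ?b r" .
      have "\<rho> * w2 \<rho> f' \<le> \<rho> * (?K * w2 \<rho> f)" using IH(3) \<rho> by (rule mult_left_mono)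
      thus "w2 \<rho> (pCons ?a' f') \<le> ?K * w2 \<rho> (pCons a f)"
        using 1 by (simp only: w2_pCons distrib_left mult.left_commute[of ?K])
      show "w2 \<rho> (pCons ?b r) \<le> w2 \<rho> (pCons a f)"
        using 2 mult_left_mono[OF IH(4) \<rho>] by simp
    qed
  qed
qed

lemma divide_zy:
  assumes "cmod c < \<rho>"
  shows "\<exists>K\<ge>0. \<forall>f\<in>const1. \<exists>f'\<in>const1. \<exists>r\<in>range (\<lambda>s. [:[:s:]:]).
     f = zy c * f' + r \<and> w2 \<rho> f' \<le> K * w2 \<rho> f \<and> w2 \<rho> r \<le> w2 \<rho> f"
proof (intro exI conjI ballI)
  let ?K = "1 / (\<rho> - cmod c)"
  have \<rho>: "\<rho> \<ge> 0" using assms norm_ge_zero[of c] by linarith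
  show "?K \<ge> 0" using assms by simp
  fix f assume "f \<in> const1"
  hence "\<exists>f'\<in>const1. \<exists>s. f = zy c * f' + [:[:s:]:] \<and> (\<rho> - cmod c) * w2 \<rho> f' + cmod s \<le> w2 \<rho> f"
  proof (induction f)
    case 0
    show ?case by (rule bexI[of _ 0]) (auto simp: const1_def)
  next
    case (pCons a f)
    hence af: "degree a = 0" "f \<in> const1" by (simp_all add: const1_pCons)
    then obtain b where b: "a = [:b:]" by (elim degree_eq_zeroE)
    obtain f' s where IH: "f' \<in> const1" "f = zy c * f' + [:[:s:]:]" "(\<rho> - cmod c) * w2 \<rho> f' + cmod s \<le> w2 \<rho> f"
      using pCons.IH[OF af(2)] by blast
    show ?case
    proof (intro bexI[of _ "pCons [:s:] f'"] exI[of _ "b + c * s"] conjI)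
      show "pCons [:s:] f' \<in> const1" using IH by (simp add: const1_pCons)
      show "pCons a f = zy c * pCons [:s:] f' + [:[:b + c * s:]:]"
        unfolding IH(2) b zy_def by simp
      have "cmod (b + c * s) \<le> cmod b + cmod c * cmod s"
        using norm_triangle_ineq[of b "c * s"] by (simp add: norm_mult)
      moreover have "\<rho> * ((\<rho> - cmod c) * w2 \<rho> f' + cmod s) \<le> \<rho> * w2 \<rho> f"
        using IH(3) \<rho> by (rule mult_left_mono)
      ultimately show "(\<rho> - cmod c) * w2 \<rho> (pCons [:s:] f') + cmod (b + c * s) \<le> w2 \<rho> (pCons a f)"
        by (simp add: b algebra_simps)
    qed
  qed
  then obtain f' s where f': "f' \<in> const1" "f = zy c * f' + [:[:s:]:]" "(\<rho> - cmod c) * w2 \<rho> f' + cmod s \<le> w2 \<rho> f"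
    by blast
  have "w2 \<rho> f' \<le> ?K * w2 \<rho> f"
  proof -
    have "(\<rho> - cmod c) * w2 \<rho> f' \<le> w2 \<rho> f" using f'(3) norm_ge_zero[of s] by linarith
    thus ?thesis using assms by (simp add: field_simps)
  qed
  moreover have "cmod s \<le> w2 \<rho> f"
  proof -
    have "0 \<le> (\<rho> - cmod c) * w2 \<rho> f'" using assms w2_nonneg[OF \<rho>] by (intro mult_nonneg_nonneg) auto
    thus ?thesis using f'(3) by linarith
  qed
  ultimately show "\<exists>f'\<in>const1. \<exists>r\<in>range (\<lambda>s. [:[:s:]:]).
     f = zy c * f' + r \<and> w2 \<rho> f' \<le> ?K * w2 \<rho> f \<and> w2 \<rho> r \<le> w2 \<rho> f"
    using f' by (intro bexI[of _ f'] bexI[of _ "[:[:s:]:]"]) auto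
qed

text \<open>Generic in \<open>V\<close> and \<open>V'\<close> because it is applied twice: from all
  polynomials to polynomials in z2, and from these to constants. The \<open>e k\<close> are partial
  products of the factors and do not depend on \<open>f\<close>; only the coefficients do, and they
  are bounded by \<open>f\<close>.\<close>

lemma reduce_mod_product:
  assumes div: "\<And>x. x \<in># M \<Longrightarrow> \<exists>K\<ge>0. \<forall>f\<in>V. \<exists>f'\<in>V. \<exists>r\<in>V'. f = L x * f' + r \<and>
      w2 \<rho> f' \<le> K * w2 \<rho> f \<and> w2 \<rho> r \<le> w2 \<rho> f" and \<rho>: "\<rho> \<ge> 0"
  shows "\<exists>(D::nat) e C. C \<ge> 0 \<and> (\<forall>f\<in>V. \<exists>c. (\<forall>k<D. c k \<in> V' \<and> w2 \<rho> (c k) \<le> C * w2 \<rho> f) \<and>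
      (\<Prod>x\<in>#M. L x) dvd f - (\<Sum>k<D. c k * e k))"
  using div
proof (induction M)
  case empty
  show ?case by (rule exI[of _ 0], rule exI, rule exI[of _ 0]) auto
next
  case (add x M)
  have "\<exists>(D::nat) e C. C \<ge> 0 \<and> (\<forall>f\<in>V. \<exists>c. (\<forall>k<D. c k \<in> V' \<and> w2 \<rho> (c k) \<le> C * w2 \<rho> f) \<and>
      (\<Prod>x\<in>#M. L x) dvd f - (\<Sum>k<D. c k * e k))"
    by (rule add.IH) (rule add.prems, simp)
  then obtain D e C where C: "C \<ge> 0" and IH: "\<And>f. f \<in> V \<Longrightarrow> \<exists>c. (\<forall>k<(D::nat). c k \<in> V' \<and> w2 \<rho> (c k) \<le> C * w2 \<rho> f) \<and>
      (\<Prod>x\<in>#M. L x) dvd f - (\<Sum>k<D. c k * e k)"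
    by blast
  obtain K where K: "K \<ge> 0" "\<And>f. f \<in> V \<Longrightarrow> \<exists>f'\<in>V. \<exists>r\<in>V'. f = L x * f' + r \<and>
      w2 \<rho> f' \<le> K * w2 \<rho> f \<and> w2 \<rho> r \<le> w2 \<rho> f"
    using add.prems[of x] by auto
  define e' where "e' = (\<lambda>k. if k < D then L x * e k else 1)"
  have "\<exists>c. (\<forall>k<Suc D. c k \<in> V' \<and> w2 \<rho> (c k) \<le> (C * K + 1) * w2 \<rho> f) \<and>
      (\<Prod>x\<in>#add_mset x M. L x) dvd f - (\<Sum>k<Suc D. c k * e' k)" if f: "f \<in> V" for f
  proof -
    obtain f' r where f': "f' \<in> V" "r \<in> V'" "f = L x * f' + r" "w2 \<rho> f' \<le> K * w2 \<rho> f" "w2 \<rho> r \<le> w2 \<rho> f"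
      using K(2)[OF f] by blast
    obtain c where c: "\<And>k. k < D \<Longrightarrow> c k \<in> V' \<and> w2 \<rho> (c k) \<le> C * w2 \<rho> f'"
      "(\<Prod>x\<in>#M. L x) dvd f' - (\<Sum>k<D. c k * e k)"
      using IH[OF f'(1)] by blast
    define c' where "c' = (\<lambda>k. if k < D then c k else r)"
    have "f - (\<Sum>k<Suc D. c' k * e' k) = L x * (f' - (\<Sum>k<D. c k * e k))"
      by (simp add: c'_def e'_def f'(3) right_diff_distrib sum_distrib_left mult.left_commute)
    hence 1: "(\<Prod>x\<in>#add_mset x M. L x) dvd f - (\<Sum>k<Suc D. c' k * e' k)"
      using c(2) by (simp add: mult_dvd_mono)
    have w: "0 \<le> w2 \<rho> f" using \<rho> by (rule w2_nonneg)
    have 2: "c' k \<in> V' \<and> w2 \<rho> (c' k) \<le> (C * K + 1) * w2 \<rho> f" if "k < Suc D" for k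
    proof (cases "k < D")
      case True
      have "w2 \<rho> (c k) \<le> C * w2 \<rho> f'" using c(1)[OF True] by blast
      also have "\<dots> \<le> C * (K * w2 \<rho> f)" using f'(4) C by (rule mult_left_mono)
      also have "\<dots> \<le> (C * K + 1) * w2 \<rho> f" using w by (simp add: algebra_simps)
      finally show ?thesis using c(1)[OF True] True by (simp add: c'_def)
    next
      case False
      have "w2 \<rho> f \<le> (C * K + 1) * w2 \<rho> f" using w C K(1) by (simp add: algebra_simps)
      thus ?thesis using False f'(2,5) by (simp add: c'_def)
    qed
    show ?thesis using 1 2 by (intro exI[of _ c']) auto
  qed
  moreover have "C * K + 1 \<ge> 0" using C K(1) by simp
  ultimately show ?case by (intro exI[of _ "Suc D"] exI[of _ e'] exI[of _ "C * K + 1"]) auto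
qed

text \<open>Reduction in z1, then of the remainders in z2. The fixed elements \<open>e k\<close>
  span all polynomials modulo \<open>N\<close>, with coordinates controlled by the norm of
  \<open>f\<close>.\<close>

lemma reduce_mod_ideal:
  assumes N: "is_ideal N" and A: "\<And>x. x \<in># A \<Longrightarrow> cmod x < \<rho>" "(\<Prod>x\<in>#A. zx x) \<in> N"
    and B: "\<And>y. y \<in># B \<Longrightarrow> cmod y < \<rho>" "(\<Prod>y\<in>#B. zy y) \<in> N" and \<rho>: "\<rho> \<ge> 0"
  shows "\<exists>K e C. finite (K :: (nat \<times> nat) set) \<and> (\<forall>f. \<exists>c. (\<forall>k\<in>K. cmod (c k) \<le> C * w2 \<rho> f) \<and>
     f - (\<Sum>k\<in>K. [:[:c k:]:] * e k) \<in> N)"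
proof -
  note I = is_idealD[OF N]
  obtain D1 e1 C1 where 1: "C1 \<ge> 0" "\<And>f. \<exists>c. (\<forall>k<(D1::nat). c k \<in> const1 \<and> w2 \<rho> (c k) \<le> C1 * w2 \<rho> f) \<and>
      (\<Prod>x\<in>#A. zx x) dvd f - (\<Sum>k<D1. c k * e1 k)"
    using reduce_mod_product[of A UNIV const1 zx \<rho>] divide_zx[OF A(1)] \<rho> by auto
  have "\<exists>(D::nat) e C. C \<ge> 0 \<and> (\<forall>f\<in>const1. \<exists>c. (\<forall>k<D. c k \<in> range (\<lambda>s. [:[:s:]:]) \<and> w2 \<rho> (c k) \<le> C * w2 \<rho> f) \<and>
      (\<Prod>y\<in>#B. zy y) dvd f - (\<Sum>k<D. c k * e k))"
    by (rule reduce_mod_product[OF divide_zy[OF B(1)] \<rho>])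
  then obtain D2 e2 C2 where 2: "C2 \<ge> 0" "\<And>f. f \<in> const1 \<Longrightarrow> \<exists>c. (\<forall>k<(D2::nat). c k \<in> range (\<lambda>s. [:[:s:]:]) \<and>
      w2 \<rho> (c k) \<le> C2 * w2 \<rho> f) \<and> (\<Prod>y\<in>#B. zy y) dvd f - (\<Sum>k<D2. c k * e2 k)"
    by blast
  let ?K = "{..<D1} \<times> {..<D2}"
  define e where "e = (\<lambda>k. e2 (snd k) * e1 (fst k))"
  have "\<exists>c. (\<forall>k\<in>?K. cmod (c k) \<le> C2 * C1 * w2 \<rho> f) \<and> f - (\<Sum>k\<in>?K. [:[:c k:]:] * e k) \<in> N" for f
  proof -
    obtain c where c: "\<And>k. k < D1 \<Longrightarrow> c k \<in> const1 \<and> w2 \<rho> (c k) \<le> C1 * w2 \<rho> f"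
      "(\<Prod>x\<in>#A. zx x) dvd f - (\<Sum>k<D1. c k * e1 k)"
      using 1(2)[of f] by blast
    have ex: "\<exists>d. (\<forall>l<D2. cmod (d l) \<le> C2 * w2 \<rho> (c k)) \<and> c k - (\<Sum>l<D2. [:[:d l:]:] * e2 l) \<in> N"
      if k: "k < D1" for k
    proof -
      obtain d' where d': "\<And>l. l < D2 \<Longrightarrow> d' l \<in> range (\<lambda>s. [:[:s:]:]) \<and> w2 \<rho> (d' l) \<le> C2 * w2 \<rho> (c k)"
        "(\<Prod>y\<in>#B. zy y) dvd c k - (\<Sum>l<D2. d' l * e2 l)"
        using 2(2)[of "c k"] c(1)[OF k] by blast
      define d where "d = (\<lambda>l. SOME s. d' l = [:[:s:]:])"
      have d: "d' l = [:[:d l:]:]" if "l < D2" for l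
        unfolding d_def using d'(1)[OF that] by (auto intro: someI)
      have "cmod (d l) \<le> C2 * w2 \<rho> (c k)" if "l < D2" for l
        using d'(1)[OF that] d[OF that] by simp
      moreover have "(\<Sum>l<D2. d' l * e2 l) = (\<Sum>l<D2. [:[:d l:]:] * e2 l)"
        by (intro sum.cong refl) (simp add: d)
      hence "c k - (\<Sum>l<D2. [:[:d l:]:] * e2 l) \<in> N"
        using is_ideal_dvd[OF N B(2) d'(2)] by simp
      ultimately show ?thesis by blast
    qed
    define d where "d = (\<lambda>k. SOME d. (\<forall>l<D2. cmod (d l) \<le> C2 * w2 \<rho> (c k)) \<and> c k - (\<Sum>l<D2. [:[:d l:]:] * e2 l) \<in> N)"
    have d: "cmod (d k l) \<le> C2 * w2 \<rho> (c k)" if "k < D1" "l < D2" for k l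
      using someI_ex[OF ex[OF that(1)]] that(2) unfolding d_def by blast
    have d2: "c k - (\<Sum>l<D2. [:[:d k l:]:] * e2 l) \<in> N" if "k < D1" for k
      using someI_ex[OF ex[OF that]] unfolding d_def by blast
    have eqK: "f - (\<Sum>k\<in>?K. [:[:d (fst k) (snd k):]:] * e k) =
      (f - (\<Sum>k<D1. c k * e1 k)) + (\<Sum>k<D1. (c k - (\<Sum>l<D2. [:[:d k l:]:] * e2 l)) * e1 k)"
    proof -
      have "(\<Sum>k\<in>?K. [:[:d (fst k) (snd k):]:] * e k) = (\<Sum>k<D1. (\<Sum>l<D2. [:[:d k l:]:] * e2 l) * e1 k)"
        unfolding e_def by (simp add: sum.cartesian_product' sum_distrib_right mult.assoc)
      thus ?thesis by (simp add: left_diff_distrib sum_subtractf)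
    qed
    have memb: "f - (\<Sum>k\<in>?K. [:[:d (fst k) (snd k):]:] * e k) \<in> N"
      unfolding eqK using is_ideal_dvd[OF N A(2) c(2)] d2 by (intro I(2) is_ideal_sum[OF N] I(4)) auto
    have "cmod (d (fst k) (snd k)) \<le> C2 * C1 * w2 \<rho> f" if "k \<in> ?K" for k
    proof -
      have "cmod (d (fst k) (snd k)) \<le> C2 * w2 \<rho> (c (fst k))" using that by (intro d) auto
      also have "\<dots> \<le> C2 * (C1 * w2 \<rho> f)" using c(1)[of "fst k"] that 2(1) by (intro mult_left_mono) auto
      finally show ?thesis by simp
    qed
    with memb show ?thesis by (intro exI[of _ "\<lambda>k. d (fst k) (snd k)"] conjI ballI)
  qed
  thus ?thesis by (intro exI[of _ ?K] exI[of _ e] exI[of _ "C2 * C1"]) auto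
qed

text \<open>Complex subspaces. The induction in \<open>finite_span_closed\<close> adjoins a line to
  the set, which destroys the ideal property but not this one.\<close>

definition is_sub :: "complex poly poly set \<Rightarrow> bool" where
  "is_sub N \<longleftrightarrow> 0 \<in> N \<and> (\<forall>x\<in>N. \<forall>y\<in>N. x + y \<in> N) \<and> (\<forall>s. \<forall>x\<in>N. [:[:s:]:] * x \<in> N)"

lemma is_subD:
  assumes "is_sub N"
  shows "0 \<in> N" "x \<in> N \<Longrightarrow> y \<in> N \<Longrightarrow> x + y \<in> N" "x \<in> N \<Longrightarrow> [:[:s:]:] * x \<in> N"
    "x \<in> N \<Longrightarrow> y \<in> N \<Longrightarrow> x - y \<in> N"
proof -
  show "0 \<in> N" and add: "x \<in> N \<Longrightarrow> y \<in> N \<Longrightarrow> x + y \<in> N" and m: "x \<in> N \<Longrightarrow> [:[:s:]:] * x \<in> N" for x y s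
    using assms unfolding is_sub_def by blast+
  show "x \<in> N \<Longrightarrow> y \<in> N \<Longrightarrow> x - y \<in> N"
  proof -
    have "[:[:-1:]:] = (-1 :: complex poly poly)" by (simp add: one_pCons)
    hence "y \<in> N \<Longrightarrow> - y \<in> N" using m[of y "-1"] by (simp only: mult_minus1)
    thus "x \<in> N \<Longrightarrow> y \<in> N \<Longrightarrow> x - y \<in> N" using add[of x "- y"] by simp
  qed
qed

lemma const_mult_assoc: "[:[:s:]:] * ([:[:t:]:] * x) = [:[:s * t:]:] * (x :: complex poly poly)"
  by (simp add: mult.assoc[symmetric])

text \<open>Subspaces of finite codimension are closed, in algebraic form. Adjoining the line
  through \<open>e a\<close> to \<open>N\<close> reduces to fewer vectors and gives f = s e(a)
  modulo \<open>N\<close>. If s is not 0, solving for \<open>e a\<close> writes it with coefficients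
  that still tend to 0, so the induction hypothesis puts \<open>e a\<close> into
  \<open>N\<close>.\<close>

lemma finite_span_closed:
  assumes "finite K" "is_sub N" "\<And>t. f - (\<Sum>k\<in>K. [:[:c t k:]:] * e k) \<in> N"
    and "\<And>k. k \<in> K \<Longrightarrow> (\<lambda>t::nat. c t k) \<longlonglongrightarrow> 0"
  shows "f \<in> N"
  using assms
proof (induction K arbitrary: N f c rule: finite_induct)
  case (insert a K)
  note S = is_subD[OF insert.prems(1)]
  define N1 where "N1 = {x. \<exists>s. x - [:[:s:]:] * e a \<in> N}"
  have N1: "is_sub N1"
    unfolding is_sub_def
  proof (intro conjI ballI allI)
    show "0 \<in> N1" unfolding N1_def by (auto intro!: exI[of _ 0] S)
    show "x + y \<in> N1" if xy: "x \<in> N1" "y \<in> N1" for x y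
    proof -
      obtain s t where "x - [:[:s:]:] * e a \<in> N" "y - [:[:t:]:] * e a \<in> N" using xy unfolding N1_def by blast
      hence "(x - [:[:s:]:] * e a) + (y - [:[:t:]:] * e a) \<in> N" by (rule S)
      hence "(x + y) - [:[:s + t:]:] * e a \<in> N"
        by (simp add: algebra_simps smult_add_left[symmetric])
      thus ?thesis unfolding N1_def by blast
    qed
    show "[:[:s:]:] * x \<in> N1" if x: "x \<in> N1" for s x
    proof -
      obtain t where "x - [:[:t:]:] * e a \<in> N" using x unfolding N1_def by blast
      hence "[:[:s:]:] * (x - [:[:t:]:] * e a) \<in> N" by (rule S)
      hence "[:[:s:]:] * x - [:[:s * t:]:] * e a \<in> N"
        by (simp only: right_diff_distrib const_mult_assoc)
      thus ?thesis unfolding N1_def by blast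
    qed
  qed
  have step: "f - (\<Sum>k\<in>insert a K. [:[:c t k:]:] * e k) = f - (\<Sum>k\<in>K. [:[:c t k:]:] * e k) - [:[:c t a:]:] * e a" for t
    using insert(1,2) by simp
  have "f \<in> N1"
  proof (rule insert.IH[OF N1, of f c])
    show "f - (\<Sum>k\<in>K. [:[:c t k:]:] * e k) \<in> N1" for t
      using insert.prems(2)[of t] unfolding step N1_def by blast
  qed (use insert.prems in auto)
  then obtain s where s: "f - [:[:s:]:] * e a \<in> N" unfolding N1_def by blast
  show ?case
  proof (cases "s = 0 \<or> e a \<in> N")
    case True
    hence "[:[:s:]:] * e a \<in> N" using S(1,3) by auto
    from S(2)[OF s this] show ?thesis by simp
  next
    case False
    have "(\<lambda>t. s - c t a) \<longlonglongrightarrow> s - 0"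
      using insert.prems(3)[of a] by (intro tendsto_diff tendsto_const) simp
    hence lim: "(\<lambda>t. s - c t a) \<longlonglongrightarrow> s" by simp
    have "\<forall>\<^sub>F t in sequentially. s - c t a \<noteq> 0"
      using lim False by (intro tendsto_imp_eventually_ne) auto
    then obtain T where T: "\<And>t. t \<ge> T \<Longrightarrow> s - c t a \<noteq> 0" by (auto simp: eventually_sequentially)
    \<comment> \<open>The coefficients of \<open>e a\<close> after solving for it; the shift by
      \<open>T\<close> keeps the denominators away from 0.\<close>
    define d where "d = (\<lambda>t k. c (t + T) k / (s - c (t + T) a))"
    have "e a \<in> N"
    proof (rule insert.IH[OF insert.prems(1), of "e a" d])
      fix t
      let ?u = "s - c (t + T) a"
      have u: "?u \<noteq> 0" using T by simp
      have "(f - (\<Sum>k\<in>K. [:[:c (t + T) k:]:] * e k) - [:[:c (t + T) a:]:] * e a) - (f - [:[:s:]:] * e a) \<in> N"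
        using insert.prems(2)[of "t + T"] unfolding step by (rule S(4)) (rule s)
      also have "(f - (\<Sum>k\<in>K. [:[:c (t + T) k:]:] * e k) - [:[:c (t + T) a:]:] * e a) - (f - [:[:s:]:] * e a) =
         [:[:?u:]:] * e a - (\<Sum>k\<in>K. [:[:c (t + T) k:]:] * e k)"
        by (simp add: algebra_simps smult_diff_left[symmetric])
      finally have "[:[:1 / ?u:]:] * ([:[:?u:]:] * e a - (\<Sum>k\<in>K. [:[:c (t + T) k:]:] * e k)) \<in> N"
        by (rule S)
      also have "[:[:1 / ?u:]:] * ([:[:?u:]:] * e a - (\<Sum>k\<in>K. [:[:c (t + T) k:]:] * e k)) =
         e a - (\<Sum>k\<in>K. [:[:d t k:]:] * e k)"
      proof -
        have "[:[:1 / ?u * ?u:]:] = (1 :: complex poly poly)" using u by (simp add: one_pCons)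
        thus ?thesis
          unfolding right_diff_distrib[of "[:[:1 / ?u:]:]"] sum_distrib_left const_mult_assoc d_def by simp
      qed
      finally show "e a - (\<Sum>k\<in>K. [:[:d t k:]:] * e k) \<in> N" .
    next
      fix k assume "k \<in> K"
      hence "(\<lambda>t. c (t + T) k / (s - c (t + T) a)) \<longlonglongrightarrow> 0 / s"
        using insert.prems(3)[of k] lim False
        by (intro tendsto_divide LIMSEQ_ignore_initial_segment) auto
      thus "(\<lambda>t. d t k) \<longlonglongrightarrow> 0" by (simp add: d_def)
    qed
    with False show ?thesis by blast
  qed
qed simp

lemma ideal_is_sub: "is_ideal N \<Longrightarrow> is_sub N"
  unfolding is_ideal_def is_sub_def by blast

lemma ideal_closed:
  assumes N: "is_ideal N" and A: "\<And>x. x \<in># A \<Longrightarrow> cmod x < 1" "(\<Prod>x\<in>#A. zx x) \<in> N"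
    and B: "\<And>y. y \<in># B \<Longrightarrow> cmod y < 1" "(\<Prod>y\<in>#B. zy y) \<in> N"
    and F: "\<And>k. F k - f \<in> N" and b: "\<And>k i j. cmod (cf (F k) i j) \<le> b k" "b \<longlonglongrightarrow> 0"
  shows "f \<in> N"
proof -
  note I = is_idealD[OF N]
  \<comment> \<open>The radius exceeds the modulus of every root, for the bounded divisions, and is
    less than 1, for \<open>w2_le\<close>.\<close>
  obtain \<rho> where \<rho>: "0 \<le> \<rho>" "\<rho> < 1" "\<And>x. x \<in># A \<Longrightarrow> cmod x < \<rho>" "\<And>y. y \<in># B \<Longrightarrow> cmod y < \<rho>"
  proof -
    define R where "R = Max (insert 0 (cmod ` (set_mset A \<union> set_mset B)))"
    have fin: "finite (insert 0 (cmod ` (set_mset A \<union> set_mset B)))" by simp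
    have "R < 1" unfolding R_def using A(1) B(1) fin by (subst Max_less_iff) auto
    moreover have "cmod x \<le> R" if "x \<in># A \<or> x \<in># B" for x
      unfolding R_def using that by (intro Max_ge fin) auto
    moreover have "0 \<le> R" unfolding R_def by (intro Max_ge fin) auto
    ultimately show ?thesis
      by (intro that[of "(R + 1) / 2"]) (fastforce simp: field_simps)+
  qed
  obtain K e C where K: "finite (K :: (nat \<times> nat) set)" "\<And>f. \<exists>c. (\<forall>k\<in>K. cmod (c k) \<le> C * w2 \<rho> f) \<and>
     f - (\<Sum>k\<in>K. [:[:c k:]:] * e k) \<in> N"
    using reduce_mod_ideal[OF N \<rho>(3) A(2) \<rho>(4) B(2) \<rho>(1)] by blast
  define c where "c = (\<lambda>t. SOME c. (\<forall>k\<in>K. cmod (c k) \<le> C * w2 \<rho> (F t)) \<and>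
     F t - (\<Sum>k\<in>K. [:[:c k:]:] * e k) \<in> N)"
  have c: "cmod (c t k) \<le> C * w2 \<rho> (F t)" if "k \<in> K" for t k
    using someI_ex[OF K(2)[of "F t"]] that unfolding c_def by blast
  have c2: "F t - (\<Sum>k\<in>K. [:[:c t k:]:] * e k) \<in> N" for t
    using someI_ex[OF K(2)[of "F t"]] unfolding c_def by blast
  have "(\<lambda>t. b t / (1 - \<rho>) / (1 - \<rho>)) \<longlonglongrightarrow> 0 / (1 - \<rho>) / (1 - \<rho>)"
    using b(2) \<rho>(2) by (intro tendsto_divide tendsto_const) auto
  hence lim: "(\<lambda>t. b t / (1 - \<rho>) / (1 - \<rho>)) \<longlonglongrightarrow> 0" by simp
  have "(\<lambda>t. w2 \<rho> (F t)) \<longlonglongrightarrow> 0"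
    by (rule real_tendsto_sandwich[OF _ _ tendsto_const lim])
       (rule always_eventually, use w2_nonneg[OF \<rho>(1)] w2_le[OF b(1) \<rho>(1,2)] in blast)+
  hence lim': "(\<lambda>t. C * w2 \<rho> (F t)) \<longlonglongrightarrow> 0" by (rule tendsto_mult_right_zero)
  show ?thesis
  proof (rule finite_span_closed[OF K(1) ideal_is_sub[OF N]])
    fix t
    have "F t - (\<Sum>k\<in>K. [:[:c t k:]:] * e k) - (F t - f) \<in> N" by (rule I(6)[OF c2 F])
    thus "f - (\<Sum>k\<in>K. [:[:c t k:]:] * e k) \<in> N" by simp
  next
    fix k assume "k \<in> K"
    thus "(\<lambda>t. c t k) \<longlonglongrightarrow> 0"
      by (intro Lim_null_comparison[OF _ lim']) (auto intro!: always_eventually c)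
  qed
qed

section \<open>Decomposition of the polynomial ring\<close>

lemma tf_prod_mset: "tf (prod_mset M) x = prod_mset (image_mset (\<lambda>f. tf f x) M)"
  by (simp add: tf_def)

lemma prod_mset_ge:
  assumes "\<And>y. y \<in># M \<Longrightarrow> 0 \<le> a y \<and> a y \<le> cmod (b y)"
  shows "prod_mset (image_mset a M) \<le> cmod (prod_mset (image_mset b M))" "0 \<le> prod_mset (image_mset a M)"
  using assms by (induction M) (auto simp: norm_mult intro!: mult_mono)

lemma prod_mset_pos:
  "(\<And>y. y \<in># M \<Longrightarrow> (0::real) < a y) \<Longrightarrow> 0 < prod_mset (image_mset a M)"
  by (induction M) auto

lemma prod_mset_partition:
  "(\<Prod>x\<in>#{#x \<in># A. P x#}. c x) * (\<Prod>x\<in>#{#x \<in># A. \<not> P x#}. c x) = (\<Prod>x\<in>#A. c x :: 'a::comm_monoid_mult)"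
  by (induction A) (auto simp: mult_ac)

context disc_nz
begin

text \<open>In u v = a q + b qt the right side is at most a multiple of |p| on the torus, while |u|
  is at least the product of the distances 1 - |x| of its roots from the circle. So |v| is at most a
  multiple of |p|.\<close>

lemma outer_factor_inL2:
  assumes c: "c = zx \<or> c = zy" and A: "(\<Prod>x\<in>#A. c x) \<in> ideal2 q qt"
  shows "inL2 p (tf (\<Prod>x\<in>#{#x \<in># A. \<not> cmod x < 1#}. c x))"
proof -
  let ?u = "\<Prod>x\<in>#{#x \<in># A. cmod x < 1#}. c x" and ?v = "\<Prod>x\<in>#{#x \<in># A. \<not> cmod x < 1#}. c x"
  have uv: "?u * ?v = (\<Prod>x\<in>#A. c x)"
    by (rule prod_mset_partition)
  obtain a b where ab: "(\<Prod>x\<in>#A. c x) = a * q + b * qt" using A unfolding ideal2_def by blast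
  obtain Ca where Ca: "Ca > 0" "\<forall>x\<in>tbox. cmod (tf a x) \<le> Ca" using bounded_on_tbox[OF continuous_on_tf] by blast
  obtain Cb where Cb: "Cb > 0" "\<forall>x\<in>tbox. cmod (tf b x) \<le> Cb" using bounded_on_tbox[OF continuous_on_tf] by blast
  define \<delta> where "\<delta> = (\<Prod>x\<in>#{#x \<in># A. cmod x < 1#}. 1 - cmod x)"
  have \<delta>: "\<delta> > 0" unfolding \<delta>_def by (rule prod_mset_pos) auto
  have u: "\<delta> \<le> cmod (tf ?u x)" for x
    unfolding tf_prod_mset \<delta>_def image_mset.compositionality o_def
  proof (rule prod_mset_ge(1))
    fix y assume y: "y \<in># {#x \<in># A. cmod x < 1#}"
    have "\<exists>i j. tf (c y) x = ee i j x - y" using c tf_zx tf_zy by blast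
    then obtain i j where "tf (c y) x = ee i j x - y" by blast
    thus "0 \<le> 1 - cmod y \<and> 1 - cmod y \<le> cmod (tf (c y) x)"
      using y norm_triangle_ineq2[of "ee i j x" y] by simp
  qed
  show ?thesis
  proof (rule inL2_bound[OF inL2_tor, of _ "(Ca + Cb) / \<delta>"])
    fix x assume x: "x \<in> tbox"
    have "\<delta> * cmod (tf ?v x) \<le> cmod (tf ?u x) * cmod (tf ?v x)"
      using u by (rule mult_right_mono) simp
    also have "\<dots> = cmod (tf (?u * ?v) x)" by (simp add: norm_mult)
    also have "\<dots> = cmod (tf a x * tf q x + tf b x * tf qt x)" unfolding uv ab by simp
    also have "\<dots> \<le> cmod (tf a x) * cmod (tor p x) + cmod (tf b x) * cmod (tor p x)"
      by (rule order_trans[OF norm_triangle_ineq]) (simp add: norm_mult cmod_tf_q cmod_tf_qt)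
    also have "\<dots> \<le> Ca * cmod (tor p x) + Cb * cmod (tor p x)"
      using Ca(2) Cb(2) x by (intro add_mono mult_right_mono) auto
    finally show "cmod (tf ?v x) \<le> (Ca + Cb) / \<delta> * cmod (tor p x)"
      using \<delta> by (simp add: field_simps)
  qed (use Ca(1) Cb(1) \<delta> in auto)
qed

lemma ipw_cancel_product:
  assumes c: "c = zx \<or> c = zy" and f: "inL2 p (tf f)" and g: "inL2 p (tf g)"
    and M: "\<And>x. x \<in># M \<Longrightarrow> cmod x \<ge> 1"
    and zero: "\<And>h. ipw p (tf (h * ((\<Prod>x\<in>#M. c x) * f))) (tf g) = 0"
  shows "ipw p (tf (h * f)) (tf g) = 0"
  using M zero
proof (induction M arbitrary: h)
  case (add x M)
  let ?f = "(\<Prod>x\<in>#M. c x) * f"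
  have z: "ipw p (tf (h * ?f)) (tf g) = 0" for h
  proof (rule ipw_cancel_factor[OF inL2_mult_poly[OF f] g, of x "c x" "if c = zx then (1, 0) else (0, -1)"])
    show "cmod x \<ge> 1" using add.prems(1) by simp
    show "c x = zx x \<and> (if c = zx then (1, 0) else (0, - 1)) = (1, 0) \<or>
          c x = zy x \<and> (if c = zx then (1, 0) else (0, - 1)) = (0, - 1)"
      using c by auto
    show "ipw p (tf (h * (c x * ?f))) (tf g) = 0" for h
      using add.prems(2)[of h] by (simp add: mult.assoc del: tf_simps)
  qed
  show ?case by (rule add.IH[OF _ z]) (rule add.prems(1), simp)
qed simp

theorem decomposition:
  assumes cop: "coprime q qt"
  shows "\<exists>N v A B. is_ideal N \<and> q \<in> N \<and> qt \<in> N \<and> (\<forall>f\<in>N. v * f \<in> ideal2 q qt) \<and>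
    (\<forall>z1 z2. cmod z1 < 1 \<longrightarrow> cmod z2 < 1 \<longrightarrow> eval2 v z1 z2 \<noteq> 0) \<and>
    (\<forall>x\<in>#A. cmod x < 1) \<and> (\<Prod>x\<in>#A. zx x) \<in> N \<and>
    (\<forall>y\<in>#B. cmod y < 1) \<and> (\<Prod>y\<in>#B. zy y) \<in> N \<and>
    (\<forall>f. \<exists>g\<in>pbox n m. inL2 p (tf g) \<and> f - g \<in> N) \<and>
    (\<forall>f g. f \<in> N \<longrightarrow> inL2 p (tf f) \<longrightarrow> g \<in> pbox n m \<longrightarrow> inL2 p (tf g) \<longrightarrow> ipw p (tf f) (tf g) = 0)"
proof -
  obtain r where r: "r \<noteq> 0" "[:r:] \<in> ideal2 q qt" using eliminate_z2[OF cop] by blast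
  let ?A = "proots r"
  have A: "(\<Prod>x\<in>#?A. zx x) \<in> ideal2 q qt" by (rule proots_in_ideal[OF ideal2_is_ideal r])
  obtain B where B: "(\<Prod>y\<in>#B. zy y) \<in> ideal2 q qt" using eliminate_z1[OF cop A] by blast
  define A1 A2 B1 B2 where "A1 = {#x \<in># ?A. cmod x < 1#}" and "A2 = {#x \<in># ?A. \<not> cmod x < 1#}"
    and "B1 = {#x \<in># B. cmod x < 1#}" and "B2 = {#x \<in># B. \<not> cmod x < 1#}"
  define u1 v1 u2 v2 where "u1 = (\<Prod>x\<in>#A1. zx x)" and "v1 = (\<Prod>x\<in>#A2. zx x)"
    and "u2 = (\<Prod>x\<in>#B1. zy x)" and "v2 = (\<Prod>x\<in>#B2. zy x)"
  have uv1: "u1 * v1 = (\<Prod>x\<in>#?A. zx x)" unfolding u1_def v1_def A1_def A2_def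
    by (rule prod_mset_partition)
  have uv2: "u2 * v2 = (\<Prod>x\<in>#B. zy x)" unfolding u2_def v2_def B1_def B2_def
    by (rule prod_mset_partition)
  note I = is_idealD[OF ideal2_is_ideal[of q qt]]
  define v where "v = v1 * v2"
  define N where "N = {f. v * f \<in> ideal2 q qt}"
  have N: "is_ideal N" unfolding N_def by (rule is_ideal_colon[OF ideal2_is_ideal])
  note IN = is_idealD[OF N]
  have qN: "q \<in> N" "qt \<in> N" unfolding N_def using ideal2_gens by (auto intro!: I(3))
  have u1N: "u1 \<in> N"
  proof -
    have "v * u1 = v2 * (u1 * v1)" by (simp add: v_def mult_ac)
    thus ?thesis unfolding N_def using I(3)[OF A, of v2] uv1 by simp
  qed
  have u2N: "u2 \<in> N"
  proof -
    have "v * u2 = v1 * (u2 * v2)" by (simp add: v_def mult_ac)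
    thus ?thesis unfolding N_def using I(3)[OF B, of v1] uv2 by simp
  qed
  have "eval2 v z1 z2 \<noteq> 0" if "cmod z1 < 1" "cmod z2 < 1" for z1 z2
    using that unfolding v_def v1_def v2_def A2_def B2_def
    by (auto simp: prod_mset_zero_iff)
  hence vnz: "\<forall>z1 z2. cmod z1 < 1 \<longrightarrow> cmod z2 < 1 \<longrightarrow> eval2 v z1 z2 \<noteq> 0" by blast
  have v1L: "inL2 p (tf v1)" unfolding v1_def A2_def by (rule outer_factor_inL2[OF _ A]) simp
  have orth: "ipw p (tf f) (tf g) = 0" if f: "f \<in> N" "inL2 p (tf f)" and g: "g \<in> pbox n m" "inL2 p (tf g)" for f g
  proof -
    have 0: "ipw p (tf (h * (v1 * (v2 * f)))) (tf g) = 0" for h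
    proof -
      have "h * (v1 * (v2 * f)) \<in> ideal2 q qt"
        using f(1) unfolding N_def v_def by (auto intro: I(3) simp: mult.assoc)
      from ipw_ideal_zero[OF g this] show ?thesis
        using ipw_commute[of p "tf g" "tf (h * (v1 * (v2 * f)))"] by simp
    qed
    have 1: "ipw p (tf (h * (v2 * f))) (tf g) = 0" for h
      by (rule ipw_cancel_product[of zx _ _ A2]) (use f(2) g(2) 0 in \<open>auto simp: A2_def v1_def[unfolded A2_def] inL2_mult_poly simp del: tf_simps\<close>)
    have "ipw p (tf (1 * f)) (tf g) = 0"
      by (rule ipw_cancel_product[of zy _ _ B2]) (use f(2) g(2) 1 in \<open>auto simp: B2_def v2_def[unfolded B2_def] simp del: tf_simps\<close>)
    thus ?thesis by simp
  qed
  have cx: "comax u1 v1"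
    unfolding u1_def v1_def
    by (intro comax_prod_mset comax_sym[OF comax_prod_mset] comax_zx) (auto simp: A1_def A2_def)
  have cy: "comax u2 v2"
    unfolding u2_def v2_def
    by (intro comax_prod_mset comax_sym[OF comax_prod_mset] comax_zy) (auto simp: B1_def B2_def)
  obtain s1 t1 where st1: "s1 * u1 + t1 * v1 = 1" using cx unfolding comax_def by blast
  obtain s2 t2 where st2: "s2 * u2 + t2 * v2 = 1" using cy unfolding comax_def by blast
  \<comment> \<open>The factor \<open>v1\<close> makes \<open>e\<close> square integrable. Modulo
    \<open>N\<close> both t1 v1 and t2 v2 are 1, since \<open>u1\<close> and \<open>u2\<close> lie
    in \<open>N\<close>; hence e = 1 modulo \<open>N\<close>.\<close>
  define e where "e = (t1 * t2 * v2) * v1"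
  have e1: "1 - e \<in> N"
  proof -
    have "1 - e = (s1 * u1 + t1 * v1) - t1 * v1 * (t2 * v2)" by (simp add: st1 e_def mult_ac)
    also have "\<dots> = s1 * u1 + t1 * v1 * (1 - t2 * v2)" by (simp add: algebra_simps)
    also have "1 - t2 * v2 = s2 * u2" using st2 by (metis add_diff_cancel_right')
    finally show ?thesis
      using IN(2)[OF IN(3)[OF u1N, of s1] IN(3)[OF IN(3)[OF u2N, of s2], of "t1 * v1"]] by simp
  qed
  have eL: "inL2 p (tf e)" unfolding e_def by (rule inL2_mult_poly[OF v1L])
  \<comment> \<open>Minimization needs finite norms, hence the square integrable part of
    \<open>N\<close>; closedness is applied to \<open>N\<close> itself.\<close>
  define N' where "N' = {f \<in> N. inL2 p (tf f)}"
  have N': "is_ideal N'"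
    unfolding is_ideal_def
  proof (intro conjI ballI allI)
    show "0 \<in> N'" unfolding N'_def using IN(1) inL2_zero[of p] by (simp add: tf_simps[abs_def])
    show "x + y \<in> N'" if "x \<in> N'" "y \<in> N'" for x y
      using that IN(2)[of x y] inL2_add[of p "tf x" "tf y"] by (simp add: N'_def tf_simps[abs_def])
    show "a * x \<in> N'" if "x \<in> N'" for a x
      using that IN(3)[of x a] inL2_mult_poly[of x a] by (simp add: N'_def)
  qed
  have q': "q \<in> N'" "qt \<in> N'"
    using qN inL2_mult_q[of 1] inL2_mult_qt[of 1] by (simp_all add: N'_def)
  have surj: "\<exists>g\<in>pbox n m. inL2 p (tf g) \<and> f - g \<in> N" for f
  proof -
    have ef: "inL2 p (tf (f * e))" by (rule inL2_mult_poly[OF eL])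
    obtain g F where g: "g \<in> pbox n m" "inL2 p (tf g)" and F: "\<And>k. F k - (f * e - g) \<in> N'"
      "\<And>k. inL2 p (tf (F k))" "(\<lambda>k. nsq p (tf (F k))) \<longlonglongrightarrow> 0"
      using approximate_projection[OF N' _ ef q'] unfolding N'_def by blast
    \<comment> \<open>The class of f e - g modulo \<open>N\<close> contains polynomials whose
      coefficients tend to 0 uniformly.\<close>
    have "f * e - g \<in> N"
    proof (rule ideal_closed[OF N, of A1 B1])
      show "F k - (f * e - g) \<in> N" for k using F(1)[of k] by (simp add: N'_def)
      show "cmod (cf (F k) i j) \<le> sqrt (nsq p (tf (F k)) * Ccf)" for k i j
        using cf_bound[OF F(2)] by (rule real_le_rsqrt)
      have "(\<lambda>k. sqrt (nsq p (tf (F k)) * Ccf)) \<longlonglongrightarrow> sqrt (0 * Ccf)"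
        by (intro tendsto_real_sqrt tendsto_mult tendsto_const F(3))
      thus "(\<lambda>k. sqrt (nsq p (tf (F k)) * Ccf)) \<longlonglongrightarrow> 0" by simp
    qed (use u1N u2N in \<open>auto simp: u1_def u2_def A1_def B1_def\<close>)
    moreover have "f * (1 - e) \<in> N" using e1 by (rule IN(3))
    ultimately have "f * (1 - e) + (f * e - g) \<in> N" by (intro IN(2))
    hence "f - g \<in> N" by (simp add: algebra_simps)
    thus ?thesis using g by blast
  qed
  have "\<forall>f\<in>N. v * f \<in> ideal2 q qt" "\<forall>x\<in>#A1. cmod x < 1" "\<forall>x\<in>#B1. cmod x < 1"
    by (simp_all add: N_def A1_def B1_def)
  thus ?thesis
    using N qN vnz u1N u2N surj orth unfolding u1_def u2_def
    by (intro exI[of _ N] exI[of _ v] exI[of _ A1] exI[of _ B1]) auto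
qed

end

section \<open>Coprimality of \<open>q\<close> and its companion\<close>

lemma flip2_eq_reflect_poly:
  assumes "f \<in> pbox (Suc n) (Suc m)" "degree f = m"
  shows "flip2 f n m = reflect_poly f"
proof (rule cf_eqI)
  fix i j
  have "cf f i j = 0" if "n < i" for i j 
    using assms(1) that unfolding pbox_def mem_Collect_eq by (metis not_less_eq)
  thus "cf (flip2 f n m) i j = cf (reflect_poly f) i j"
    using assms(2) by (auto simp: flip2_def) (auto simp: cf_def coeff_reflect_poly)
qed

lemma degree_eqI_pbox:
  assumes "f \<in> pbox (Suc n) (Suc m)" "cf f i m \<noteq> 0"
  shows "degree f = m"
proof (rule antisym)
  show "m \<le> degree f" using assms(2) by (intro le_degree) (auto simp: cf_def)
  show "degree f \<le> m"
    using assms(1) by (intro degree_le allI impI poly_eqI) (fastforce simp: pbox_def cf_def)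
qed

text \<open>Reflection is multiplicative and, on polynomials with nonzero constant coefficient, an
  involution. A common divisor of the reflections therefore reflects to one of \<open>f\<close> and
  \<open>g\<close>.\<close>

lemma coprime_reflect_poly:
  fixes f g :: "complex poly poly"
  assumes "coprime f g" "coeff f 0 \<noteq> 0" "coeff g 0 \<noteq> 0"
  shows "coprime (reflect_poly f) (reflect_poly g)"
proof (rule coprimeI)
  fix c assume c: "c dvd reflect_poly f" "c dvd reflect_poly g"
  then obtain d where d: "reflect_poly f = c * d" by (elim dvdE)
  have f0: "f \<noteq> 0" using assms(2) by auto
  have c0: "coeff c 0 \<noteq> 0"
  proof
    assume "coeff c 0 = 0"
    hence "coeff (reflect_poly f) 0 = 0" by (simp add: d coeff_mult_0)
    thus False using f0 by simp
  qed
  have "reflect_poly c dvd f" "reflect_poly c dvd g"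
    using c assms(2,3) by (metis dvd_def reflect_poly_mult reflect_poly_reflect_poly)+
  hence "is_unit (reflect_poly c)" using assms(1) by (metis coprime_common_divisor)
  then obtain a where a: "reflect_poly c = [:a:]" "is_unit a"
    by (auto simp: is_unit_poly_iff)
  hence "c = [:a:]" using c0 by (metis reflect_poly_reflect_poly reflect_poly_const)
  thus "is_unit c" using a(2) by (simp add: is_unit_const_poly_iff)
qed

text \<open>Both polynomials need z2-degree exactly \<open>m\<close> and a nonzero constant
  coefficient in z2. For \<open>p\<close> these come from the bidegree and from p(0,0) being
  nonzero; reflection exchanges the two reasons.\<close>

lemma coprime_flips:
  assumes bi: "has_bidegree p n m" and p0: "eval2 p 0 0 \<noteq> 0" and cop: "coprime p (refl2 p n m)"
  shows "coprime (flip2 p n m) (flip2 (refl2 p n m) n m)"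
proof -
  have box: "p \<in> pbox (Suc n) (Suc m)" using bi by (rule has_bidegree_box)
  obtain i where i: "cf p i m \<noteq> 0" using bi unfolding has_bidegree_def by blast
  hence "i \<le> n" using bi unfolding has_bidegree_def by blast
  have d1: "degree p = m" by (rule degree_eqI_pbox[OF box i])
  have cf0: "cf p 0 0 \<noteq> 0" using p0 by (simp add: eval2_altdef poly_0_coeff_0 cf_def)
  hence "cf (refl2 p n m) n m \<noteq> 0" by (simp add: refl2_def)
  hence d2: "degree (refl2 p n m) = m" by (rule degree_eqI_pbox[OF refl2_in_box])
  have "cf (refl2 p n m) (n - i) 0 \<noteq> 0" using i \<open>i \<le> n\<close> by (simp add: refl2_def)
  hence c2: "coeff (refl2 p n m) 0 \<noteq> 0" by (auto simp: cf_def)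
  have c1: "coeff p 0 \<noteq> 0" using cf0 by (auto simp: cf_def)
  show ?thesis
    unfolding flip2_eq_reflect_poly[OF box d1] flip2_eq_reflect_poly[OF refl2_in_box d2]
    by (rule coprime_reflect_poly[OF cop c1 c2])
qed

section \<open>Local multiplicities\<close>

context vector_space
begin

lemma dim_direct_sum:
  assumes fin: "finite \<Lambda>" and sub: "\<And>l. l \<in> \<Lambda> \<Longrightarrow> subspace (W l)" and S: "finite S" "\<And>l. l \<in> \<Lambda> \<Longrightarrow> W l \<subseteq> span S"
    and gen: "\<And>x. x \<in> V \<Longrightarrow> \<exists>w. (\<forall>l\<in>\<Lambda>. w l \<in> W l) \<and> x = (\<Sum>l\<in>\<Lambda>. w l)"
    and inc: "\<And>l. l \<in> \<Lambda> \<Longrightarrow> W l \<subseteq> V"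
    and ind: "\<And>w. (\<forall>l\<in>\<Lambda>. w l \<in> W l) \<Longrightarrow> (\<Sum>l\<in>\<Lambda>. w l) = 0 \<Longrightarrow> \<forall>l\<in>\<Lambda>. w l = 0"
  shows "dim V = (\<Sum>l\<in>\<Lambda>. dim (W l))"
proof -
  define B where "B = (\<lambda>l. SOME B. B \<subseteq> W l \<and> independent B \<and> W l \<subseteq> span B \<and> card B = dim (W l))"
  have B: "B l \<subseteq> W l \<and> independent (B l) \<and> W l \<subseteq> span (B l) \<and> card (B l) = dim (W l)" for l
  proof -
    obtain b where "b \<subseteq> W l" "independent b" "W l \<subseteq> span b" "card b = dim (W l)"
      using basis_exists[of "W l"] by blast
    thus ?thesis unfolding B_def by (intro someI[of "\<lambda>B. B \<subseteq> W l \<and> independent B \<and> W l \<subseteq> span B \<and> card B = dim (W l)" b]) simp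
  qed
  have finB: "finite (B l)" if "l \<in> \<Lambda>" for l
    using independent_span_bound[OF S(1)] B[of l] S(2)[OF that] by blast
  have disj: "B l \<inter> B k = {}" if lk: "l \<in> \<Lambda>" "k \<in> \<Lambda>" "l \<noteq> k" for l k
  proof (rule equals0I)
    fix x assume x: "x \<in> B l \<inter> B k"
    \<comment> \<open>A common element x would give the relation x - x = 0 between two different
      summands.\<close>
    define w where "w = (\<lambda>j. (if j = l then x else 0) - (if j = k then x else 0))"
    have "w j \<in> W j" if "j \<in> \<Lambda>" for j
      unfolding w_def using sub[OF that] x B[of l] B[of k]
      by (intro subspace_diff) (auto intro: subspace_0)
    moreover have "(\<Sum>j\<in>\<Lambda>. w j) = 0"
      unfolding w_def using fin lk by (simp add: sum_subtractf)
    ultimately have "w l = 0" using ind lk by blast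
    hence "x = 0" using lk by (simp add: w_def)
    thus False using x B[of l] dependent_zero by blast
  qed
  have finU: "finite (\<Union>l\<in>\<Lambda>. B l)" using fin finB by blast
  have indep: "independent (\<Union>l\<in>\<Lambda>. B l)"
  proof
    assume "dependent (\<Union>l\<in>\<Lambda>. B l)"
    then obtain u where u: "\<exists>v\<in>(\<Union>l\<in>\<Lambda>. B l). u v \<noteq> 0" "(\<Sum>v\<in>(\<Union>l\<in>\<Lambda>. B l). scale (u v) v) = 0"
      unfolding dependent_finite[OF finU] by blast
    define w where "w = (\<lambda>l. \<Sum>v\<in>B l. scale (u v) v)"
    have "(\<Sum>l\<in>\<Lambda>. w l) = 0"
      unfolding w_def u(2)[symmetric] using fin finB disj by (intro sum.UNION_disjoint[symmetric]) auto
    moreover have "\<forall>l\<in>\<Lambda>. w l \<in> W l"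
      unfolding w_def using B by (intro ballI subspace_sum[OF sub] subspace_scale[OF sub]) auto
    ultimately have w0: "\<forall>l\<in>\<Lambda>. w l = 0" by (intro ind) auto
    obtain l x where lx: "l \<in> \<Lambda>" "x \<in> B l" "u x \<noteq> 0" using u(1) by blast
    have "dependent (B l)"
      unfolding dependent_finite[OF finB[OF lx(1)]] using w0 lx unfolding w_def by blast
    thus False using B by blast
  qed
  have "V \<subseteq> span (\<Union>l\<in>\<Lambda>. B l)"
  proof
    fix x assume "x \<in> V"
    then obtain w where w: "\<forall>l\<in>\<Lambda>. w l \<in> W l" "x = (\<Sum>l\<in>\<Lambda>. w l)" using gen by blast
    have "w l \<in> span (\<Union>l\<in>\<Lambda>. B l)" if "l \<in> \<Lambda>" for l
    proof -
      have "w l \<in> span (B l)" using w(1) B[of l] that by blast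
      thus ?thesis using span_mono[of "B l" "\<Union>l\<in>\<Lambda>. B l"] that by blast
    qed
    thus "x \<in> span (\<Union>l\<in>\<Lambda>. B l)" unfolding w(2) by (rule span_sum)
  qed
  moreover have "(\<Union>l\<in>\<Lambda>. B l) \<subseteq> V" using B inc by blast
  ultimately have "dim V = card (\<Union>l\<in>\<Lambda>. B l)" using indep by (intro dim_unique) auto
  also have "\<dots> = (\<Sum>l\<in>\<Lambda>. card (B l))"
    using fin finB disj by (intro card_UN_disjoint) auto
  finally show ?thesis using B by simp
qed

end

interpretation cs: vector_space cscale
  by unfold_locales (simp_all add: cscale_def smult_add_right smult_add_left[symmetric] one_pCons[symmetric] mult.commute)

lemma cdim_eq: "cdim S = cs.dim S"
  by (simp add: cdim_def)

lemma pbox_span: "\<exists>S. finite S \<and> pbox n m \<subseteq> cs.span S"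
proof (intro exI conjI subsetI)
  let ?S = "(\<lambda>k. monom (monom 1 (fst k)) (snd k)) ` ({..<n} \<times> {..<m})"
  show "finite ?S" by simp
  fix f assume f: "f \<in> pbox n m"
  have "f = (\<Sum>i<n. \<Sum>j<m. cscale (cf f i j) (monom (monom 1 i) j))"
    by (subst pbox_eq_mkb[OF f]) (simp add: mkb_def cscale_def smult_monom)
  also have "\<dots> \<in> cs.span ?S"
    by (intro cs.span_sum cs.span_scale cs.span_base) (auto intro!: image_eqI[of _ _ "(_, _)"])
  finally show "f \<in> cs.span ?S" .
qed

lemma vanish_ideal:
  assumes "eval2 f a b = 0"
  shows "\<exists>s t. f = s * zx a + t * zy b"
proof -
  have "poly (f - [:poly f [:b:]:]) [:b:] = 0" by simp
  hence "zy b dvd f - [:poly f [:b:]:]"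
    unfolding zy_def poly_eq_0_iff_dvd by simp
  then obtain t where t: "f - [:poly f [:b:]:] = zy b * t" by (elim dvdE)
  have "poly (poly f [:b:]) a = 0" using assms by (simp add: eval2_altdef)
  hence "[:- a, 1:] dvd poly f [:b:]" by (simp add: poly_eq_0_iff_dvd)
  then obtain s where "poly f [:b:] = [:- a, 1:] * s" by (elim dvdE)
  hence "[:poly f [:b:]:] = [:s:] * zx a" by (simp add: zx_def)
  hence "f = [:s:] * zx a + t * zy b" using t by (simp add: algebra_simps)
  thus ?thesis by blast
qed

text \<open>Modulo \<open>K\<close>: 1 = a x = (a x)^k = a^k x^k = 0.\<close>

lemma one_in_ideal_of_power:
  fixes x :: "'a::comm_ring_1"
  assumes K: "is_ideal K" and x: "x ^ k \<in> K" "1 - a * x \<in> K"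
  shows "1 \<in> K"
proof -
  note I = is_idealD[OF K]
  have "1 - (a * x) ^ j \<in> K" for j
  proof (induction j)
    case (Suc j)
    have "1 - y ^ Suc j = (1 - y) + y * (1 - y ^ j)" for y :: 'a by (simp add: algebra_simps)
    thus ?case using I(2)[OF x(2) I(3)[OF Suc, of "a * x"]] by metis
  qed (simp add: I)
  from I(2)[OF this[of k] I(3)[OF x(1), of "a ^ k"]] show ?thesis
    by (simp add: power_mult_distrib)
qed

text \<open>Modulo \<open>K\<close> the two linear factors at the point are nilpotent, so
  \<open>c\<close> differs from a nonzero constant by a nilpotent element and is a unit; but it is
  also 0. The two nilpotents are removed one after the other, by way of K + (zy b).\<close>

lemma one_in_ideal_at:
  assumes K: "is_ideal K" and x: "zx a ^ k \<in> K" and y: "zy b ^ k \<in> K" and c: "c \<in> K" "eval2 c a b \<noteq> 0"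
  shows "1 \<in> K"
proof -
  note I = is_idealD[OF K]
  define d where "d = eval2 c a b"
  have "eval2 (c - [:[:d:]:]) a b = 0" by (simp add: d_def)
  then obtain s t where st: "c - [:[:d:]:] = s * zx a + t * zy b" using vanish_ideal by blast
  let ?i = "[:[:inverse d:]:]"
  have di: "?i * [:[:d:]:] = 1" using c(2) by (simp add: d_def one_pCons)
  define K' where "K' = {h. \<exists>e. h - e * zy b \<in> K}"
  have K': "is_ideal K'" unfolding K'_def by (rule is_ideal_add_principal[OF K])
  have sub: "h \<in> K'" if "h \<in> K" for h
    unfolding K'_def using that by (auto intro!: exI[of _ 0])
  have "1 - (- ?i * s) * zx a \<in> K'"
  proof -
    have "?i * c \<in> K" using c(1) by (rule I)
    moreover have "c = [:[:d:]:] + (s * zx a + t * zy b)" using st by (simp add: algebra_simps)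
    hence "?i * c = ?i * [:[:d:]:] + ?i * (s * zx a + t * zy b)" by (simp only: distrib_left)
    ultimately have "1 + ?i * (s * zx a + t * zy b) \<in> K" using di by simp
    moreover have "1 + j * (s * zx a + t * zy b) = 1 - (- j * s) * zx a - (- j * t) * zy b" for j :: "complex poly poly"
      by (simp add: algebra_simps)
    ultimately have "1 - (- ?i * s) * zx a - (- ?i * t) * zy b \<in> K" by metis
    thus ?thesis unfolding K'_def by blast
  qed
  hence "1 \<in> K'" by (rule one_in_ideal_of_power[OF K' sub[OF x]])
  then obtain e where "1 - e * zy b \<in> K" unfolding K'_def by blast
  thus ?thesis by (rule one_in_ideal_of_power[OF K y])
qed

section \<open>The local ring at a point and the intersection multiplicity\<close>

lemma Fract_diff_one:
  "b \<noteq> 0 \<Longrightarrow> Fract a b - Fract g 1 = Fract (a - b * g) (b :: complex poly poly)"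
  by (simp add: mult.commute)

lemma Iloc_I:
  assumes "x * c = a * f + b * g" "eval2 c (fst l) (snd l) \<noteq> 0" "eval2 d (fst l) (snd l) \<noteq> 0"
  shows "Fract x d \<in> Iloc l f g"
proof -
  have c0: "c \<noteq> 0" and d0: "d \<noteq> 0" using assms by auto
  have "Fract x d = Fract (x * c) (d * c)" using c0 d0 by (simp add: eq_fract)
  also have "\<dots> = Fract a (d * c) * Fract f 1 + Fract b (d * c) * Fract g 1"
    using c0 d0 unfolding assms(1) by (simp add: eq_fract algebra_simps)
  finally have "Fract x d = Fract a (d * c) * Fract f 1 + Fract b (d * c) * Fract g 1" .
  moreover have "eval2 (d * c) (fst l) (snd l) \<noteq> 0" using assms(2,3) by simp
  hence "Fract a (d * c) \<in> Oloc l" "Fract b (d * c) \<in> Oloc l" unfolding Oloc_def by blast+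
  ultimately show ?thesis unfolding Iloc_def by blast
qed

text \<open>Clearing denominators. With \<open>Iloc_I\<close> it replaces the local ideal by
  polynomials that some polynomial nonzero at \<open>l\<close> multiplies into the ideal.\<close>

lemma Iloc_D:
  assumes "Fract x 1 \<in> Iloc l f g"
  shows "\<exists>c. eval2 c (fst l) (snd l) \<noteq> 0 \<and> c * x \<in> ideal2 f g"
proof -
  obtain a b c d where bd: "eval2 b (fst l) (snd l) \<noteq> 0" "eval2 d (fst l) (snd l) \<noteq> 0"
    and eq: "Fract x 1 = Fract a b * Fract f 1 + Fract c d * Fract g 1"
    using assms unfolding Iloc_def Oloc_def by blast
  have 0: "b \<noteq> 0" "d \<noteq> 0" using bd by auto
  have "x * (b * d) = (a * d) * f + (c * b) * g"
    using eq 0 by (simp add: eq_fract algebra_simps)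
  hence "(b * d) * x = (a * d) * f + (c * b) * g" by (simp add: mult.commute)
  hence "(b * d) * x \<in> ideal2 f g" unfolding ideal2_def by blast
  thus ?thesis using bd by (intro exI[of _ "b * d"]) simp
qed

lemma Oloc_add: "x \<in> Oloc l \<Longrightarrow> y \<in> Oloc l \<Longrightarrow> x + y \<in> Oloc l"
  unfolding Oloc_def
proof safe
  fix a b c d assume bd: "eval2 b (fst l) (snd l) \<noteq> 0" "eval2 d (fst l) (snd l) \<noteq> 0"
  hence "b \<noteq> 0" "d \<noteq> 0" by auto
  thus "\<exists>a' b'. eval2 b' (fst l) (snd l) \<noteq> 0 \<and> Fract a b + Fract c d = Fract a' b'"
    using bd by (intro exI[of _ "a * d + c * b"] exI[of _ "b * d"]) simp
qed

lemma Oloc_mult: "x \<in> Oloc l \<Longrightarrow> y \<in> Oloc l \<Longrightarrow> x * y \<in> Oloc l"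
  unfolding Oloc_def
proof safe
  fix a b c d assume bd: "eval2 b (fst l) (snd l) \<noteq> 0" "eval2 d (fst l) (snd l) \<noteq> 0"
  thus "\<exists>a' b'. eval2 b' (fst l) (snd l) \<noteq> 0 \<and> Fract a b * Fract c d = Fract a' b'"
    by (intro exI[of _ "a * c"] exI[of _ "b * d"]) simp
qed

lemma Oloc_poly: "Fract a 1 \<in> Oloc l"
  unfolding Oloc_def by (intro CollectI exI[of _ a] exI[of _ 1]) simp

lemma Iloc_add: "x \<in> Iloc l f g \<Longrightarrow> y \<in> Iloc l f g \<Longrightarrow> x + y \<in> Iloc l f g"
  unfolding Iloc_def
proof safe
  fix u v u' v' assume "u \<in> Oloc l" "v \<in> Oloc l" "u' \<in> Oloc l" "v' \<in> Oloc l"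
  thus "\<exists>a\<in>Oloc l. \<exists>b\<in>Oloc l. u * Fract f 1 + v * Fract g 1 + (u' * Fract f 1 + v' * Fract g 1) = a * Fract f 1 + b * Fract g 1"
    by (intro bexI[of _ "u + u'"] bexI[of _ "v + v'"] Oloc_add) (simp_all add: algebra_simps)
qed

lemma Iloc_mult: "x \<in> Iloc l f g \<Longrightarrow> y \<in> Oloc l \<Longrightarrow> y * x \<in> Iloc l f g"
  unfolding Iloc_def
proof safe
  fix u v assume "u \<in> Oloc l" "v \<in> Oloc l" "y \<in> Oloc l"
  thus "\<exists>a\<in>Oloc l. \<exists>b\<in>Oloc l. y * (u * Fract f 1 + v * Fract g 1) = a * Fract f 1 + b * Fract g 1"
    by (intro bexI[of _ "y * u"] bexI[of _ "y * v"] Oloc_mult) (simp_all add: algebra_simps)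
qed

lemma Iloc_0: "0 \<in> Iloc l f g"
proof -
  have "Fract 0 1 \<in> Oloc l" by (rule Oloc_poly)
  hence "0 \<in> Oloc l" by (simp add: Zero_fract_def)
  thus ?thesis unfolding Iloc_def by force
qed

lemma Iloc_sum: "(\<And>k. k \<in> K \<Longrightarrow> x k \<in> Iloc l f g) \<Longrightarrow> sum x K \<in> Iloc l f g"
  by (induction K rule: infinite_finite_induct) (auto intro: Iloc_0 Iloc_add)

lemma fsc_Oloc: "fsc c \<in> Oloc l"
  unfolding fsc_def by (rule Oloc_poly)

lemma fsc_simps: "fsc (a + b) = fsc a + fsc b" "fsc (a * b) = fsc a * fsc b" "fsc 0 = 0"
  by (simp_all add: fsc_def Zero_fract_def)

lemma fsc_sum: "fsc (\<Sum>k\<in>K. c k) = (\<Sum>k\<in>K. fsc (c k))"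
  by (induction K rule: infinite_finite_induct) (simp_all add: fsc_simps)

text \<open>More unknowns than equations. The quotient by \<open>Iloc\<close> is never formed as a
  vector space, and the uniqueness of its dimension rests on this.\<close>

lemma homogeneous_system:
  fixes a :: "'k \<Rightarrow> nat \<Rightarrow> complex"
  assumes "finite K" "d < card K"
  shows "\<exists>c. (\<exists>k\<in>K. c k \<noteq> 0) \<and> (\<forall>i<d. (\<Sum>k\<in>K. c k * a k i) = 0)"
  using assms
proof (induction d arbitrary: K a)
  case 0
  hence "K \<noteq> {}" by auto
  thus ?case by (intro exI[of _ "\<lambda>_. 1"]) auto
next
  case (Suc d)
  show ?case
  proof (cases "\<exists>k0\<in>K. a k0 d \<noteq> 0")
    case False
    hence z: "c k * a k d = 0" if "k \<in> K" for c :: "'k \<Rightarrow> complex" and k using that by auto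
    obtain c where c: "\<exists>k\<in>K. c k \<noteq> 0" "\<forall>i<d. (\<Sum>k\<in>K. c k * a k i) = 0"
      using Suc.IH[of K a] Suc.prems by auto
    thus ?thesis using z[of _ c] by (intro exI[of _ c]) (auto simp: less_Suc_eq intro!: sum.neutral)
  next
    case True
    then obtain k0 where k0: "k0 \<in> K" "a k0 d \<noteq> 0" by blast
    \<comment> \<open>Elimination of equation \<open>d\<close> with pivot \<open>k0\<close>; the
      value of \<open>c'\<close> at \<open>k0\<close> will restore that equation.\<close>
    define a' where "a' = (\<lambda>k i. a k i - a k d / a k0 d * a k0 i)"
    have "card (K - {k0}) > d" using Suc.prems k0 by simp
    then obtain c where c: "\<exists>k\<in>K - {k0}. c k \<noteq> 0" "\<forall>i<d. (\<Sum>k\<in>K - {k0}. c k * a' k i) = 0"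
      using Suc.IH[of "K - {k0}" a'] Suc.prems(1) by auto
    define s where "s = (\<Sum>k\<in>K - {k0}. c k * (a k d / a k0 d))"
    define c' where "c' = (\<lambda>k. if k = k0 then - s else c k)"
    have sum: "(\<Sum>k\<in>K. c' k * a k i) = (\<Sum>k\<in>K - {k0}. c k * a' k i)" for i
    proof -
      have "(\<Sum>k\<in>K. c' k * a k i) = - s * a k0 i + (\<Sum>k\<in>K - {k0}. c' k * a k i)"
        using Suc.prems(1) k0(1) by (subst sum.remove[of K k0]) (auto simp: c'_def)
      also have "(\<Sum>k\<in>K - {k0}. c' k * a k i) = (\<Sum>k\<in>K - {k0}. c k * a k i)"
        by (intro sum.cong) (auto simp: c'_def)
      finally show ?thesis
        by (simp add: s_def a'_def right_diff_distrib sum_subtractf sum_distrib_right mult.assoc)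
    qed
    have "(\<Sum>k\<in>K. c' k * a k i) = 0" if "i < Suc d" for i
    proof (cases "i = d")
      case True
      show ?thesis unfolding sum True using k0(2) by (intro sum.neutral) (auto simp: a'_def)
    next
      case False
      thus ?thesis unfolding sum using c(2) that by auto
    qed
    moreover have "\<exists>k\<in>K. c' k \<noteq> 0" using c(1) by (auto simp: c'_def)
    ultimately show ?thesis by blast
  qed
qed

text \<open>The independent \<open>e'\<close> are expressed modulo the ideal by the
  \<open>e\<close>; if there were more of them, a nontrivial solution of the resulting system would
  be a relation.\<close>

lemma quot_has_dim_le:
  assumes "quot_has_dim l f g d" "quot_has_dim l f g d'"
  shows "d' \<le> d"
proof (rule ccontr)
  assume "\<not> d' \<le> d"
  hence lt: "d < card {..<d'}" by simp
  obtain e where e: "\<And>x. x \<in> Oloc l \<Longrightarrow> \<exists>c. x - (\<Sum>i<d. fsc (c i) * e i) \<in> Iloc l f g"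
    using assms(1) unfolding quot_has_dim_def by blast
  obtain e' where e': "\<And>i. i < d' \<Longrightarrow> e' i \<in> Oloc l"
    "\<And>c. (\<Sum>i<d'. fsc (c i) * e' i) \<in> Iloc l f g \<Longrightarrow> \<forall>i<d'. c i = 0"
    using assms(2) unfolding quot_has_dim_def by blast
  define a where "a = (\<lambda>k. SOME c. e' k - (\<Sum>i<d. fsc (c i) * e i) \<in> Iloc l f g)"
  have a: "e' k - (\<Sum>i<d. fsc (a k i) * e i) \<in> Iloc l f g" if "k < d'" for k
    unfolding a_def using e[OF e'(1)[OF that]] by (rule someI_ex)
  obtain c where c: "\<exists>k\<in>{..<d'}. c k \<noteq> 0" "\<forall>i<d. (\<Sum>k\<in>{..<d'}. c k * a k i) = 0"
    using homogeneous_system[OF _ lt, of a] by auto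
  have "(\<Sum>k<d'. fsc (c k) * (e' k - (\<Sum>i<d. fsc (a k i) * e i))) \<in> Iloc l f g"
    by (intro Iloc_sum Iloc_mult a fsc_Oloc) simp
  also have "(\<Sum>k<d'. fsc (c k) * (e' k - (\<Sum>i<d. fsc (a k i) * e i))) =
     (\<Sum>k<d'. fsc (c k) * e' k) - (\<Sum>k<d'. \<Sum>i<d. fsc (c k * a k i) * e i)"
    by (simp add: right_diff_distrib sum_subtractf sum_distrib_left fsc_simps mult.assoc)
  also have "(\<Sum>k<d'. \<Sum>i<d. fsc (c k * a k i) * e i) = (\<Sum>i<d. fsc (\<Sum>k<d'. c k * a k i) * e i)"
    by (subst sum.swap) (simp add: fsc_sum sum_distrib_right)
  also have "\<dots> = 0" using c(2) by (intro sum.neutral) (auto simp: fsc_simps)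
  finally have "\<forall>i<d'. c i = 0" using e'(2)[of c] by simp
  thus False using c(1) by auto
qed

lemma int_mult_eqI: "quot_has_dim l f g d \<Longrightarrow> int_mult l f g = d"
  unfolding int_mult_def by (intro the_equality) (auto intro: antisym quot_has_dim_le)

section \<open>The quotient module\<close>

lemma cscale_mult: "cscale c f = [:[:c:]:] * f"
  by (simp add: cscale_def)

lemma Fract_sum_one: "(\<Sum>k\<in>K. Fract (f k) 1) = Fract (\<Sum>k\<in>K. f k) (1 :: complex poly poly)"
  by (induction K rule: infinite_finite_induct) (simp_all add: Zero_fract_def)

lemma zx_shift: "zx c = zx 0 - [:[:c:]:]" and zy_shift: "zy c = zy 0 - [:[:c:]:]"
  by (simp_all add: zx_def zy_def)

lemma prod_power_in_ideal:
  assumes N: "is_ideal N" and A: "(\<Prod>x\<in>#A. c x) \<in> N" and k: "size A \<le> k"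
  shows "(\<Prod>x\<in>set_mset A. c x ^ k) \<in> N"
proof (rule is_ideal_dvd[OF N A])
  have "(\<Prod>x\<in>#A. c x) = (\<Prod>x\<in>set_mset A. c x ^ count A x)"
    by (simp add: image_prod_mset_multiplicity)
  also have "\<dots> dvd (\<Prod>x\<in>set_mset A. c x ^ k)"
    using k by (intro prod_dvd_prod le_imp_power_dvd) (meson count_le_size order_trans)
  finally show "(\<Prod>x\<in>#A. c x) dvd (\<Prod>x\<in>set_mset A. c x ^ k)" .
qed

text \<open>The purely algebraic situation: the map induces a linear isomorphism from
  \<open>G\<close> onto the polynomials modulo \<open>N\<close> that carries \<open>T1\<close> and
  \<open>T2\<close> to multiplication by z1 and z2. \<open>A\<close> and \<open>B\<close> bound the
  coordinates of the points at which \<open>N\<close> vanishes.\<close>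

locale quotient_model =
  fixes q qt v :: "complex poly poly" and N G :: "complex poly poly set" and A B :: "complex multiset"
    and \<psi> T1 T2 :: "complex poly poly \<Rightarrow> complex poly poly"
  assumes N: "is_ideal N" and qN: "q \<in> N" and qtN: "qt \<in> N"
    and vN: "\<And>f. f \<in> N \<Longrightarrow> v * f \<in> ideal2 q qt"
    and vnz: "\<And>z1 z2. cmod z1 < 1 \<Longrightarrow> cmod z2 < 1 \<Longrightarrow> eval2 v z1 z2 \<noteq> 0"
    and A: "(\<Prod>x\<in>#A. zx x) \<in> N" and B: "(\<Prod>y\<in>#B. zy y) \<in> N"
    and G_sub: "cs.subspace G" and G_fin: "\<exists>S. finite S \<and> G \<subseteq> cs.span S"
    and psi_add: "\<And>f g. \<psi> (f + g) = \<psi> f + \<psi> g" and psi_scale: "\<And>c f. \<psi> (cscale c f) = cscale c (\<psi> f)"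
    and psi_inj: "\<And>g. g \<in> G \<Longrightarrow> \<psi> g \<in> N \<Longrightarrow> g = 0"
    and psi_surj: "\<And>f. \<exists>g\<in>G. f - \<psi> g \<in> N"
    and T1: "\<And>g. g \<in> G \<Longrightarrow> T1 g \<in> G \<and> zx 0 * \<psi> g - \<psi> (T1 g) \<in> N"
    and T2: "\<And>g. g \<in> G \<Longrightarrow> T2 g \<in> G \<and> zy 0 * \<psi> g - \<psi> (T2 g) \<in> N"
begin

lemmas I = is_idealD[OF N]

lemma ideal2_subset: "f \<in> ideal2 q qt \<Longrightarrow> f \<in> N"
  unfolding ideal2_def using qN qtN by (auto intro: I(2) I(3))

lemma psi_0 [simp]: "\<psi> 0 = 0"
  using psi_scale[of 0 0] by (simp add: cscale_def)

lemma psi_cmult: "\<psi> ([:[:c:]:] * f) = [:[:c:]:] * \<psi> f"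
  using psi_scale[of c f] by (simp only: cscale_mult)

lemma psi_diff: "\<psi> (f - g) = \<psi> f - \<psi> g"
  using psi_add[of "f - g" g] by simp

lemma psi_sum: "\<psi> (\<Sum>k\<in>K. f k) = (\<Sum>k\<in>K. \<psi> (f k))"
  by (induction K rule: infinite_finite_induct) (simp_all add: psi_add)

definition Gl :: "complex \<times> complex \<Rightarrow> complex poly poly set" where
  "Gl l = {f \<in> G. \<exists>N M. ((\<lambda>g. T1 g - smult [:fst l:] g) ^^ N) f = 0 \<and>
      ((\<lambda>g. T2 g - smult [:snd l:] g) ^^ M) f = 0}"

lemma iterate:
  assumes T: "\<And>g. g \<in> G \<Longrightarrow> T g \<in> G \<and> z * \<psi> g - \<psi> (T g) \<in> N" and g: "g \<in> G"
  shows "((\<lambda>g. T g - smult [:c:] g) ^^ k) g \<in> G \<and>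
     (z - [:[:c:]:]) ^ k * \<psi> g - \<psi> (((\<lambda>g. T g - smult [:c:] g) ^^ k) g) \<in> N"
proof (induction k)
  case 0
  show ?case using g I(1) by simp
next
  case (Suc k)
  let ?h = "((\<lambda>g. T g - smult [:c:] g) ^^ k) g"
  have h: "?h \<in> G" "(z - [:[:c:]:]) ^ k * \<psi> g - \<psi> ?h \<in> N" using Suc by blast+
  have "T ?h - cscale c ?h \<in> G" using T[OF h(1)] h(1) by (intro cs.subspace_diff cs.subspace_scale G_sub) auto
  moreover have "\<psi> (T ?h - cscale c ?h) = \<psi> (T ?h) - [:[:c:]:] * \<psi> ?h"
    by (simp only: psi_diff cscale_mult psi_cmult)
  hence "(z - [:[:c:]:]) ^ Suc k * \<psi> g - \<psi> (T ?h - cscale c ?h) =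
     (z - [:[:c:]:]) * ((z - [:[:c:]:]) ^ k * \<psi> g - \<psi> ?h) + (z * \<psi> ?h - \<psi> (T ?h))"
    by (simp add: algebra_simps)
  moreover have "\<dots> \<in> N" using h T[OF h(1)] by (intro I(2) I(3)) auto
  ultimately show ?case by (simp add: cscale_def del: power_Suc)
qed

lemma iterate_zero_iff:
  assumes T: "\<And>g. g \<in> G \<Longrightarrow> T g \<in> G \<and> z * \<psi> g - \<psi> (T g) \<in> N" and g: "g \<in> G"
  shows "((\<lambda>g. T g - smult [:c:] g) ^^ k) g = 0 \<longleftrightarrow> (z - [:[:c:]:]) ^ k * \<psi> g \<in> N"
proof
  let ?h = "((\<lambda>g. T g - smult [:c:] g) ^^ k) g"
  have h: "?h \<in> G" "(z - [:[:c:]:]) ^ k * \<psi> g - \<psi> ?h \<in> N" using iterate[OF T g] by blast+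
  show "?h = 0 \<Longrightarrow> (z - [:[:c:]:]) ^ k * \<psi> g \<in> N" using h(2) by simp
  assume "(z - [:[:c:]:]) ^ k * \<psi> g \<in> N"
  from I(6)[OF this h(2)] have "\<psi> ?h \<in> N" by simp
  thus "?h = 0" by (rule psi_inj[OF h(1)])
qed

lemma power_mult_mono: "z ^ k * f \<in> N \<Longrightarrow> k \<le> j \<Longrightarrow> z ^ j * f \<in> N"
  by (rule is_ideal_dvd[OF N]) (auto intro: mult_dvd_mono le_imp_power_dvd)

text \<open>The larger of the two exponents serves for both operators, which from here on are
  replaced by multiplication modulo \<open>N\<close>.\<close>

lemma Gl_iff: "g \<in> Gl l \<longleftrightarrow> g \<in> G \<and> (\<exists>k. zx (fst l) ^ k * \<psi> g \<in> N \<and> zy (snd l) ^ k * \<psi> g \<in> N)"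
proof -
  have "(\<exists>N' M. zx (fst l) ^ N' * \<psi> g \<in> N \<and> zy (snd l) ^ M * \<psi> g \<in> N) \<longleftrightarrow>
      (\<exists>k. zx (fst l) ^ k * \<psi> g \<in> N \<and> zy (snd l) ^ k * \<psi> g \<in> N)"
  proof
    assume "\<exists>N' M. zx (fst l) ^ N' * \<psi> g \<in> N \<and> zy (snd l) ^ M * \<psi> g \<in> N"
    then obtain N' M where "zx (fst l) ^ N' * \<psi> g \<in> N" "zy (snd l) ^ M * \<psi> g \<in> N" by blast
    thus "\<exists>k. zx (fst l) ^ k * \<psi> g \<in> N \<and> zy (snd l) ^ k * \<psi> g \<in> N"
      by (intro exI[of _ "max N' M"] conjI) (auto elim: power_mult_mono)
  qed blast
  thus ?thesis
    unfolding Gl_def using iterate_zero_iff[OF T1] iterate_zero_iff[OF T2]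
    by (auto simp: zx_shift[of "fst l"] zy_shift[of "snd l"])
qed

lemma Gl_subset: "Gl l \<subseteq> G"
  by (auto simp: Gl_def)

lemma Gl_subspace: "cs.subspace (Gl l)"
proof (rule cs.subspaceI)
  show "0 \<in> Gl l" unfolding Gl_iff using I(1) cs.subspace_0[OF G_sub] by simp
next
  fix f g assume "f \<in> Gl l" "g \<in> Gl l"
  then obtain j k where fg: "f \<in> G" "g \<in> G" and j: "zx (fst l) ^ j * \<psi> f \<in> N" "zy (snd l) ^ j * \<psi> f \<in> N"
    and k: "zx (fst l) ^ k * \<psi> g \<in> N" "zy (snd l) ^ k * \<psi> g \<in> N"
    unfolding Gl_iff by blast
  have "zx (fst l) ^ max j k * \<psi> (f + g) \<in> N" "zy (snd l) ^ max j k * \<psi> (f + g) \<in> N"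
    unfolding psi_add distrib_left
    by (intro I(2) power_mult_mono[OF j(1)] power_mult_mono[OF j(2)] power_mult_mono[OF k(1)] power_mult_mono[OF k(2)]; simp)+
  thus "f + g \<in> Gl l" unfolding Gl_iff using cs.subspace_add[OF G_sub fg] by blast
next
  fix c f assume "f \<in> Gl l"
  then obtain j where f: "f \<in> G" and j: "zx (fst l) ^ j * \<psi> f \<in> N" "zy (snd l) ^ j * \<psi> f \<in> N"
    unfolding Gl_iff by blast
  have "zx (fst l) ^ j * \<psi> (cscale c f) \<in> N" "zy (snd l) ^ j * \<psi> (cscale c f) \<in> N"
    unfolding cscale_mult psi_cmult mult.left_commute[of "_ ^ j"]
    using I(3)[OF j(1)] I(3)[OF j(2)] by blast+
  thus "cscale c f \<in> Gl l" unfolding Gl_iff using cs.subspace_scale[OF G_sub f] by blast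
qed

text \<open>The annihilator of the image of \<open>g\<close> modulo \<open>N\<close> contains powers
  of both linear factors at \<open>l\<close> and also \<open>c\<close>, hence 1.\<close>

lemma zero_of_local:
  assumes g: "g \<in> Gl l" and c: "eval2 c (fst l) (snd l) \<noteq> 0" "c * \<psi> g \<in> N"
  shows "g = 0"
proof -
  obtain k where k: "g \<in> G" "zx (fst l) ^ k * \<psi> g \<in> N" "zy (snd l) ^ k * \<psi> g \<in> N"
    using g unfolding Gl_iff by blast
  have K: "is_ideal {h. \<psi> g * h \<in> N}" by (rule is_ideal_colon[OF N])
  have "1 \<in> {h. \<psi> g * h \<in> N}"
    by (rule one_in_ideal_at[OF K, of "fst l" k "snd l" c])
       (use k c in \<open>simp_all add: mult.commute\<close>)
  thus ?thesis using psi_inj[OF k(1)] by simp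
qed

text \<open>A grid that contains the common zeros in the bidisk and in general further points, at
  which \<open>Gl\<close> will turn out to be 0.\<close>

definition pts :: "(complex \<times> complex) set" where "pts = set_mset A \<times> set_mset B"

lemma finite_pts: "finite pts"
  by (simp add: pts_def)

text \<open>Products of the Chinese remainder idempotents in z1 and in z2. One exponent serves for
  all roots, since multiplicities are at most the size of the multiset.\<close>

lemma idempotents:
  "\<exists>E k. 1 - (\<Sum>l\<in>pts. E l) \<in> N \<and> (\<forall>l\<in>pts. zx (fst l) ^ k * E l \<in> N \<and> zy (snd l) ^ k * E l \<in> N)"
proof -
  define k where "k = max (size A) (size B)"
  let ?P = "\<Prod>x\<in>set_mset A. zx x ^ k" and ?Q = "\<Prod>y\<in>set_mset B. zy y ^ k"
  have P: "?P \<in> N" and Q: "?Q \<in> N"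
    using prod_power_in_ideal[OF N A, of k] prod_power_in_ideal[OF N B, of k] by (simp_all add: k_def)
  obtain w c where w: "(\<Sum>x\<in>set_mset A. w x) = 1 + c * ?P" "\<And>x. x \<in># A \<Longrightarrow> ?P dvd zx x ^ k * w x"
    using partition_of_unity[of "set_mset A" "\<lambda>x. zx x ^ k"] comax_powers comax_zx by force
  obtain w' c' where w': "(\<Sum>y\<in>set_mset B. w' y) = 1 + c' * ?Q" "\<And>y. y \<in># B \<Longrightarrow> ?Q dvd zy y ^ k * w' y"
    using partition_of_unity[of "set_mset B" "\<lambda>y. zy y ^ k"] comax_powers comax_zy by force
  define E where "E = (\<lambda>l. w (fst l) * w' (snd l))"
  have "(\<Sum>l\<in>pts. E l) = (1 + c * ?P) * (1 + c' * ?Q)"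
    unfolding w(1)[symmetric] w'(1)[symmetric] pts_def E_def
    by (simp add: sum_product sum.cartesian_product case_prod_unfold)
  hence "1 - (\<Sum>l\<in>pts. E l) = (- c * (1 + c' * ?Q)) * ?P + (- c') * ?Q" by (simp add: algebra_simps)
  hence "1 - (\<Sum>l\<in>pts. E l) \<in> N" using I(2)[OF I(3)[OF P] I(3)[OF Q]] by metis
  moreover have "zx (fst l) ^ k * E l \<in> N \<and> zy (snd l) ^ k * E l \<in> N" if "l \<in> pts" for l
  proof
    have l: "fst l \<in># A" "snd l \<in># B" using that by (auto simp: pts_def)
    have "zx (fst l) ^ k * E l = (zx (fst l) ^ k * w (fst l)) * w' (snd l)" by (simp add: E_def mult.assoc)
    thus "zx (fst l) ^ k * E l \<in> N" using I(4)[OF is_ideal_dvd[OF N P w(2)[OF l(1)]]] by (simp only:)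
    have "zy (snd l) ^ k * E l = w (fst l) * (zy (snd l) ^ k * w' (snd l))" by (simp add: E_def mult.left_commute)
    thus "zy (snd l) ^ k * E l \<in> N" using I(3)[OF is_ideal_dvd[OF N Q w'(2)[OF l(2)]]] by (simp only:)
  qed
  ultimately show ?thesis by blast
qed

lemma in_Gl_of_idempotent:
  assumes g: "g \<in> G" "E * f - \<psi> g \<in> N" and E: "zx (fst l) ^ k * E \<in> N" "zy (snd l) ^ k * E \<in> N"
  shows "g \<in> Gl l"
proof -
  have *: "z * \<psi> g \<in> N" if "z * E \<in> N" for z
  proof -
    have "(z * E) * f - z * (E * f - \<psi> g) \<in> N" by (rule I(6)[OF I(4)[OF that] I(3)[OF g(2)]])
    thus ?thesis by (simp add: algebra_simps)
  qed
  show ?thesis unfolding Gl_iff using g(1) * E by blast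
qed

text \<open>Locally at \<open>l\<close> the idempotent \<open>E l\<close> is 1. Every other
  \<open>E j\<close> is annihilated by a power of a linear factor in a coordinate where
  \<open>j\<close> and \<open>l\<close> differ; that factor is nonzero at \<open>l\<close>, and the
  product of these factors is \<open>u\<close>.\<close>

lemma ex_one_minus_idempotent:
  assumes E: "1 - (\<Sum>l\<in>pts. E l) \<in> N" "\<And>l. l \<in> pts \<Longrightarrow> zx (fst l) ^ k * E l \<in> N \<and> zy (snd l) ^ k * E l \<in> N"
    and l: "l \<in> pts"
  shows "\<exists>u. eval2 u (fst l) (snd l) \<noteq> 0 \<and> u * (1 - E l) \<in> N"
proof -
  define u where "u = (\<lambda>j. if fst j \<noteq> fst l then zx (fst j) ^ k else zy (snd j) ^ k)"
  have u: "eval2 (u j) (fst l) (snd l) \<noteq> 0" "u j * E j \<in> N" if "j \<in> pts - {l}" for j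
    using that E(2)[of j] by (auto simp: u_def prod_eq_iff)
  let ?u = "\<Prod>j\<in>pts - {l}. u j"
  have "eval2 (\<Prod>j\<in>J. u j) (fst l) (snd l) = (\<Prod>j\<in>J. eval2 (u j) (fst l) (snd l))" for J
    by (induction J rule: infinite_finite_induct) auto
  hence 1: "eval2 ?u (fst l) (snd l) \<noteq> 0"
    using u(1) finite_pts by simp
  have "?u * E j \<in> N" if "j \<in> pts - {l}" for j
  proof -
    have "u j * E j dvd ?u * E j" using that finite_pts by (intro mult_dvd_mono dvd_prodI) auto
    thus ?thesis using is_ideal_dvd[OF N u(2)[OF that]] by blast
  qed
  hence "(\<Sum>j\<in>pts - {l}. ?u * E j) \<in> N" by (rule is_ideal_sum[OF N])
  hence "?u * (1 - (\<Sum>l\<in>pts. E l)) + (\<Sum>j\<in>pts - {l}. ?u * E j) \<in> N" using E(1) by (intro I(2) I(3))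
  also have "?u * (1 - (\<Sum>l\<in>pts. E l)) + (\<Sum>j\<in>pts - {l}. ?u * E j) = ?u * (1 - E l)"
    unfolding sum.remove[OF finite_pts l] sum_distrib_left[symmetric] by (simp add: algebra_simps)
  finally show ?thesis using 1 by blast
qed

lemma dim_G: "cs.dim G = (\<Sum>l\<in>pts. cs.dim (Gl l))"
proof -
  obtain E k where E: "1 - (\<Sum>l\<in>pts. E l) \<in> N"
    "\<And>l. l \<in> pts \<Longrightarrow> zx (fst l) ^ k * E l \<in> N \<and> zy (snd l) ^ k * E l \<in> N"
    using idempotents by blast
  obtain S where S: "finite S" "G \<subseteq> cs.span S" using G_fin by blast
  show ?thesis
  proof (rule cs.dim_direct_sum[OF finite_pts Gl_subspace S(1)])
    show "Gl l \<subseteq> cs.span S" for l using Gl_subset S(2) by blast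
    show "Gl l \<subseteq> G" for l by (rule Gl_subset)
  next
    fix x assume x: "x \<in> G"
    \<comment> \<open>The component of x at \<open>l\<close> is the element of \<open>G\<close>
      representing \<open>E l\<close> times the image of x.\<close>
    define w where "w = (\<lambda>l. SOME g. g \<in> G \<and> E l * \<psi> x - \<psi> g \<in> N)"
    have w: "w l \<in> G \<and> E l * \<psi> x - \<psi> (w l) \<in> N" for l
      unfolding w_def by (rule someI_ex) (use psi_surj in blast)
    have "w l \<in> Gl l" if "l \<in> pts" for l
      by (rule in_Gl_of_idempotent[of _ "E l" "\<psi> x" _ k]) (use w[of l] E(2)[OF that] in blast)+
    moreover have "x - (\<Sum>l\<in>pts. w l) = 0"
    proof (rule psi_inj)
      show "x - (\<Sum>l\<in>pts. w l) \<in> G"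
        using x w by (intro cs.subspace_diff cs.subspace_sum G_sub) auto
      have "(1 - (\<Sum>l\<in>pts. E l)) * \<psi> x + (\<Sum>l\<in>pts. E l * \<psi> x - \<psi> (w l)) \<in> N"
        using E(1) w by (intro I(2) I(4) is_ideal_sum[OF N]) auto
      thus "\<psi> (x - (\<Sum>l\<in>pts. w l)) \<in> N"
        by (simp add: psi_diff psi_sum sum_subtractf left_diff_distrib sum_distrib_right)
    qed
    hence "x = (\<Sum>l\<in>pts. w l)" by simp
    ultimately show "\<exists>w. (\<forall>l\<in>pts. w l \<in> Gl l) \<and> x = (\<Sum>l\<in>pts. w l)" by blast
  next
    fix w assume w: "\<forall>l\<in>pts. w l \<in> Gl l" and sum0: "(\<Sum>l\<in>pts. w l) = 0"
    \<comment> \<open>Powers of linear factors with different roots annihilate \<open>E j\<close>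
      and the component at \<open>l\<close>; such powers are comaximal.\<close>
    have cross: "E j * \<psi> (w l) \<in> N" if l: "l \<in> pts" and j: "j \<in> pts" and "j \<noteq> l" for j l
    proof -
      obtain i where i: "zx (fst l) ^ i * \<psi> (w l) \<in> N" "zy (snd l) ^ i * \<psi> (w l) \<in> N"
        using w l unfolding Gl_iff by blast
      have *: "E j * \<psi> (w l) \<in> N" if c: "comax a b" and ab: "a * E j \<in> N" "b * \<psi> (w l) \<in> N" for a b
      proof -
        obtain s t where st: "s * a + t * b = 1" using c unfolding comax_def by blast
        have "(s * \<psi> (w l)) * (a * E j) + (t * E j) * (b * \<psi> (w l)) \<in> N"
          by (rule I(2)[OF I(3)[OF ab(1)] I(3)[OF ab(2)]])
        also have "(s * \<psi> (w l)) * (a * E j) + (t * E j) * (b * \<psi> (w l)) = (s * a + t * b) * (E j * \<psi> (w l))"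
          by (simp add: algebra_simps)
        finally show ?thesis by (simp add: st)
      qed
      show ?thesis
      proof (cases "fst j = fst l")
        case True
        hence "snd j \<noteq> snd l" using \<open>j \<noteq> l\<close> by (simp add: prod_eq_iff)
        thus ?thesis using * comax_powers[OF comax_zy] E(2)[OF j] i(2) by blast
      next
        case False
        thus ?thesis using * comax_powers[OF comax_zx] E(2)[OF j] i(1) by blast
      qed
    qed
    show "\<forall>l\<in>pts. w l = 0"
    proof
      fix l assume l: "l \<in> pts"
      have "(\<Sum>j\<in>pts. \<psi> (w j)) = 0" using sum0 psi_sum[of w pts] by simp
      hence "E l * \<psi> (w l) = - (\<Sum>j\<in>pts - {l}. E l * \<psi> (w j))"
        unfolding sum_distrib_left[symmetric] sum.remove[OF finite_pts l]
        by (simp add: eq_neg_iff_add_eq_0 distrib_left[symmetric])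
      moreover have "(\<Sum>j\<in>pts - {l}. E l * \<psi> (w j)) \<in> N" using l by (intro is_ideal_sum[OF N] cross) auto
      ultimately have El: "E l * \<psi> (w l) \<in> N" using I(5) by simp
      have "(\<Sum>j\<in>pts - {l}. E j * \<psi> (w l)) \<in> N" using l by (intro is_ideal_sum[OF N] cross) auto
      hence "E l * \<psi> (w l) + (\<Sum>j\<in>pts - {l}. E j * \<psi> (w l)) \<in> N" using El by (intro I(2))
      hence "(\<Sum>j\<in>pts. E j) * \<psi> (w l) \<in> N"
        unfolding sum_distrib_right by (subst sum.remove[OF finite_pts l])
      hence "(\<Sum>j\<in>pts. E j) * \<psi> (w l) + (1 - (\<Sum>j\<in>pts. E j)) * \<psi> (w l) \<in> N"
        by (rule I(2)[OF _ I(4)[OF E(1)]])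
      hence "\<psi> (w l) \<in> N" by (simp add: algebra_simps)
      thus "w l = 0" using psi_inj w l Gl_subset by blast
    qed
  qed
qed

text \<open>A basis of \<open>Gl l\<close> gives a basis of the local quotient. A relation is
  annihilated by some polynomial nonzero at \<open>l\<close>, so \<open>zero_of_local\<close> makes
  it trivial. A fraction a/d is represented through an inverse of \<open>d\<close> that exists
  locally modulo \<open>N\<close>.\<close>

lemma quot_has_dim_Gl:
  assumes l: "l \<in> pts" "cmod (fst l) < 1" "cmod (snd l) < 1"
  shows "quot_has_dim l q qt (cs.dim (Gl l))"
proof -
  obtain E k where E: "1 - (\<Sum>l\<in>pts. E l) \<in> N"
    "\<And>l. l \<in> pts \<Longrightarrow> zx (fst l) ^ k * E l \<in> N \<and> zy (snd l) ^ k * E l \<in> N"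
    using idempotents by blast
  obtain S where S: "finite S" "G \<subseteq> cs.span S" using G_fin by blast
  obtain b where b: "b \<subseteq> Gl l" "cs.independent b" "Gl l \<subseteq> cs.span b" "card b = cs.dim (Gl l)"
    using cs.basis_exists by blast
  have finb: "finite b"
    using cs.independent_span_bound[OF S(1) b(2)] b(1) Gl_subset S(2) by blast
  let ?d = "cs.dim (Gl l)"
  obtain h where h: "bij_betw h {..<?d} b"
    using ex_bij_betw_nat_finite[OF finb] b(4) by (auto simp: atLeast0LessThan)
  have sum: "(\<Sum>i<?d. fsc (c i) * Fract (\<psi> (h i)) 1) = Fract (\<psi> (\<Sum>i<?d. cscale (c i) (h i))) 1" for c
    by (simp only: psi_sum psi_cmult Fract_sum_one[symmetric] cscale_mult fsc_def mult_fract mult_1)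
  have v0: "eval2 v (fst l) (snd l) \<noteq> 0" using l vnz by blast
  show ?thesis
    unfolding quot_has_dim_def
  proof (intro exI[of _ "\<lambda>i. Fract (\<psi> (h i)) 1"] conjI allI impI ballI)
    show "Fract (\<psi> (h i)) 1 \<in> Oloc l" for i by (rule Oloc_poly)
  next
    fix c i assume "(\<Sum>i<?d. fsc (c i) * Fract (\<psi> (h i)) 1) \<in> Iloc l q qt" and i: "i < ?d"
    then obtain u where u: "eval2 u (fst l) (snd l) \<noteq> 0" "u * \<psi> (\<Sum>i<?d. cscale (c i) (h i)) \<in> ideal2 q qt"
      unfolding sum using Iloc_D by blast
    have "(\<Sum>i<?d. cscale (c i) (h i)) \<in> Gl l"
      using b(1) bij_betwE[OF h] by (intro cs.subspace_sum cs.subspace_scale Gl_subspace) auto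
    hence z: "(\<Sum>i<?d. cscale (c i) (h i)) = 0" using u ideal2_subset by (rule_tac zero_of_local) auto
    define w where "w = (\<lambda>x. c (inv_into {..<?d} h x))"
    have wh: "w (h j) = c j" if "j < ?d" for j
      unfolding w_def using h that by (simp add: bij_betw_inv_into_left)
    have "(\<Sum>x\<in>b. cscale (w x) x) = (\<Sum>i<?d. cscale (w (h i)) (h i))"
      by (rule sum.reindex_bij_betw[OF h, symmetric])
    also have "\<dots> = 0" using z wh by simp
    finally have "\<forall>x\<in>b. w x = 0" using b(2) cs.dependent_finite[OF finb] by blast
    thus "c i = 0" using wh[OF i] bij_betwE[OF h] i by auto
  next
    fix x assume "x \<in> Oloc l"
    then obtain a d where ad: "eval2 d (fst l) (snd l) \<noteq> 0" "x = Fract a d" unfolding Oloc_def by blast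
    \<comment> \<open>The polynomials that become 0 modulo \<open>N\<close> after localization at
      \<open>l\<close>.\<close>
    define K where "K = {f. \<exists>u. eval2 u (fst l) (snd l) \<noteq> 0 \<and> u * f \<in> N}"
    have K: "is_ideal K"
      unfolding is_ideal_def
    proof (intro conjI ballI allI)
      show "0 \<in> K" unfolding K_def using I(1) by (auto intro!: exI[of _ 1])
      show "f + g \<in> K" if fg: "f \<in> K" "g \<in> K" for f g
      proof -
        obtain u u' where u: "eval2 u (fst l) (snd l) \<noteq> 0" "u * f \<in> N" "eval2 u' (fst l) (snd l) \<noteq> 0" "u' * g \<in> N"
          using fg unfolding K_def by blast
        have "u' * (u * f) + u * (u' * g) \<in> N" by (rule I(2)[OF I(3)[OF u(2)] I(3)[OF u(4)]])
        hence "(u * u') * (f + g) \<in> N" by (simp add: algebra_simps)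
        thus ?thesis unfolding K_def using u by (intro CollectI exI[of _ "u * u'"]) simp
      qed
      show "a * f \<in> K" if "f \<in> K" for a f
        using that unfolding K_def by (auto simp: mult.left_commute[of _ a] intro: I(3))
    qed
    note IK = is_idealD[OF K]
    have NK: "f \<in> K" if "f \<in> N" for f unfolding K_def using that by (auto intro!: exI[of _ 1])
    have EK: "1 - E l \<in> K" using ex_one_minus_idempotent[OF E l(1)] unfolding K_def by blast
    \<comment> \<open>\<open>E l\<close> is 1 modulo \<open>K\<close>, so whatever annihilates it
      modulo \<open>N\<close> lies in \<open>K\<close>, in particular powers of the linear factors
      at \<open>l\<close>.\<close>
    have powK: "z \<in> K" if "z * E l \<in> N" for z
    proof -
      have "z * (1 - E l) + z * E l \<in> K" by (rule IK(2)[OF IK(3)[OF EK] NK[OF that]])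
      thus ?thesis by (simp add: algebra_simps)
    qed
    define K' where "K' = {f. \<exists>r. f - r * d \<in> K}"
    have K': "is_ideal K'" unfolding K'_def by (rule is_ideal_add_principal[OF K])
    have KK': "f \<in> K'" if "f \<in> K" for f unfolding K'_def using that by (auto intro!: exI[of _ 0])
    have "d \<in> K'" unfolding K'_def using IK(1) by (auto intro!: exI[of _ 1])
    hence "1 \<in> K'"
      using one_in_ideal_at[OF K' KK'[OF powK] KK'[OF powK], of "fst l" k "snd l" d] E(2)[OF l(1)] ad(1) by blast
    then obtain r where r: "1 - r * d \<in> K" unfolding K'_def by blast
    \<comment> \<open>\<open>r\<close> inverts \<open>d\<close> modulo \<open>K\<close>, so this
      \<open>g\<close> represents the component of a/d at \<open>l\<close>.\<close>
    obtain g where g: "g \<in> G" "E l * (a * r) - \<psi> g \<in> N" using psi_surj by blast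
    have gl: "g \<in> Gl l" using in_Gl_of_idempotent[OF g] E(2)[OF l(1)] by blast
    have "a * (1 - E l) + (a * E l) * (1 - r * d) + d * (E l * (a * r) - \<psi> g) \<in> K"
      using EK r NK[OF g(2)] by (intro IK(2) IK(3))
    also have "a * (1 - E l) + (a * E l) * (1 - r * d) + d * (E l * (a * r) - \<psi> g) = a - d * \<psi> g"
      by (simp add: algebra_simps)
    finally obtain u where u: "eval2 u (fst l) (snd l) \<noteq> 0" "u * (a - d * \<psi> g) \<in> N" unfolding K_def by blast
    \<comment> \<open>The factor \<open>v\<close> leads from \<open>N\<close> back to the ideal of
      \<open>q\<close> and \<open>qt\<close>; being nonzero at \<open>l\<close>, it is a unit of the
      local ring.\<close>
    obtain \<alpha> \<beta> where "v * (u * (a - d * \<psi> g)) = \<alpha> * q + \<beta> * qt"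
      using vN[OF u(2)] unfolding ideal2_def by blast
    hence eq: "(a - d * \<psi> g) * (v * u) = \<alpha> * q + \<beta> * qt" by (simp add: mult_ac)
    have in_I: "Fract (a - d * \<psi> g) d \<in> Iloc l q qt"
      by (rule Iloc_I[OF eq]) (use u v0 ad in simp_all)
    have "g \<in> cs.span b" using gl b(3) by blast
    then obtain c where c: "g = (\<Sum>y\<in>b. cscale (c y) y)" unfolding cs.span_finite[OF finb] by blast
    have "g = (\<Sum>i<?d. cscale (c (h i)) (h i))"
      unfolding c by (rule sum.reindex_bij_betw[OF h, symmetric])
    moreover have "d \<noteq> 0" using ad(1) by auto
    ultimately have "x - (\<Sum>i<?d. fsc (c (h i)) * Fract (\<psi> (h i)) 1) = Fract (a - d * \<psi> g) d"
      using sum[of "\<lambda>i. c (h i)"] Fract_diff_one[of d a "\<psi> g"] ad(2) by simp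
    thus "\<exists>c. x - (\<Sum>i<?d. fsc (c i) * Fract (\<psi> (h i)) 1) \<in> Iloc l q qt"
      using in_I by (intro exI[of _ "\<lambda>i. c (h i)"]) simp
  qed
qed

text \<open>Since \<open>v\<close> is nonzero in the bidisk, all of \<open>N\<close> vanishes at
  such a point, in particular the two products of linear factors.\<close>

lemma common_zeros_subset: "common_zeros_bidisk q qt \<subseteq> pts"
proof
  fix l assume l: "l \<in> common_zeros_bidisk q qt"
  hence z: "eval2 q (fst l) (snd l) = 0" "eval2 qt (fst l) (snd l) = 0"
    and v0: "eval2 v (fst l) (snd l) \<noteq> 0"
    using vnz by (auto simp: common_zeros_bidisk_def)
  have "eval2 f (fst l) (snd l) = 0" if f: "f \<in> N" for f
  proof -
    obtain a b where "v * f = a * q + b * qt" using vN[OF f] unfolding ideal2_def by blast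
    hence "eval2 (v * f) (fst l) (snd l) = eval2 (a * q + b * qt) (fst l) (snd l)" by (rule arg_cong)
    thus ?thesis using v0 z by simp
  qed
  from this[OF A] this[OF B] have "fst l \<in># A" "snd l \<in># B"
    by (auto simp: prod_mset_zero_iff)
  thus "l \<in> pts" by (cases l) (simp add: pts_def)
qed

theorem main:
  "(\<forall>l\<in>common_zeros_bidisk q qt. int_mult l q qt = cs.dim (Gl l)) \<and>
   finite (common_zeros_bidisk q qt) \<and>
   cs.dim G = (\<Sum>l\<in>common_zeros_bidisk q qt. int_mult l q qt)"
  if disc: "\<forall>x\<in>#A. cmod x < 1" "\<forall>y\<in>#B. cmod y < 1"
proof -
  have 1: "int_mult l q qt = cs.dim (Gl l)" if "l \<in> common_zeros_bidisk q qt" for l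
    using that common_zeros_subset
    by (intro int_mult_eqI quot_has_dim_Gl) (auto simp: common_zeros_bidisk_def)
  \<comment> \<open>One of \<open>q\<close> and \<open>qt\<close> is nonzero at the point and lies
    in \<open>N\<close>, so \<open>zero_of_local\<close> applies.\<close>
  have "cs.dim (Gl l) = 0" if l: "l \<in> pts - common_zeros_bidisk q qt" for l
  proof -
    have "eval2 q (fst l) (snd l) \<noteq> 0 \<or> eval2 qt (fst l) (snd l) \<noteq> 0"
      using l disc by (auto simp: common_zeros_bidisk_def pts_def)
    then obtain c where c: "c \<in> N" "eval2 c (fst l) (snd l) \<noteq> 0" using qN qtN by blast
    have "Gl l \<subseteq> {0}" using zero_of_local[OF _ c(2)] I(4)[OF c(1)] by blast
    thus ?thesis using cs.dim_le_card[of "Gl l" "{}"] by simp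
  qed
  hence "cs.dim G = (\<Sum>l\<in>common_zeros_bidisk q qt. cs.dim (Gl l))"
    unfolding dim_G by (intro sum.mono_neutral_right finite_pts common_zeros_subset) auto
  thus ?thesis using 1 finite_subset[OF common_zeros_subset finite_pts] by simp
qed

end

section \<open>The compressed multiplications\<close>

lemma tor_diff: "tor (f - g) x = tor f x - tor g x"
  by (simp add: tor_def)

lemma inL2_ee_iff: "inL2 p (\<lambda>x. ee a b x * F x) \<longleftrightarrow> inL2 p F"
proof
  assume "inL2 p (\<lambda>x. ee a b x * F x)"
  from inL2_mult_continuous[OF this continuous_on_ee, of "- a" "- b"] show "inL2 p F"
    by (simp add: mult.assoc[symmetric] ee_mult)
qed (rule inL2_mult_continuous[OF _ continuous_on_ee])

lemma ipw_ee: "ipw p (\<lambda>x. ee a b x * F x) (\<lambda>x. ee a b x * H x) = ipw p F H"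
proof -
  have "ee a b x * F x * cnj (ee a b x * H x) = F x * cnj (H x)" for x
  proof -
    have "ee a b x * F x * cnj (ee a b x * H x) = (ee a b x * cnj (ee a b x)) * (F x * cnj (H x))" by simp
    thus ?thesis by (simp add: cnj_ee ee_mult)
  qed
  thus ?thesis by (simp only: ipw_def)
qed

lemma ipw_cnj: "ipw p (\<lambda>x. cnj (F x)) (\<lambda>x. cnj (H x)) = cnj (ipw p F H)"
  unfolding ipw_def by (simp flip: Bochner_Integration.integral_cnj)

context disc_nz
begin

text \<open>Elements of the box have degrees at most (n - 1, m - 1). The linear map
  \<open>fl\<close> exchanges the traces \<open>tor\<close> and \<open>tf\<close> up to a character.
  For \<open>n = 0\<close> or \<open>m = 0\<close> the truncated subtraction is harmless, the box
  being {0}.\<close>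

definition fl :: "complex poly poly \<Rightarrow> complex poly poly" where "fl f = flip2 f (n - 1) (m - 1)"
definition rf :: "complex poly poly \<Rightarrow> complex poly poly" where "rf f = refl2 f (n - 1) (m - 1)"

lemma Gsp_iff: "f \<in> Gsp p n m \<longleftrightarrow> f \<in> pbox n m \<and> inL2 p (tor f)"
  by (simp add: Gsp_def pbox_def)

lemma pbox_enlarge: "f \<in> pbox n m \<Longrightarrow> f \<in> pbox (Suc (n - 1)) (Suc (m - 1))"
  by (rule pbox_mono) auto

lemma fl_pbox: "f \<in> pbox n m \<Longrightarrow> fl f \<in> pbox n m"
  unfolding pbox_def fl_def flip2_def mem_Collect_eq cf_mk2
proof (intro allI impI)
  fix i j assume f: "\<forall>i j. cf f i j \<noteq> 0 \<longrightarrow> i < n \<and> j < m"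
    and ij: "(if i \<le> n - 1 \<and> j \<le> m - 1 then cf f i (m - 1 - j) else 0) \<noteq> 0"
  have "j \<le> m - 1" "cf f i (m - 1 - j) \<noteq> 0" using ij by presburger+
  moreover from this f have "i < n" "m - 1 - j < m" by blast+
  ultimately show "i < n \<and> j < m" by linarith
qed

lemma rf_pbox: "f \<in> pbox n m \<Longrightarrow> rf f \<in> pbox n m"
  unfolding pbox_def rf_def refl2_def mem_Collect_eq cf_mk2
proof (intro allI impI)
  fix i j assume f: "\<forall>i j. cf f i j \<noteq> 0 \<longrightarrow> i < n \<and> j < m"
    and ij: "(if i \<le> n - 1 \<and> j \<le> m - 1 then cnj (cf f (n - 1 - i) (m - 1 - j)) else 0) \<noteq> 0"
  have le: "i \<le> n - 1" "j \<le> m - 1" using ij by presburger+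
  hence "cf f (n - 1 - i) (m - 1 - j) \<noteq> 0" using ij by auto
  hence "n - 1 - i < n" "m - 1 - j < m" using f by blast+
  thus "i < n \<and> j < m" using le by linarith
qed

lemma fl_fl: "f \<in> pbox n m \<Longrightarrow> fl (fl f) = f"
proof (rule cf_eqI)
  fix i j assume f: "f \<in> pbox n m"
  show "cf (fl (fl f)) i j = cf f i j"
  proof (cases "i \<le> n - 1 \<and> j \<le> m - 1")
    case False
    hence "cf f i j = 0"
      using pbox_enlarge[OF f] unfolding pbox_def mem_Collect_eq less_Suc_eq_le by blast
    thus ?thesis using False by (auto simp: fl_def flip2_def)
  next
    case True
    hence "m - 1 - j \<le> m - 1" "m - 1 - (m - 1 - j) = j" by auto
    thus ?thesis using True by (simp only: fl_def flip2_def cf_mk2 if_True simp_thms)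
  qed
qed

lemma fl_add: "fl (f + g) = fl f + fl g" and fl_diff: "fl (f - g) = fl f - fl g"
  and fl_scale: "fl (cscale c f) = cscale c (fl f)"
  by (rule cf_eqI; simp add: fl_def flip2_def cscale_def)+

lemma tf_fl: "f \<in> pbox n m \<Longrightarrow> tf (fl f) x = ee 0 (- int (m - 1)) x * tor f x"
  unfolding fl_def by (rule tf_flip2[OF pbox_enlarge])

lemma tor_rf: "f \<in> pbox n m \<Longrightarrow> tor (rf f) x = ee (int (n - 1)) (int (m - 1)) x * cnj (tor f x)"
  unfolding rf_def by (rule tor_refl2[OF pbox_enlarge])

lemma inL2_tf_fl: "f \<in> pbox n m \<Longrightarrow> inL2 p (tf (fl f)) \<longleftrightarrow> inL2 p (tor f)"
  using inL2_ee_iff[of p 0 "- int (m - 1)" "tor f"] tf_fl[of f] by presburger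

lemma fl_Gsp: "g \<in> pbox n m \<Longrightarrow> inL2 p (tf g) \<Longrightarrow> fl g \<in> Gsp p n m"
  using inL2_tf_fl[OF fl_pbox, of g] by (simp add: Gsp_iff fl_fl fl_pbox)

lemma rf_Gsp: "f \<in> Gsp p n m \<Longrightarrow> rf f \<in> Gsp p n m"
proof -
  assume f: "f \<in> Gsp p n m"
  have "inL2 p (tor (rf f))"
  proof (rule inL2_bound[of p "tor f" _ 1])
    show "cmod (tor (rf f) x) \<le> 1 * cmod (tor f x)" for x
      using f by (simp add: tor_rf Gsp_iff norm_mult)
  qed (use f in \<open>auto simp: Gsp_iff\<close>)
  thus ?thesis using f by (simp add: Gsp_iff rf_pbox)
qed

lemma Gsp_subspace: "cs.subspace (Gsp p n m)"
proof (rule cs.subspaceI)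
  have "tor 0 = (\<lambda>x. 0)" by (auto simp: tor_def)
  thus "0 \<in> Gsp p n m" using inL2_zero[of p] by (simp add: Gsp_def)
next
  fix f g assume fg: "f \<in> Gsp p n m" "g \<in> Gsp p n m"
  have "tor (f + g) = (\<lambda>x. tor f x + tor g x)" by (auto simp: tor_def)
  hence "inL2 p (tor (f + g))" using fg inL2_add[of p "tor f" "tor g"] by (simp add: Gsp_iff)
  moreover have "f + g \<in> pbox n m" using fg unfolding Gsp_iff pbox_def mem_Collect_eq cf_simps by (metis add_0)
  ultimately show "f + g \<in> Gsp p n m" by (simp add: Gsp_iff)
next
  fix c f assume f: "f \<in> Gsp p n m"
  have "tor (cscale c f) = (\<lambda>x. c * tor f x)" by (auto simp: tor_def cscale_def)
  hence "inL2 p (tor (cscale c f))" using f inL2_cmult[of p "tor f" c] by (simp add: Gsp_iff)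
  moreover have "cscale c f \<in> pbox n m"
    using f unfolding Gsp_iff pbox_def mem_Collect_eq cscale_def cf_simps by (metis mult_zero_right)
  ultimately show "cscale c f \<in> Gsp p n m" by (simp add: Gsp_iff)
qed

text \<open>By \<open>cf_bound\<close> a polynomial of norm 0 has zero coefficients, so the inner
  product is definite on \<open>Gsp\<close>. This gives the uniqueness that the definite
  descriptions of the operators require.\<close>

lemma Gsp_eqI:
  assumes X: "X \<in> Gsp p n m" and Y: "Y \<in> Gsp p n m"
    and 0: "\<And>h. h \<in> Gsp p n m \<Longrightarrow> ipw p (\<lambda>x. tor X x - tor Y x) (tor h) = 0"
  shows "X = Y"
proof -
  have D: "X - Y \<in> Gsp p n m" using X Y by (rule cs.subspace_diff[OF Gsp_subspace])
  hence box: "X - Y \<in> pbox n m" by (simp add: Gsp_iff)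
  have "tor (X - Y) = (\<lambda>x. tor X x - tor Y x)" by (auto simp: tor_diff)
  hence "ipw p (tor (X - Y)) (tor (X - Y)) = 0" using 0[OF D] by simp
  hence "nsq p (tor (X - Y)) = 0" by (simp add: ipw_self)
  moreover have "nsq p (tf (fl (X - Y))) = nsq p (tor (X - Y))"
    by (simp add: nsq_def tf_fl[OF box] norm_mult)
  ultimately have "(cmod (cf (fl (X - Y)) i j))\<^sup>2 \<le> 0" for i j
    using cf_bound[of "fl (X - Y)" i j] D inL2_tf_fl[OF box] by (simp add: Gsp_iff)
  hence "fl (X - Y) = 0" by (intro cf_eqI) simp
  hence "fl (fl (X - Y)) = 0" using fl_scale[of 0 0] by (simp add: cscale_def)
  thus ?thesis using fl_fl[OF box] by simp
qed

lemma projection_unique: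
  assumes F: "inL2 p F" and X: "X \<in> Gsp p n m" and Y: "Y \<in> Gsp p n m"
    and 0: "\<And>h. h \<in> Gsp p n m \<Longrightarrow> ipw p (\<lambda>x. F x - tor X x) (tor h) = 0"
      "\<And>h. h \<in> Gsp p n m \<Longrightarrow> ipw p (\<lambda>x. F x - tor Y x) (tor h) = 0"
  shows "X = Y"
proof (rule Gsp_eqI[OF X Y])
  fix h assume h: "h \<in> Gsp p n m"
  thus "ipw p (\<lambda>x. tor X x - tor Y x) (tor h) = 0"
    using 0[OF h] X Y F by (simp add: ipw_diff_left Gsp_iff)
qed

text \<open>The representative of \<open>z * fl f\<close> modulo \<open>N\<close> differs from it by
  a square integrable element of \<open>N\<close>, which is orthogonal to the box. Reduction modulo
  \<open>N\<close> is therefore the orthogonal projection.\<close>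

lemma module_projection:
  assumes surj: "\<And>f. \<exists>g\<in>pbox n m. inL2 p (tf g) \<and> f - g \<in> N"
    and orth: "\<And>f g. f \<in> N \<Longrightarrow> inL2 p (tf f) \<Longrightarrow> g \<in> pbox n m \<Longrightarrow> inL2 p (tf g) \<Longrightarrow> ipw p (tf f) (tf g) = 0"
    and z: "\<And>x. tf z x = ee i j x" and f: "f \<in> Gsp p n m"
  shows "\<exists>h\<in>Gsp p n m. z * fl f - fl h \<in> N \<and> (\<forall>k\<in>Gsp p n m. ipw p (\<lambda>x. ee i j x * tor f x - tor h x) (tor k) = 0)"
proof -
  obtain g where g: "g \<in> pbox n m" "inL2 p (tf g)" "z * fl f - g \<in> N" using surj by blast
  let ?h = "fl g"
  have h: "?h \<in> Gsp p n m" using g by (intro fl_Gsp)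
  have fbox: "f \<in> pbox n m" and fL: "inL2 p (tf (fl f))" using f by (simp_all add: Gsp_iff inL2_tf_fl)
  have eq: "tf (z * fl f - g) = (\<lambda>x. ee 0 (- int (m - 1)) x * (ee i j x * tor f x - tor ?h x))"
  proof
    fix x
    have "tf g x = ee 0 (- int (m - 1)) x * tor ?h x" using tf_fl[OF fl_pbox[OF g(1)]] by (simp add: fl_fl g(1))
    thus "tf (z * fl f - g) x = ee 0 (- int (m - 1)) x * (ee i j x * tor f x - tor ?h x)"
      by (simp add: z tf_fl[OF fbox] algebra_simps)
  qed
  have L: "inL2 p (tf (z * fl f - g))"
    using inL2_diff[OF inL2_mult_poly[OF fL, of z] g(2)] by (simp add: tf_simps[abs_def])
  have "ipw p (\<lambda>x. ee i j x * tor f x - tor ?h x) (tor k) = 0" if k: "k \<in> Gsp p n m" for k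
  proof -
    have kbox: "k \<in> pbox n m" using k by (simp add: Gsp_iff)
    have "ipw p (tf (z * fl f - g)) (tf (fl k)) = 0"
      using orth[OF g(3) L fl_pbox[OF kbox]] k by (simp add: inL2_tf_fl Gsp_iff)
    moreover have "tf (fl k) = (\<lambda>x. ee 0 (- int (m - 1)) x * tor k x)" using tf_fl[OF kbox] by blast
    ultimately show ?thesis unfolding eq by (simp only: ipw_ee)
  qed
  thus ?thesis using h g(3) fl_fl[OF g(1)] by (intro bexI[of _ ?h]) simp_all
qed

context
  fixes N
  assumes surj: "\<And>f. \<exists>g\<in>pbox n m. inL2 p (tf g) \<and> f - g \<in> N"
    and orth: "\<And>f g. f \<in> N \<Longrightarrow> inL2 p (tf f) \<Longrightarrow> g \<in> pbox n m \<Longrightarrow> inL2 p (tf g) \<Longrightarrow> ipw p (tf f) (tf g) = 0"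
begin

lemma inL2_ee_tor: "f \<in> Gsp p n m \<Longrightarrow> inL2 p (\<lambda>x. ee i j x * tor f x)"
  by (simp add: inL2_ee_iff Gsp_iff)

lemma tf_zx0: "tf (zx 0) x = ee 1 0 x" and tf_zy0: "tf (zy 0) x = ee 0 (- 1) x"
  by (simp_all add: tf_zx tf_zy)

lemma Top1_spec:
  assumes f: "f \<in> Gsp p n m"
  shows "Top1 p n m f \<in> Gsp p n m \<and> zx 0 * fl f - fl (Top1 p n m f) \<in> N"
proof -
  obtain h where h: "h \<in> Gsp p n m" "zx 0 * fl f - fl h \<in> N"
    "\<And>k. k \<in> Gsp p n m \<Longrightarrow> ipw p (\<lambda>x. ee 1 0 x * tor f x - tor h x) (tor k) = 0"
    using module_projection[OF surj orth tf_zx0 f] by blast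
  have e: "cis (fst x) = ee 1 0 x" for x by (simp add: ee_def)
  have "Top1 p n m f = h"
    unfolding Top1_def e
  proof (rule the_equality)
    fix g assume "g \<in> Gsp p n m \<and> (\<forall>k\<in>Gsp p n m. ipw p (\<lambda>x. ee 1 0 x * tor f x - tor g x) (tor k) = 0)"
    thus "g = h" using projection_unique[OF inL2_ee_tor[OF f]] h(1,3) by blast
  qed (use h in blast)
  thus ?thesis using h by simp
qed

text \<open>The antiunitary reflection \<open>rf\<close> exchanges multiplication by \<open>z2\<close> and by its conjugate,
  so the projection that defines \<open>Top2\<close> exists because the one for the conjugate does.\<close>
lemma Top2_spec:
  assumes f: "f \<in> Gsp p n m"
  shows "Top2 p n m f \<in> Gsp p n m \<and>
    (\<forall>k\<in>Gsp p n m. ipw p (\<lambda>x. ee 0 1 x * tor f x - tor (Top2 p n m f) x) (tor k) = 0)"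
proof -
  obtain h where h: "h \<in> Gsp p n m"
    "\<And>k. k \<in> Gsp p n m \<Longrightarrow> ipw p (\<lambda>x. ee 0 (- 1) x * tor (rf f) x - tor h x) (tor k) = 0"
    using module_projection[OF surj orth tf_zy0 rf_Gsp[OF f]] by blast
  let ?e = "ee (int (n - 1)) (int (m - 1))"
  have box: "f \<in> pbox n m" "h \<in> pbox n m" using f h by (simp_all add: Gsp_iff)
  have ee1: "?e x * cnj (?e x) = 1" for x by (simp add: cnj_ee ee_mult)
  have tor2: "tor k x = ?e x * cnj (tor (rf k) x)" if "k \<in> Gsp p n m" for k x
  proof -
    have "k \<in> pbox n m" using that by (simp add: Gsp_iff)
    hence "?e x * cnj (tor (rf k) x) = (?e x * cnj (?e x)) * tor k x"
      by (simp only: tor_rf complex_cnj_mult complex_cnj_cnj mult.assoc)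
    thus ?thesis unfolding ee1 by simp
  qed
  have orth': "ipw p (\<lambda>x. ee 0 1 x * tor f x - tor (rf h) x) (tor k) = 0" if k: "k \<in> Gsp p n m" for k
  proof -
    have 1: "(\<lambda>x. ee 0 1 x * tor f x - tor (rf h) x) =
        (\<lambda>x. ?e x * cnj (ee 0 (- 1) x * tor (rf f) x - tor h x))"
    proof
      fix x
      show "ee 0 1 x * tor f x - tor (rf h) x = ?e x * cnj (ee 0 (- 1) x * tor (rf f) x - tor h x)"
        unfolding tor2[OF f, of x] tor_rf[OF box(2)] by (simp add: cnj_ee right_diff_distrib mult.left_commute)
    qed
    have 2: "tor k = (\<lambda>x. ?e x * cnj (tor (rf k) x))" using tor2[OF k] by blast
    show ?thesis unfolding 1 by (subst 2) (simp only: ipw_ee ipw_cnj h(2)[OF rf_Gsp[OF k]] complex_cnj_zero)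
  qed
  have e: "cis (snd x) = ee 0 1 x" for x by (simp add: ee_def)
  have "Top2 p n m f = rf h"
    unfolding Top2_def e
  proof (rule the_equality)
    fix g assume "g \<in> Gsp p n m \<and> (\<forall>k\<in>Gsp p n m. ipw p (\<lambda>x. ee 0 1 x * tor f x - tor g x) (tor k) = 0)"
    thus "g = rf h" using projection_unique[OF inL2_ee_tor[OF f]] rf_Gsp[OF h(1)] orth' by blast
  qed (use rf_Gsp[OF h(1)] orth' in blast)
  thus ?thesis using rf_Gsp[OF h(1)] orth' by simp
qed

text \<open>The adjoint of the compression of z2 is the compression of its conjugate, and in the
  variables (z1, 1/z2) this is multiplication by the second variable.\<close>

lemma Top2adj_spec:
  assumes f: "f \<in> Gsp p n m"
  shows "Top2adj p n m f \<in> Gsp p n m \<and> zy 0 * fl f - fl (Top2adj p n m f) \<in> N"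
proof -
  obtain h where h: "h \<in> Gsp p n m" "zy 0 * fl f - fl h \<in> N"
    "\<And>k. k \<in> Gsp p n m \<Longrightarrow> ipw p (\<lambda>x. ee 0 (- 1) x * tor f x - tor h x) (tor k) = 0"
    using module_projection[OF surj orth tf_zy0 f] by blast
  have adj: "ipw p (tor h) (tor k) = ipw p (tor f) (tor (Top2 p n m k))" if k: "k \<in> Gsp p n m" for k
  proof -
    have L: "inL2 p (tor f)" "inL2 p (tor h)" "inL2 p (tor k)" "inL2 p (tor (Top2 p n m k))"
      using f h(1) k Top2_spec[OF k] by (simp_all add: Gsp_iff)
    have "ipw p (tor h) (tor k) = ipw p (\<lambda>x. ee 0 (- 1) x * tor f x) (tor k)"
      using h(3)[OF k] ipw_diff_left[OF inL2_ee_tor[OF f] L(2,3), of 0 "- 1"] by simp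
    also have "\<dots> = ipw p (\<lambda>x. ee 0 1 x * (ee 0 (- 1) x * tor f x)) (\<lambda>x. ee 0 1 x * tor k x)"
      by (rule ipw_ee[symmetric])
    also have "\<dots> = ipw p (tor f) (\<lambda>x. ee 0 1 x * tor k x)"
      by (simp add: mult.assoc[symmetric] ee_mult)
    also have "\<dots> = ipw p (tor f) (tor (Top2 p n m k))"
    proof -
      have "ipw p (\<lambda>x. ee 0 1 x * tor k x - tor (Top2 p n m k) x) (tor f) = 0"
        using Top2_spec[OF k] f by blast
      hence "ipw p (\<lambda>x. ee 0 1 x * tor k x) (tor f) = ipw p (tor (Top2 p n m k)) (tor f)"
        using ipw_diff_left[OF inL2_ee_tor[OF k] L(4,1), of 0 1] by simp
      thus ?thesis by (metis ipw_commute)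
    qed
    finally show ?thesis .
  qed
  have "Top2adj p n m f = h"
    unfolding Top2adj_def
  proof (rule the_equality)
    fix g assume g: "g \<in> Gsp p n m \<and> (\<forall>k\<in>Gsp p n m. ipw p (tor g) (tor k) = ipw p (tor f) (tor (Top2 p n m k)))"
    show "g = h"
    proof (rule Gsp_eqI[OF _ h(1)])
      fix k assume k: "k \<in> Gsp p n m"
      have "ipw p (tor g) (tor k) = ipw p (tor h) (tor k)" using g adj[OF k] k by simp
      thus "ipw p (\<lambda>x. tor g x - tor h x) (tor k) = 0"
        using g h(1) k by (simp add: ipw_diff_left Gsp_iff)
    qed (use g in blast)
  qed (use h(1) adj in blast)
  thus ?thesis using h by simp
qed

end

end

theorem theorem13p1:
  fixes p :: "complex poly poly" and n m :: nat
  assumes "has_bidegree p n m" and "semi_stable p n m"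
  shows "(\<forall>l \<in> common_zeros_bidisk (flip2 p n m) (flip2 (refl2 p n m) n m).
            int_mult l (flip2 p n m) (flip2 (refl2 p n m) n m) = cdim (Gloc p n m l))
       \<and> finite (common_zeros_bidisk (flip2 p n m) (flip2 (refl2 p n m) n m))
       \<and> cdim (Gsp p n m) =
           (\<Sum>l \<in> common_zeros_bidisk (flip2 p n m) (flip2 (refl2 p n m) n m).
               int_mult l (flip2 p n m) (flip2 (refl2 p n m) n m))"
proof -
  interpret disc_nz p n m
    using assms has_bidegree_box by unfold_locales (auto simp: semi_stable_def)
  have "coprime (flip2 p n m) (flip2 (refl2 p n m) n m)"
    using assms nz[of 0 0] by (intro coprime_flips) (auto simp: semi_stable_def)
  hence cop: "coprime q qt" by (simp add: q_def qt_def)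
  obtain N v A B where N: "is_ideal N" "q \<in> N" "qt \<in> N" "\<forall>f\<in>N. v * f \<in> ideal2 q qt"
    and v: "\<forall>z1 z2. cmod z1 < 1 \<longrightarrow> cmod z2 < 1 \<longrightarrow> eval2 v z1 z2 \<noteq> 0"
    and disc: "\<forall>x\<in>#A. cmod x < 1" "\<forall>y\<in>#B. cmod y < 1"
    and prods: "(\<Prod>x\<in>#A. zx x) \<in> N" "(\<Prod>y\<in>#B. zy y) \<in> N"
    and surj: "\<And>f. \<exists>g\<in>pbox n m. inL2 p (tf g) \<and> f - g \<in> N"
    and orth: "\<And>f g. f \<in> N \<Longrightarrow> inL2 p (tf f) \<Longrightarrow> g \<in> pbox n m \<Longrightarrow> inL2 p (tf g) \<Longrightarrow> ipw p (tf f) (tf g) = 0"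
    using decomposition[OF cop] by blast
  interpret quotient_model q qt v N "Gsp p n m" A B fl "Top1 p n m" "Top2adj p n m"
  proof
    show "is_ideal N" "q \<in> N" "qt \<in> N" "(\<Prod>x\<in>#A. zx x) \<in> N" "(\<Prod>y\<in>#B. zy y) \<in> N"
      by (fact N prods)+
    show "v * f \<in> ideal2 q qt" if "f \<in> N" for f using N(4) that by blast
    show "eval2 v z1 z2 \<noteq> 0" if "cmod z1 < 1" "cmod z2 < 1" for z1 z2 using v that by blast
    show "cs.subspace (Gsp p n m)" by (rule Gsp_subspace)
    have "Gsp p n m \<subseteq> pbox n m" by (auto simp: Gsp_iff)
    thus "\<exists>S. finite S \<and> Gsp p n m \<subseteq> cs.span S" using pbox_span[of n m] by blast
    show "fl (f + g) = fl f + fl g" "fl (cscale c f) = cscale c (fl f)" for f g c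
      by (rule fl_add, rule fl_scale)
    show "\<exists>g\<in>Gsp p n m. f - fl g \<in> N" for f
    proof -
      obtain g where "g \<in> pbox n m" "inL2 p (tf g)" "f - g \<in> N" using surj by blast
      thus ?thesis using fl_Gsp[of g] fl_fl[of g] by (intro bexI[of _ "fl g"]) simp_all
    qed
    show "Top1 p n m g \<in> Gsp p n m \<and> zx 0 * fl g - fl (Top1 p n m g) \<in> N" if "g \<in> Gsp p n m" for g
      by (rule Top1_spec[OF surj orth that])
    show "Top2adj p n m g \<in> Gsp p n m \<and> zy 0 * fl g - fl (Top2adj p n m g) \<in> N" if "g \<in> Gsp p n m" for g
      by (rule Top2adj_spec[OF surj orth that])
    \<comment> \<open>If \<open>fl g\<close> lies in \<open>N\<close>, it is orthogonal to the
      images of all of \<open>Gsp\<close>, so \<open>g\<close> is orthogonal to itself.\<close>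
    show "g = 0" if g: "g \<in> Gsp p n m" "fl g \<in> N" for g
    proof (rule Gsp_eqI[OF g(1) cs.subspace_0[OF Gsp_subspace]])
      fix k assume k: "k \<in> Gsp p n m"
      have gb: "g \<in> pbox n m" "inL2 p (tf (fl g))" and kb: "k \<in> pbox n m" "inL2 p (tf (fl k))"
        using g k by (simp_all add: Gsp_iff inL2_tf_fl)
      have "ipw p (tf (fl g)) (tf (fl k)) = 0" by (rule orth[OF g(2) gb(2) fl_pbox[OF kb(1)] kb(2)])
      moreover have "tf (fl h) = (\<lambda>x. ee 0 (- int (m - 1)) x * tor h x)" if "h \<in> pbox n m" for h
        using tf_fl[OF that] by blast
      ultimately have "ipw p (tor g) (tor k) = 0" using gb kb by (simp only: ipw_ee)
      moreover have "(\<lambda>x. tor g x - tor 0 x) = tor g" by (auto simp: tor_def)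
      ultimately show "ipw p (\<lambda>x. tor g x - tor 0 x) (tor k) = 0" by (simp only:)
    qed
  qed
  have "Gl l = Gloc p n m l" for l
    unfolding Gl_def Gloc_def ..
  thus ?thesis using main[OF disc] unfolding cdim_eq q_def qt_def by simp
qed

end
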